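(* Let $T:=[T_1,\ldots,T_n]$, $T_i\in B(\mathcal H)$, be a row contraction with $\mathrm{rank}\,\Delta_T<\infty$, and let $\mathrm{curv}(T)$ and $\chi(T)$ denote its curvature and Euler characteristic, respectively. Then $$\mathrm{curv}(T)=\mathrm{rank}\,\Delta_T-\lim_{m\to\infty}\frac{\mathrm{trace}\,[\Theta_T\Theta_T^*(P_m\otimes I)]}{n^m}$$ and $$\chi(T)=\lim_{m\to\infty}\frac{\mathrm{rank}\,[(I-\Theta_T\Theta_T^* )(P_{\le m}\otimes I)]}{1+n+\cdots+n^{m}},$$ where $\Theta_T$ is the characteristic function of $T$ and $P_m$ (resp. $P_{\le m}$) is the orthogonal projection of the full Fock space $F^2(H_n)$ onto the subspace of all homogeneous polynomials of degree $m$ (resp. polynomials of degree $\le m$).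
   Context: Let $n\in\{1,2,\dots\}$ and let $F^2(H_n)=\bigoplus_{k\ge 0}H_n^{\otimes k}$ be the full Fock space of an $n$-dimensional complex Hilbert space $H_n$ with orthonormal basis $e_1,\dots,e_n$ (with $H_n^{\otimes 0}=\mathbb C1$); homogeneous polynomials of degree $m$ are the elements of $H_n^{\otimes m}$, polynomials of degree $\le m$ the elements of $\bigoplus_{k\le m}H_n^{\otimes k}$. $R_i\varphi=\varphi\otimes e_i$ are the right creation operators. $T=[T_1,\dots,T_n]$, viewed as an operator $\mathcal H^{(n)}\to\mathcal H$ ($\mathcal H^{(n)}$ the direct sum of $n$ copies of $\mathcal H$), is a row contraction if $TT^*=\sum_iT_iT_i^*\le I$. Set $\Delta_T=(I-TT^* )^{1/2}$, $\Delta_{T^*}=(I-T^*T)^{1/2}\in B(\mathcal H^{(n)})$, $\mathcal D_T=\overline{\Delta_T\mathcal H}$, $\mathcal D_{T^*}=\overline{\Delta_{T^*}\mathcal H^{(n)}}$. The characteristic function $\Theta_T:F^2(H_n)\otimes\mathcal D_{T^*}\to F^2(H_n)\otimes\mathcal D_T$ is the bounded operator with formal Fourier representation $$-I\otimes T+(I\otimes\Delta_T)\Big(I-\sum_{i=1}^nR_i\otimes T_i^*\Big)^{-1}[R_1\otimes I_{\mathcal H},\dots,R_n\otimes I_{\mathcal H}](I\otimes\Delta_{T^*}),$$ meaning that $\Theta_T$ is the SOT-limit as $r\to1$, $r<1$, of the operators obtained by replacing each $R_i$ by $rR_i$ in this formula (restricted to $F^2(H_n)\otimes\mathcal D_{T^*}$).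 With $\Phi_T(X)=\sum_{i=1}^nT_iXT_i^*$, the curvature and Euler characteristic are $$\mathrm{curv}(T)=\lim_{m\to\infty}\frac{\mathrm{trace}[I-\Phi_T^m(I)]}{1+n+\cdots+n^{m-1}},\qquad \chi(T)=\lim_{m\to\infty}\frac{\mathrm{rank}[I-\Phi_T^m(I)]}{1+n+\cdots+n^{m-1}}$$ (these limits exist). *)

theory Defs
  imports "HOL-Analysis.Analysis"
begin

section \<open>Complex inner product spaces and Hilbert spaces\<close>

text \<open>The inner product is linear in the first and conjugate linear in the second argument.
  Nonnegativity and definiteness of the inner product follow from \<open>cinner_self\<close>.\<close>

class complex_inner = real_normed_vector +
  fixes scaleC :: "complex \<Rightarrow> 'a \<Rightarrow> 'a" (infixr \<open>*\<^sub>C\<close> 75)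
    and cinner :: "'a \<Rightarrow> 'a \<Rightarrow> complex"
  assumes scaleC_add_right: "c *\<^sub>C (x + y) = c *\<^sub>C x + c *\<^sub>C y"
    and scaleC_add_left: "(c + d) *\<^sub>C x = c *\<^sub>C x + d *\<^sub>C x"
    and scaleC_scaleC: "c *\<^sub>C d *\<^sub>C x = (c * d) *\<^sub>C x"
    and scaleC_one: "1 *\<^sub>C x = x"
    and scaleR_scaleC: "r *\<^sub>R x = complex_of_real r *\<^sub>C x"
    and cinner_commute: "cinner x y = cnj (cinner y x)"
    and cinner_add_left: "cinner (x + y) z = cinner x z + cinner y z"
    and cinner_scaleC_left: "cinner (c *\<^sub>C x) y = c * cinner x y"
    and cinner_self: "cinner x x = complex_of_real ((norm x)\<^sup>2)"

class chilbert_space = complex_inner + complete_space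

global_interpretation complex_vector:
  vector_space "scaleC :: complex \<Rightarrow> 'a \<Rightarrow> 'a::complex_inner"
  by unfold_locales (simp_all add: scaleC_add_right scaleC_add_left scaleC_scaleC scaleC_one)

lemma cinner_add_right: "cinner x (y + z) = cinner x y + cinner x (z::'a::complex_inner)"
  by (metis cinner_add_left cinner_commute complex_cnj_add)

lemma cinner_scaleC_right: "cinner x (c *\<^sub>C y) = cnj c * cinner x (y::'a::complex_inner)"
  by (metis cinner_scaleC_left cinner_commute complex_cnj_mult)

lemma norm_scaleC: "norm (c *\<^sub>C x) = cmod c * norm (x::'a::complex_inner)"
proof -
  have "complex_of_real ((norm (c *\<^sub>C x))\<^sup>2) = c * cnj c * cinner x x"
    by (simp only: cinner_self[symmetric] cinner_scaleC_left cinner_scaleC_right mult.assoc mult.left_commute)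
  also have "\<dots> = complex_of_real ((cmod c * norm x)\<^sup>2)"
    by (simp add: cinner_self complex_norm_square[symmetric] power_mult_distrib)
  finally have "complex_of_real ((norm (c *\<^sub>C x))\<^sup>2) = complex_of_real ((cmod c * norm x)\<^sup>2)" .
  then have "(norm (c *\<^sub>C x))\<^sup>2 = (cmod c * norm x)\<^sup>2"
    by (simp only: of_real_eq_iff)
  then show ?thesis
    by (simp add: power2_eq_iff_nonneg)
qed

lemma cmod_cinner_le: "cmod (cinner x y) \<le> (norm x)\<^sup>2 + (norm (y::'a::complex_inner))\<^sup>2"
proof -
  define u where "u = (if cinner x y = 0 then 1 else cinner x y / cmod (cinner x y))"
  have u: "cmod u = 1" by (simp add: u_def norm_divide)
  have n: "norm (u *\<^sub>C y) = norm y" by (simp add: norm_scaleC u)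
  have inn: "cinner x (u *\<^sub>C y) = cmod (cinner x y)"
  proof (cases "cinner x y = 0")
    case False
    have "cnj (cinner x y) * cinner x y = (cmod (cinner x y))\<^sup>2"
      by (metis complex_norm_square mult.commute)
    with False show ?thesis
      by (simp add: cinner_scaleC_right u_def power2_eq_square)
  qed (simp add: cinner_scaleC_right)
  define z where "z = u *\<^sub>C y"
  have "complex_of_real ((norm (x + z))\<^sup>2) = cinner (x + z) (x + z)"
    by (simp only: cinner_self)
  also have "\<dots> = cinner x x + cinner x z + cnj (cinner x z) + cinner z z"
    using cinner_commute[of z x] by (simp add: cinner_add_left cinner_add_right)
  also have "\<dots> = complex_of_real ((norm x)\<^sup>2 + 2 * cmod (cinner x y) + (norm y)\<^sup>2)"
    using inn n by (simp add: z_def cinner_self)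
  finally have *: "(norm (x + z))\<^sup>2 = (norm x)\<^sup>2 + 2 * cmod (cinner x y) + (norm y)\<^sup>2"
    by (simp only: of_real_eq_iff)
  have "(norm (x + z))\<^sup>2 \<le> (norm x + norm y)\<^sup>2"
    using norm_triangle_ineq[of x z] n by (intro power_mono) (auto simp: z_def)
  also have "\<dots> \<le> 2 * (norm x)\<^sup>2 + 2 * (norm y)\<^sup>2"
    using sum_squares_bound[of "norm x" "norm y"] by (simp add: power2_sum)
  finally have "2 * cmod (cinner x y) \<le> (norm x)\<^sup>2 + (norm y)\<^sup>2"
    using * by simp
  then show ?thesis
    by (smt (verit) norm_ge_zero)
qed

instantiation complex :: chilbert_space
begin
definition scaleC_complex :: "complex \<Rightarrow> complex \<Rightarrow> complex" where
  "scaleC_complex c x = c * x"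
definition cinner_complex :: "complex \<Rightarrow> complex \<Rightarrow> complex" where
  "cinner_complex x y = x * cnj y"
instance
  by standard (auto simp: scaleC_complex_def cinner_complex_def algebra_simps scaleR_conv_of_real
      complex_norm_square simp del: of_real_power)
end

text \<open>The direct sum of finitely many copies of a Hilbert space; the norm of the library on
  \<^typ>\<open>'a ^ 'n\<close> is already the Euclidean one.\<close>

instantiation vec :: (complex_inner, finite) complex_inner
begin
definition scaleC_vec :: "complex \<Rightarrow> 'a ^ 'b \<Rightarrow> 'a ^ 'b" where
  "scaleC_vec c x = (\<chi> i. c *\<^sub>C x $ i)"
definition cinner_vec :: "'a ^ 'b \<Rightarrow> 'a ^ 'b \<Rightarrow> complex" where
  "cinner_vec x y = (\<Sum>i\<in>UNIV. cinner (x $ i) (y $ i))"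
instance
proof
  fix x y z :: "'a ^ 'b" and c d :: complex and r :: real
  show "c *\<^sub>C (x + y) = c *\<^sub>C x + c *\<^sub>C y" "(c + d) *\<^sub>C x = c *\<^sub>C x + d *\<^sub>C x"
    "c *\<^sub>C d *\<^sub>C x = (c * d) *\<^sub>C x" "1 *\<^sub>C x = x" "r *\<^sub>R x = complex_of_real r *\<^sub>C x"
    by (simp_all add: scaleC_vec_def vec_eq_iff scaleC_add_right scaleC_add_left scaleC_scaleC
        scaleC_one scaleR_scaleC)
  show "cinner x y = cnj (cinner y x)"
    unfolding cinner_vec_def cnj_sum by (rule sum.cong[OF refl]) (rule cinner_commute)
  show "cinner (x + y) z = cinner x z + cinner y z" "cinner (c *\<^sub>C x) y = c * cinner x y"
    by (simp_all add: cinner_vec_def scaleC_vec_def cinner_add_left cinner_scaleC_left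
        sum.distrib sum_distrib_left)
  show "cinner x x = complex_of_real ((norm x)\<^sup>2)"
    by (simp add: cinner_vec_def norm_vec_def L2_set_def cinner_self sum_nonneg)
qed
end

instance vec :: (chilbert_space, finite) chilbert_space ..


section \<open>Square-summable families\<close>

typedef (overloaded) ('i, 'a) ell2 =
  "{f :: 'i \<Rightarrow> 'a::complex_inner. (\<lambda>i. (norm (f i))\<^sup>2) summable_on UNIV}"
  morphisms coord Abs_ell2
  by (rule exI[of _ "\<lambda>_. 0"]) simp

setup_lifting type_definition_ell2

lemma ell2_add_closed:
  fixes f g :: "'i \<Rightarrow> 'a::complex_inner"
  assumes "(\<lambda>i. (norm (f i))\<^sup>2) summable_on UNIV" "(\<lambda>i. (norm (g i))\<^sup>2) summable_on UNIV"
  shows "(\<lambda>i. (norm (f i + g i))\<^sup>2) summable_on UNIV"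
proof (rule summable_on_comparison_test)
  show "(\<lambda>i. 2 * (norm (f i))\<^sup>2 + 2 * (norm (g i))\<^sup>2) summable_on UNIV"
    by (intro summable_on_add summable_on_cmult_right assms)
  fix i
  have "(norm (f i + g i))\<^sup>2 \<le> (norm (f i) + norm (g i))\<^sup>2"
    by (intro power_mono norm_triangle_ineq) simp
  also have "\<dots> \<le> 2 * (norm (f i))\<^sup>2 + 2 * (norm (g i))\<^sup>2"
    using sum_squares_bound[of "norm (f i)" "norm (g i)"] by (simp add: power2_sum)
  finally show "(norm (f i + g i))\<^sup>2 \<le> 2 * (norm (f i))\<^sup>2 + 2 * (norm (g i))\<^sup>2" .
qed simp

lemma ell2_scaleC_closed:
  fixes f :: "'i \<Rightarrow> 'a::complex_inner"
  assumes "(\<lambda>i. (norm (f i))\<^sup>2) summable_on UNIV"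
  shows "(\<lambda>i. (norm (c *\<^sub>C f i))\<^sup>2) summable_on UNIV"
  using summable_on_cmult_right[OF assms, of "(cmod c)\<^sup>2"]
  by (simp add: norm_scaleC power_mult_distrib)

instantiation ell2 :: (type, complex_inner) complex_inner
begin

lift_definition zero_ell2 :: "('a, 'b) ell2" is "\<lambda>_. 0" by simp
lift_definition plus_ell2 :: "('a, 'b) ell2 \<Rightarrow> ('a, 'b) ell2 \<Rightarrow> ('a, 'b) ell2"
  is "\<lambda>f g i. f i + g i" by (rule ell2_add_closed)
lift_definition uminus_ell2 :: "('a, 'b) ell2 \<Rightarrow> ('a, 'b) ell2"
  is "\<lambda>f i. - f i" by simp
lift_definition minus_ell2 :: "('a, 'b) ell2 \<Rightarrow> ('a, 'b) ell2 \<Rightarrow> ('a, 'b) ell2"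
  is "\<lambda>f g i. f i - g i"
  subgoal for f g using ell2_add_closed[of f "\<lambda>i. - g i"] by simp
  done
lift_definition scaleC_ell2 :: "complex \<Rightarrow> ('a, 'b) ell2 \<Rightarrow> ('a, 'b) ell2"
  is "\<lambda>c f i. c *\<^sub>C f i" by (rule ell2_scaleC_closed)
lift_definition scaleR_ell2 :: "real \<Rightarrow> ('a, 'b) ell2 \<Rightarrow> ('a, 'b) ell2"
  is "\<lambda>r f i. r *\<^sub>R f i"
  unfolding scaleR_scaleC by (rule ell2_scaleC_closed)
lift_definition norm_ell2 :: "('a, 'b) ell2 \<Rightarrow> real"
  is "\<lambda>f. sqrt (\<Sum>\<^sub>\<infinity>i. (norm (f i))\<^sup>2)" .
lift_definition cinner_ell2 :: "('a, 'b) ell2 \<Rightarrow> ('a, 'b) ell2 \<Rightarrow> complex"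
  is "\<lambda>f g. \<Sum>\<^sub>\<infinity>i. cinner (f i) (g i)" .
definition dist_ell2 :: "('a, 'b) ell2 \<Rightarrow> ('a, 'b) ell2 \<Rightarrow> real" where
  "dist_ell2 x y = norm (x - y)"
definition sgn_ell2 :: "('a, 'b) ell2 \<Rightarrow> ('a, 'b) ell2" where
  "sgn_ell2 x = scaleR (inverse (norm x)) x"
definition [code del]: "(uniformity :: (('a, 'b) ell2 \<times> ('a, 'b) ell2) filter)
  = (INF e\<in>{0 <..}. principal {(x, y). dist x y < e})"
definition [code del]: "open (U :: ('a, 'b) ell2 set)
  \<longleftrightarrow> (\<forall>x\<in>U. eventually (\<lambda>(x', y). x' = x \<longrightarrow> y \<in> U) uniformity)"

lemma L2_set_le_ell2: "finite F \<Longrightarrow> L2_set (\<lambda>i. norm (coord x i)) F \<le> norm (x :: ('a, 'b) ell2)"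
  unfolding L2_set_def by transfer (auto intro!: finite_sum_le_infsum)

lemma ell2_boundI:
  fixes f :: "'a \<Rightarrow> 'b"
  assumes "\<And>F. finite F \<Longrightarrow> L2_set (\<lambda>i. norm (f i)) F \<le> B"
  shows "(\<lambda>i. (norm (f i))\<^sup>2) summable_on UNIV \<and> sqrt (\<Sum>\<^sub>\<infinity>i. (norm (f i))\<^sup>2) \<le> B"
proof -
  have B: "0 \<le> B" using assms[of "{}"] by simp
  have le: "(\<Sum>i\<in>F. (norm (f i))\<^sup>2) \<le> B\<^sup>2" if "finite F" for F
    using assms[OF that] B unfolding L2_set_def by (simp add: sqrt_le_D)
  have s: "(\<lambda>i. (norm (f i))\<^sup>2) summable_on UNIV"
    by (rule nonneg_bdd_above_summable_on) (auto intro!: bdd_aboveI[where M = "B\<^sup>2"] le)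
  moreover have "(\<Sum>\<^sub>\<infinity>i. (norm (f i))\<^sup>2) \<le> B\<^sup>2"
    using s le by (intro infsum_le_finite_sums) auto
  ultimately show ?thesis
    using B by (simp add: real_le_lsqrt infsum_nonneg)
qed

instance
proof
  fix x y z :: "('a, 'b) ell2" and a b r :: real and c d :: complex
  show "x + y + z = x + (y + z)" "x + y = y + x" "0 + x = x" "- x + x = 0" "x - y = x + - y"
    by (transfer, simp add: algebra_simps)+
  show "a *\<^sub>R (x + y) = a *\<^sub>R x + a *\<^sub>R y" "(a + b) *\<^sub>R x = a *\<^sub>R x + b *\<^sub>R x"
    "a *\<^sub>R b *\<^sub>R x = (a * b) *\<^sub>R x" "1 *\<^sub>R x = x"
    by (transfer, simp add: algebra_simps)+
  show "dist x y = norm (x - y)" "sgn x = scaleR (inverse (norm x)) x"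
    by (simp_all add: dist_ell2_def sgn_ell2_def)
  show "uniformity = (INF e\<in>{0 <..}. principal {(x, y :: ('a, 'b) ell2). dist x y < e})"
    by (simp add: uniformity_ell2_def)
  show "open U \<longleftrightarrow> (\<forall>x\<in>U. eventually (\<lambda>(x', y). x' = x \<longrightarrow> y \<in> U) uniformity)"
    for U :: "('a, 'b) ell2 set"
    by (simp add: open_ell2_def)
  show "norm x = 0 \<longleftrightarrow> x = 0"
  proof
    assume "norm x = 0"
    then have "norm (coord x i) \<le> 0" for i
      using L2_set_le_ell2[of "{i}" x] by (simp add: L2_set_def)
    then show "x = 0"
      by transfer (simp add: fun_eq_iff)
  qed (transfer, simp)
  show "norm (x + y) \<le> norm x + norm y"
  proof -
    have "L2_set (\<lambda>i. norm (coord x i + coord y i)) F \<le> norm x + norm y" if "finite F" for F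
    proof -
      have "L2_set (\<lambda>i. norm (coord x i + coord y i)) F
          \<le> L2_set (\<lambda>i. norm (coord x i) + norm (coord y i)) F"
        by (intro L2_set_mono norm_triangle_ineq) simp
      also have "\<dots> \<le> L2_set (\<lambda>i. norm (coord x i)) F + L2_set (\<lambda>i. norm (coord y i)) F"
        by (rule L2_set_triangle_ineq)
      also have "\<dots> \<le> norm x + norm y"
        using that by (intro add_mono L2_set_le_ell2)
      finally show ?thesis .
    qed
    then show ?thesis
      using ell2_boundI[of "\<lambda>i. coord x i + coord y i" "norm x + norm y"]
      by (simp add: norm_ell2.rep_eq plus_ell2.rep_eq)
  qed
  show "norm (a *\<^sub>R x) = \<bar>a\<bar> * norm x"
    by transfer (simp add: power_mult_distrib infsum_cmult_right' real_sqrt_mult)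
  show "c *\<^sub>C (x + y) = c *\<^sub>C x + c *\<^sub>C y" "(c + d) *\<^sub>C x = c *\<^sub>C x + d *\<^sub>C x"
    "c *\<^sub>C d *\<^sub>C x = (c * d) *\<^sub>C x" "1 *\<^sub>C x = x" "r *\<^sub>R x = complex_of_real r *\<^sub>C x"
    by (transfer, simp add: scaleC_add_right scaleC_add_left scaleC_scaleC scaleC_one scaleR_scaleC)+
  have sm: "(\<lambda>i. cinner (coord u i) (coord v i)) summable_on UNIV" for u v :: "('a, 'b) ell2"
  proof (rule abs_summable_summable, rule summable_on_comparison_test)
    show "(\<lambda>i. (norm (coord u i))\<^sup>2 + (norm (coord v i))\<^sup>2) summable_on UNIV"
      using coord[of u] coord[of v] by (intro summable_on_add) auto
  qed (simp_all add: cmod_cinner_le)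
  show "cinner x y = cnj (cinner y x)"
    unfolding cinner_ell2.rep_eq infsum_cnj[symmetric]
    by (rule infsum_cong) (rule cinner_commute)
  show "cinner (x + y) z = cinner x z + cinner y z"
    by (simp add: cinner_ell2.rep_eq plus_ell2.rep_eq cinner_add_left infsum_add sm)
  show "cinner (c *\<^sub>C x) y = c * cinner x y"
    by (simp add: cinner_ell2.rep_eq scaleC_ell2.rep_eq cinner_scaleC_left infsum_cmult_right')
  show "cinner x x = complex_of_real ((norm x)\<^sup>2)"
  proof -
    have "(\<Sum>\<^sub>\<infinity>i. complex_of_real ((norm (coord x i))\<^sup>2))
        = complex_of_real (\<Sum>\<^sub>\<infinity>i. (norm (coord x i))\<^sup>2)"
      using coord[of x] by (intro infsumI has_sum_of_real has_sum_infsum) simp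
    then show ?thesis
      by (simp add: cinner_ell2.rep_eq norm_ell2.rep_eq cinner_self infsum_nonneg)
  qed
qed

end

instance ell2 :: (type, chilbert_space) chilbert_space
proof
  fix X :: "nat \<Rightarrow> ('a, 'b) ell2"
  assume X: "Cauchy X"
  have le: "norm (coord x i) \<le> norm x" for x :: "('a, 'b) ell2" and i
    using L2_set_le_ell2[of "{i}" x] by (simp add: L2_set_def)
  have "Cauchy (\<lambda>n. coord (X n) i)" for i
  proof (rule metric_CauchyI)
    fix e :: real assume "e > 0"
    with X obtain M where M: "\<And>m n. m \<ge> M \<Longrightarrow> n \<ge> M \<Longrightarrow> dist (X m) (X n) < e"
      by (meson metric_CauchyD)
    show "\<exists>M. \<forall>m\<ge>M. \<forall>n\<ge>M. dist (coord (X m) i) (coord (X n) i) < e"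
    proof (intro exI allI impI)
      fix m n assume mn: "m \<ge> M" "n \<ge> M"
      have "dist (coord (X m) i) (coord (X n) i) \<le> dist (X m) (X n)"
        using le[of "X m - X n" i] by (simp add: dist_norm minus_ell2.rep_eq)
      also have "\<dots> < e" using M mn by blast
      finally show "dist (coord (X m) i) (coord (X n) i) < e" .
    qed
  qed
  then have "\<forall>i. \<exists>l. (\<lambda>n. coord (X n) i) \<longlonglongrightarrow> l"
    using Cauchy_convergent convergent_def by blast
  then obtain f where f: "\<And>i. (\<lambda>n. coord (X n) i) \<longlonglongrightarrow> f i"
    by metis
  have key: "\<exists>M. \<forall>n\<ge>M. \<forall>F. finite F \<longrightarrow> L2_set (\<lambda>i. norm (coord (X n) i - f i)) F \<le> e"
    if "e > 0" for e :: real
  proof -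
    from X that obtain M where M: "\<And>m n. m \<ge> M \<Longrightarrow> n \<ge> M \<Longrightarrow> norm (X n - X m) < e"
      by (metis metric_CauchyD dist_norm)
    show ?thesis
    proof (intro exI allI impI)
      fix n and F :: "'a set" assume n: "n \<ge> M" and F: "finite F"
      have lim: "(\<lambda>m. L2_set (\<lambda>i. norm (coord (X n) i - coord (X m) i)) F)
          \<longlonglongrightarrow> L2_set (\<lambda>i. norm (coord (X n) i - f i)) F"
        unfolding L2_set_def by (intro tendsto_intros f)
      show "L2_set (\<lambda>i. norm (coord (X n) i - f i)) F \<le> e"
      proof (rule LIMSEQ_le_const2[OF lim], intro exI allI impI)
        fix m assume "m \<ge> M"
        then have "norm (X n - X m) < e" using M n by blast
        then show "L2_set (\<lambda>i. norm (coord (X n) i - coord (X m) i)) F \<le> e"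
          using L2_set_le_ell2[OF F, of "X n - X m"] by (simp add: minus_ell2.rep_eq)
      qed
    qed
  qed
  obtain N where N: "\<And>F. finite F \<Longrightarrow> L2_set (\<lambda>i. norm (coord (X N) i - f i)) F \<le> 1"
    using key[of 1] by auto
  have "(\<lambda>i. (norm (coord (X N) i - f i))\<^sup>2) summable_on UNIV"
    using ell2_boundI[OF N] by blast
  then have "(\<lambda>i. (norm (- (coord (X N) i - f i) + coord (X N) i))\<^sup>2) summable_on UNIV"
    using coord[of "X N"] by (intro ell2_add_closed) (simp_all add: norm_minus_commute)
  then have f2: "coord (Abs_ell2 f) = f"
    by (intro Abs_ell2_inverse) simp
  have "X \<longlonglongrightarrow> Abs_ell2 f"
  proof (rule metric_LIMSEQ_I)
    fix e :: real assume "e > 0"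
    then obtain M where M: "\<And>n F. n \<ge> M \<Longrightarrow> finite F \<Longrightarrow>
        L2_set (\<lambda>i. norm (coord (X n) i - f i)) F \<le> e / 2"
      using key[of "e / 2"] by auto
    have "dist (X n) (Abs_ell2 f) < e" if "n \<ge> M" for n
      using ell2_boundI[OF M[OF that]] \<open>e > 0\<close>
      by (simp add: dist_norm norm_ell2.rep_eq minus_ell2.rep_eq f2)
    then show "\<exists>M. \<forall>n\<ge>M. dist (X n) (Abs_ell2 f) < e" by blast
  qed
  then show "convergent X" by (rule convergentI)
qed


section \<open>Operators\<close>

text \<open>Operators between Hilbert spaces are functions; an operator between closed subspaces is a
  function on the ambient type of which only the values on the domain matter.\<close>

definition bounded_clinear :: "('a::complex_inner \<Rightarrow> 'b::complex_inner) \<Rightarrow> bool" where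
  "bounded_clinear A \<longleftrightarrow> bounded_linear A \<and> (\<forall>c x. A (c *\<^sub>C x) = c *\<^sub>C A x)"

definition adj_on :: "'a set \<Rightarrow> ('a::complex_inner \<Rightarrow> 'b::complex_inner) \<Rightarrow> 'b \<Rightarrow> 'a" where
  "adj_on M A y = (THE x. x \<in> M \<and> (\<forall>z\<in>M. cinner (A z) y = cinner z x))"

abbreviation adj :: "('a::complex_inner \<Rightarrow> 'b::complex_inner) \<Rightarrow> 'b \<Rightarrow> 'a" where
  "adj \<equiv> adj_on UNIV"

definition positive_op :: "('a::complex_inner \<Rightarrow> 'a) \<Rightarrow> bool" where
  "positive_op A \<longleftrightarrow> bounded_clinear A \<and> (\<forall>x. cinner (A x) x \<in> \<real>\<^sub>\<ge>\<^sub>0)"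

definition sqrt_op :: "('a::complex_inner \<Rightarrow> 'a) \<Rightarrow> 'a \<Rightarrow> 'a" where
  "sqrt_op A = (THE B. positive_op B \<and> (\<forall>x. B (B x) = A x))"

definition finite_rank_on :: "'a set \<Rightarrow> ('a \<Rightarrow> 'b::complex_inner) \<Rightarrow> bool" where
  "finite_rank_on M A \<longleftrightarrow> (\<exists>B. finite B \<and> A ` M \<subseteq> complex_vector.span B)"

text \<open>Meaningful for operators satisfying \<^const>\<open>finite_rank_on\<close> (the value is \<open>0\<close> otherwise).\<close>

definition rank_on :: "'a set \<Rightarrow> ('a \<Rightarrow> 'b::complex_inner) \<Rightarrow> nat" where
  "rank_on M A = complex_vector.dim (A ` M)"

definition is_onb :: "'a::complex_inner set \<Rightarrow> 'a set \<Rightarrow> bool" where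
  "is_onb M B \<longleftrightarrow> B \<subseteq> M \<and> (\<forall>x\<in>B. norm x = 1) \<and> (\<forall>x\<in>B. \<forall>y\<in>B. x \<noteq> y \<longrightarrow> cinner x y = 0)
     \<and> closure (complex_vector.span B) = M"

text \<open>The trace of an operator on the closed subspace \<open>M\<close>; for trace class operators it does not
  depend on the orthonormal basis.\<close>

definition trace_on :: "'a::complex_inner set \<Rightarrow> ('a \<Rightarrow> 'a) \<Rightarrow> complex" where
  "trace_on M A = (\<Sum>\<^sub>\<infinity>e\<in>(SOME B. is_onb M B). cinner (A e) e)"


section \<open>Full Fock space and tensor products\<close>

text \<open>The type variable \<open>'n\<close> indexes the orthonormal basis of \<open>H\<^sub>n\<close>, so \<open>n = CARD('n) \<ge> 1\<close>. The
  word \<open>[i\<^sub>1, \<dots>, i\<^sub>k]\<close> stands for the basis vector \<open>e\<^bsub>i\<^sub>1\<^esub> \<otimes> \<dots> \<otimes> e\<^bsub>i\<^sub>k\<^esub>\<close> of the \<open>k\<close>-fold tensor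
  power of \<open>H\<^sub>n\<close>, the empty word for \<open>1\<close>. The Hilbert space tensor product of \<open>F\<^sup>2(H\<^sub>n)\<close> with \<open>K\<close> is
  \<open>('n list, K) ell2\<close>, in which \<open>tensor_vec f v\<close> is the elementary tensor of \<open>f\<close> and \<open>v\<close>.\<close>

type_synonym 'n fock = "('n list, complex) ell2"

definition right_creation :: "'n \<Rightarrow> 'n fock \<Rightarrow> 'n fock" where
  "right_creation i f =
     Abs_ell2 (\<lambda>w. if w \<noteq> [] \<and> last w = i then coord f (butlast w) else 0)"

definition proj_hom :: "nat \<Rightarrow> 'n fock \<Rightarrow> 'n fock" where
  "proj_hom m f = Abs_ell2 (\<lambda>w. if length w = m then coord f w else 0)"

definition proj_le :: "nat \<Rightarrow> 'n fock \<Rightarrow> 'n fock" where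
  "proj_le m f = Abs_ell2 (\<lambda>w. if length w \<le> m then coord f w else 0)"

definition tensor_vec :: "('i, complex) ell2 \<Rightarrow> 'a::complex_inner \<Rightarrow> ('i, 'a) ell2" where
  "tensor_vec f v = Abs_ell2 (\<lambda>w. coord f w *\<^sub>C v)"

definition tensor_op :: "(('i, complex) ell2 \<Rightarrow> ('j, complex) ell2) \<Rightarrow>
    ('a::complex_inner \<Rightarrow> 'b::complex_inner) \<Rightarrow> ('i, 'a) ell2 \<Rightarrow> ('j, 'b) ell2" where
  "tensor_op X A = (THE Z. bounded_clinear Z \<and>
     (\<forall>f v. Z (tensor_vec f v) = tensor_vec (X f) (A v)))"

text \<open>For a closed subspace \<open>D\<close> of \<open>K\<close>: the tensor product of \<open>F\<^sup>2(H\<^sub>n)\<close> with \<open>D\<close>, inside the one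
  with \<open>K\<close>.\<close>

definition fock_tensor :: "'a::complex_inner set \<Rightarrow> ('n list, 'a) ell2 set" where
  "fock_tensor D = {x. \<forall>w. coord x w \<in> D}"


section \<open>Row contractions\<close>

definition row_op :: "('n::finite \<Rightarrow> 'h \<Rightarrow> 'h) \<Rightarrow> 'h ^ 'n \<Rightarrow> 'h::complex_inner" where
  "row_op T v = (\<Sum>i\<in>UNIV. T i (v $ i))"

definition row_contraction :: "('n::finite \<Rightarrow> 'h \<Rightarrow> 'h::complex_inner) \<Rightarrow> bool" where
  "row_contraction T \<longleftrightarrow> positive_op (\<lambda>x. x - row_op T (adj (row_op T) x))"

text \<open>\<open>defect T\<close> is \<open>\<Delta>\<^sub>T\<close> and \<open>defect_star T\<close> is the defect operator of the adjoint of \<open>T\<close>.\<close>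

definition defect :: "('n::finite \<Rightarrow> 'h \<Rightarrow> 'h) \<Rightarrow> 'h \<Rightarrow> 'h::complex_inner" where
  "defect T = sqrt_op (\<lambda>x. x - row_op T (adj (row_op T) x))"

definition defect_star :: "('n::finite \<Rightarrow> 'h \<Rightarrow> 'h) \<Rightarrow> 'h ^ 'n \<Rightarrow> 'h::complex_inner ^ 'n" where
  "defect_star T = sqrt_op (\<lambda>v. v - adj (row_op T) (row_op T v))"

definition defect_space :: "('n::finite \<Rightarrow> 'h \<Rightarrow> 'h) \<Rightarrow> 'h::complex_inner set" where
  "defect_space T = closure (range (defect T))"

definition defect_star_space :: "('n::finite \<Rightarrow> 'h \<Rightarrow> 'h) \<Rightarrow> ('h::complex_inner ^ 'n) set" where
  "defect_star_space T = closure (range (defect_star T))"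

text \<open>The formula for the characteristic function with \<open>R\<^sub>i\<close> replaced by \<open>r R\<^sub>i\<close>. Applying the row
  of the operators \<open>r R\<^sub>i \<otimes> I\<close> uses the identification of \<open>F\<^sup>2(H\<^sub>n) \<otimes> H\<^sup>n\<close> with the sum of \<open>n\<close>
  copies of \<open>F\<^sup>2(H\<^sub>n) \<otimes> H\<close>: the \<open>i\<close>-th component is \<open>I\<close> tensored with the \<open>i\<close>-th coordinate map.\<close>

definition char_fun_radial :: "('n::finite \<Rightarrow> 'h \<Rightarrow> 'h) \<Rightarrow> real \<Rightarrow>
    ('n list, 'h ^ 'n) ell2 \<Rightarrow> ('n list, 'h::complex_inner) ell2" where
  "char_fun_radial T r x =
     - tensor_op id (row_op T) x
     + tensor_op id (defect T)
         (inv (\<lambda>y. y - (\<Sum>i\<in>UNIV. tensor_op (\<lambda>f. r *\<^sub>R right_creation i f) (adj (T i)) y))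
           (\<Sum>i\<in>UNIV. tensor_op (\<lambda>f. r *\<^sub>R right_creation i f) id
              (tensor_op id (\<lambda>v. v $ i) (tensor_op id (defect_star T) x))))"

text \<open>The characteristic function, to be regarded as an operator from
  \<open>fock_tensor (defect_star_space T)\<close> to \<open>fock_tensor (defect_space T)\<close>; its adjoint is taken
  between these spaces.\<close>

definition char_fun :: "('n::finite \<Rightarrow> 'h \<Rightarrow> 'h) \<Rightarrow>
    ('n list, 'h ^ 'n) ell2 \<Rightarrow> ('n list, 'h::complex_inner) ell2" where
  "char_fun T x = Lim (at_left 1) (\<lambda>r. char_fun_radial T r x)"

definition char_fun_adj :: "('n::finite \<Rightarrow> 'h \<Rightarrow> 'h) \<Rightarrow>
    ('n list, 'h) ell2 \<Rightarrow> ('n list, 'h::complex_inner ^ 'n) ell2" where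
  "char_fun_adj T = adj_on (fock_tensor (defect_star_space T)) (char_fun T)"

definition Phi :: "('n::finite \<Rightarrow> 'h \<Rightarrow> 'h) \<Rightarrow> ('h \<Rightarrow> 'h) \<Rightarrow> 'h \<Rightarrow> 'h::complex_inner" where
  "Phi T X = (\<lambda>x. \<Sum>i\<in>UNIV. T i (X (adj (T i) x)))"

text \<open>The operators whose traces are taken are positive, so \<open>Re\<close> loses nothing.\<close>

definition curv :: "('n::finite \<Rightarrow> 'h \<Rightarrow> 'h::complex_inner) \<Rightarrow> real" where
  "curv T = lim (\<lambda>m. Re (trace_on UNIV (\<lambda>x. x - (Phi T ^^ m) id x)) / (\<Sum>k<m. real CARD('n) ^ k))"

definition euler_char :: "('n::finite \<Rightarrow> 'h \<Rightarrow> 'h::complex_inner) \<Rightarrow> real" where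
  "euler_char T =
     lim (\<lambda>m. real (rank_on UNIV (\<lambda>x. x - (Phi T ^^ m) id x)) / (\<Sum>k<m. real CARD('n) ^ k))"

end

theory Submission
  imports Defs
begin

text \<open>
  The key identity is \<open>I - \<Theta>\<^sub>T \<Theta>\<^sub>T\<^sup>* = K K\<^sup>*\<close> on \<open>F\<^sup>2(H\<^sub>n) \<otimes> \<D>\<^sub>T\<close>, where \<open>K h\<close> has the coordinate
  \<open>\<Delta>\<^sub>T T\<^sub>w\<^sup>* h\<close> at the word \<open>w\<close>. It holds because \<open>\<Theta>\<^sub>T\<close> and \<open>K\<close> are the responses of a linear system,
  built from the unitary Julia operator of \<open>T\<close>, to an input and to an initial state; on finitely
  supported vectors the adjoint is computed by running the adjoint system backwards.

  With an orthonormal basis \<open>F\<close> of \<open>\<D>\<^sub>T\<close> and \<open>g\<^bsub>w,f\<^esub> = T\<^sub>w \<Delta>\<^sub>T f\<close>, one has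
  \<open>I - \<Phi>\<^sub>T\<^sup>m(I) = \<Sum> \<langle>\<cdot>, g\<^bsub>w,f\<^esub>\<rangle> g\<^bsub>w,f\<^esub>\<close> over the words of length \<open>< m\<close>. Hence both traces are sums of
  \<open>\<parallel>g\<^bsub>w,f\<^esub>\<parallel>\<^sup>2\<close>, and both ranks are the dimension of the span of the \<open>g\<^bsub>w,f\<^esub>\<close>, since \<open>K\<close> is injective on
  that span. In either case the increments \<open>d\<^sub>k\<close> satisfy \<open>0 \<le> d\<^sub>k\<^sub>+\<^sub>1 \<le> n d\<^sub>k\<close>, so \<open>d\<^sub>k / n\<^sup>k\<close> decreases to a
  limit, and the weighted means of these quotients have the same limit.
\<close>

section \<open>Complex Hilbert spaces\<close>

text \<open>\<open>char_fun\<close> is defined through a limit, an \<open>inv\<close> and several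
  \<open>THE\<close>-terms, so its values have to be recovered first. The coordinate recursion does
  this. For r < 1 a contraction argument shows that the resolvent equation is solvable, and the
  equation then fixes all coordinates; the energy bound is uniform in r, so the limit r -> 1 needs
  checking on elementary tensors only. The adjoint is needed only behind P_m or P_{\<le>m}, that is,
  on finitely supported vectors, where the backward recursion is a finite sum. Square roots come
  from the power series of 1 - sqrt (1 - z): the intertwining of R^* R with R R^* by the row
  operator R passes term by term to the series and gives \<open>R_Ds\<close>, the identity behind
  the unitarity of the Julia operator. P_m need not commute with \<Theta>\<Theta>^*, so the trace in
  the curvature formula is computed from rank one terms <., b> a with a different from b. The growth
  bound has one source: a new first letter applies one of n operators, which are contractions for
  the trace and merely linear for the dimension.\<close>

instance chilbert_space \<subseteq> banach ..

global_interpretation complex_pair: vector_space_pair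
  "scaleC :: complex \<Rightarrow> 'a \<Rightarrow> 'a::complex_inner" "scaleC :: complex \<Rightarrow> 'b \<Rightarrow> 'b::complex_inner"
  by unfold_locales

lemma cinner_zero_left [simp]: "cinner 0 y = 0"
  by (metis add_cancel_left_left cinner_add_left add_0)

lemma cinner_zero_right [simp]: "cinner x 0 = 0"
  by (metis add_cancel_left_left cinner_add_right add_0)

lemma cinner_minus_left: "cinner (- x) y = - cinner x y"
  by (metis add_eq_0_iff cinner_add_left cinner_zero_left)

lemma cinner_minus_right: "cinner x (- y) = - cinner x y"
  by (metis add_eq_0_iff cinner_add_right cinner_zero_right)

lemma cinner_diff_left: "cinner (x - y) z = cinner x z - cinner y z"
  using cinner_add_left[of x "- y" z] by (simp add: cinner_minus_left)

lemma cinner_diff_right: "cinner x (y - z) = cinner x y - cinner x z"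
  using cinner_add_right[of x y "- z"] by (simp add: cinner_minus_right)

lemma cinner_sum_left: "cinner (sum f I) y = (\<Sum>i\<in>I. cinner (f i) y)"
  by (induction I rule: infinite_finite_induct) (simp_all add: cinner_add_left)

lemma cinner_sum_right: "cinner x (sum f I) = (\<Sum>i\<in>I. cinner x (f i))"
  by (induction I rule: infinite_finite_induct) (simp_all add: cinner_add_right)

lemma cinner_scaleR_left: "cinner (r *\<^sub>R x) y = of_real r * cinner x y"
  by (simp add: scaleR_scaleC cinner_scaleC_left)

lemma cinner_scaleR_right: "cinner x (r *\<^sub>R y) = of_real r * cinner x y"
  by (simp add: scaleR_scaleC cinner_scaleC_right)

lemmas cinner_simps = cinner_add_left cinner_add_right cinner_diff_left cinner_diff_right
  cinner_minus_left cinner_minus_right cinner_scaleC_left cinner_scaleC_right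
  cinner_scaleR_left cinner_scaleR_right

lemma norm_eq_Re_cinner: "(norm x)\<^sup>2 = Re (cinner x x)"
  by (simp add: cinner_self)

lemma cinner_eq_zero_iff: "cinner x x = 0 \<longleftrightarrow> x = 0"
  by (simp add: cinner_self)

lemma Re_cinner_commute: "Re (cinner x y) = Re (cinner y x)"
  by (subst cinner_commute) simp

lemma norm_add_sq: "(norm (x + y))\<^sup>2 = (norm x)\<^sup>2 + (norm y)\<^sup>2 + 2 * Re (cinner x y)"
  using Re_cinner_commute[of x y] by (simp add: norm_eq_Re_cinner cinner_simps)

lemma norm_diff_sq: "(norm (x - y))\<^sup>2 = (norm x)\<^sup>2 + (norm y)\<^sup>2 - 2 * Re (cinner x y)"
  using Re_cinner_commute[of x y] by (simp add: norm_eq_Re_cinner cinner_simps)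

text \<open>Pythagoras for the projection onto the line through \<open>z\<close>. Nonnegativity of
  the left side is Cauchy-Schwarz; the exact decrease is what contradicts minimality in the
  projection theorem.\<close>

lemma norm_diff_proj_sq:
  assumes "z \<noteq> 0"
  shows "(norm (x - (cinner x z / of_real ((norm z)\<^sup>2)) *\<^sub>C z))\<^sup>2
    = (norm x)\<^sup>2 - (cmod (cinner x z))\<^sup>2 / (norm z)\<^sup>2"
proof -
  have "Re (cinner x ((cinner x z / of_real ((norm z)\<^sup>2)) *\<^sub>C z)) = (cmod (cinner x z))\<^sup>2 / (norm z)\<^sup>2"
  proof -
    have "cinner x ((cinner x z / of_real ((norm z)\<^sup>2)) *\<^sub>C z)
        = cnj (cinner x z) * cinner x z / of_real ((norm z)\<^sup>2)"
      by (simp add: cinner_simps)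
    also have "\<dots> = of_real ((cmod (cinner x z))\<^sup>2 / (norm z)\<^sup>2)"
      by (metis complex_norm_square mult.commute of_real_divide)
    finally show ?thesis by simp
  qed
  moreover have "(norm ((cinner x z / of_real ((norm z)\<^sup>2)) *\<^sub>C z))\<^sup>2 = (cmod (cinner x z))\<^sup>2 / (norm z)\<^sup>2"
    using assms by (simp add: norm_scaleC norm_divide norm_mult power2_eq_square)
  ultimately show ?thesis by (simp add: norm_diff_sq)
qed

lemma cinner_Cauchy_Schwarz: "cmod (cinner x y) \<le> norm x * norm y"
proof (cases "y = 0")
  case False
  have "0 \<le> (norm x)\<^sup>2 - (cmod (cinner x y))\<^sup>2 / (norm y)\<^sup>2"
    unfolding norm_diff_proj_sq[OF False, symmetric] by simp
  then have "(cmod (cinner x y))\<^sup>2 \<le> (norm x * norm y)\<^sup>2"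
    using False by (simp add: divide_simps power_mult_distrib)
  then show ?thesis by (rule power2_le_imp_le) simp
qed simp

lemma cinner_eqI_right: "(\<And>z. cinner z x = cinner z y) \<Longrightarrow> x = y"
  by (metis cinner_diff_right cinner_eq_zero_iff right_minus_eq)

section \<open>Bounded complex linear operators\<close>

lemma bounded_clinearI:
  assumes "\<And>x y. A (x + y) = A x + A y" "\<And>c x. A (c *\<^sub>C x) = c *\<^sub>C A x"
    and "\<And>x. norm (A x) \<le> K * norm x"
  shows "bounded_clinear A"
  unfolding bounded_clinear_def
  using assms by (auto intro!: bounded_linear_intro[where K = K] simp: scaleR_scaleC mult.commute)

context
  fixes A :: "'a::complex_inner \<Rightarrow> 'b::complex_inner"
  assumes A: "bounded_clinear A"
begin

lemma bounded_clinear_bounded_linear: "bounded_linear A"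
  using A by (simp add: bounded_clinear_def)

lemma bounded_clinear_linear: "linear A"
  by (rule bounded_linear.linear[OF bounded_clinear_bounded_linear])

lemma bounded_clinear_add: "A (x + y) = A x + A y"
  by (rule linear_add[OF bounded_clinear_linear])

lemma bounded_clinear_diff: "A (x - y) = A x - A y"
  by (rule linear_diff[OF bounded_clinear_linear])

lemma bounded_clinear_minus: "A (- x) = - A x"
  by (rule linear_neg[OF bounded_clinear_linear])

lemma bounded_clinear_zero: "A 0 = 0"
  by (rule linear_0[OF bounded_clinear_linear])

lemma bounded_clinear_sum: "A (sum f I) = (\<Sum>i\<in>I. A (f i))"
  by (rule linear_sum[OF bounded_clinear_linear])

lemma bounded_clinear_scaleR: "A (r *\<^sub>R x) = r *\<^sub>R A x"
  by (rule linear_scale[OF bounded_clinear_linear])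

lemma bounded_clinear_scaleC: "A (c *\<^sub>C x) = c *\<^sub>C A x"
  using A by (simp add: bounded_clinear_def)

lemmas bounded_clinear_simps = bounded_clinear_add bounded_clinear_diff bounded_clinear_minus
  bounded_clinear_zero bounded_clinear_sum bounded_clinear_scaleR bounded_clinear_scaleC

lemma bounded_clinear_bound: "\<exists>K\<ge>0. \<forall>x. norm (A x) \<le> K * norm x"
  using bounded_linear.nonneg_bounded[OF bounded_clinear_bounded_linear] by (metis mult.commute)

lemma bounded_clinear_clinear: "Vector_Spaces.linear scaleC scaleC A"
  unfolding Vector_Spaces.linear_iff
  by (simp add: bounded_clinear_add bounded_clinear_scaleC complex_vector.vector_space_axioms)

lemma bounded_clinear_isCont: "isCont A x"
  by (rule linear_continuous_at[OF bounded_clinear_bounded_linear])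

end

lemma bounded_clinear_compose:
  "bounded_clinear A \<Longrightarrow> bounded_clinear B \<Longrightarrow> bounded_clinear (\<lambda>x. A (B x))"
  unfolding bounded_clinear_def by (auto intro: bounded_linear_compose)

lemma bounded_clinear_id: "bounded_clinear (\<lambda>x. x)"
  unfolding bounded_clinear_def by auto

lemma bounded_clinear_minus_op:
  "bounded_clinear A \<Longrightarrow> bounded_clinear B \<Longrightarrow> bounded_clinear (\<lambda>x. A x - B x)"
  unfolding bounded_clinear_def
  by (auto intro: bounded_linear_sub simp: complex_vector.scale_right_diff_distrib)

lemma bounded_clinear_sum_op:
  "(\<And>i. i \<in> I \<Longrightarrow> bounded_clinear (A i)) \<Longrightarrow> bounded_clinear (\<lambda>x. \<Sum>i\<in>I. A i x)"
  unfolding bounded_clinear_def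
  by (auto intro: bounded_linear_sum simp: complex_vector.scale_sum_right)

lemma bounded_clinear_scaleC_op: "bounded_clinear (\<lambda>x. c *\<^sub>C x)"
  by (rule bounded_clinearI[where K = "cmod c"])
    (simp_all add: scaleC_add_right scaleC_scaleC norm_scaleC mult.commute)

lemma bounded_clinear_cinner_left: "bounded_clinear (\<lambda>x. cinner x y)"
proof (rule bounded_clinearI)
  show "norm (cinner x y) \<le> norm y * norm x" for x
    using cinner_Cauchy_Schwarz[of x y] by (simp add: mult.commute)
qed (simp_all add: cinner_simps scaleC_complex_def)

lemma bounded_linear_cinner_right: "bounded_linear (\<lambda>y. cinner x y)"
proof (rule bounded_linear_intro)
  show "norm (cinner x y) \<le> norm y * norm x" for y
    using cinner_Cauchy_Schwarz[of x y] by (simp add: mult.commute)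
qed (simp_all add: cinner_simps scaleR_conv_of_real)

section \<open>Closed subspaces, the projection theorem and adjoints\<close>

lemma closure_span_add_scaleC:
  assumes "x \<in> closure (complex_vector.span B)" "y \<in> closure (complex_vector.span B)"
  shows "x + y \<in> closure (complex_vector.span B)" "c *\<^sub>C x \<in> closure (complex_vector.span B)"
proof -
  obtain f where f: "\<And>n. f n \<in> complex_vector.span B" "f \<longlonglongrightarrow> x"
    using assms(1) unfolding closure_sequential by blast
  obtain g where g: "\<And>n. g n \<in> complex_vector.span B" "g \<longlonglongrightarrow> y"
    using assms(2) unfolding closure_sequential by blast
  show "x + y \<in> closure (complex_vector.span B)"
    unfolding closure_sequential
    using f g by (intro exI[of _ "\<lambda>n. f n + g n"]) (auto intro: tendsto_add complex_vector.span_add)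
  show "c *\<^sub>C x \<in> closure (complex_vector.span B)"
    unfolding closure_sequential
    using f bounded_linear.tendsto[OF bounded_clinear_bounded_linear[OF bounded_clinear_scaleC_op]]
    by (intro exI[of _ "\<lambda>n. c *\<^sub>C f n"]) (auto intro: complex_vector.span_scale)
qed

lemma subspace_closure_span: "complex_vector.subspace (closure (complex_vector.span B))"
  unfolding complex_vector.subspace_def
  using closure_subset[of "complex_vector.span B"] complex_vector.span_zero[of B]
  by (blast intro: closure_span_add_scaleC)

lemma subspace_closure:
  assumes "complex_vector.subspace M"
  shows "complex_vector.subspace (closure M)"
  using subspace_closure_span[of M] assms by (metis complex_vector.span_eq_iff)

text \<open>The point of \<open>M\<close> nearest to \<open>x\<close> is the limit of a minimizing
  sequence; the error 1/(n+1) in the squared distance is enough to make that sequence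
  Cauchy.\<close>

lemma orthogonal_projection_exists:
  fixes M :: "'a::chilbert_space set"
  assumes M: "complex_vector.subspace M" "closed M"
  shows "\<exists>p\<in>M. \<forall>z\<in>M. cinner (x - p) z = 0"
proof -
  define d where "d = (INF z\<in>M. (norm (x - z))\<^sup>2)"
  have ne: "M \<noteq> {}" using complex_vector.subspace_0[OF M(1)] by blast
  have bdd: "bdd_below ((\<lambda>z. (norm (x - z))\<^sup>2) ` M)"
    by (rule bdd_belowI2[where m = 0]) simp
  have d: "d \<le> (norm (x - z))\<^sup>2" if "z \<in> M" for z
    unfolding d_def by (rule cINF_lower[OF bdd that])
  have "\<exists>z\<in>M. (norm (x - z))\<^sup>2 < d + inverse (real (Suc n))" for n
  proof -
    have "(INF z\<in>M. (norm (x - z))\<^sup>2) < d + inverse (real (Suc n))"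
      unfolding d_def by simp
    then show ?thesis using cINF_less_iff[OF ne bdd] by blast
  qed
  then obtain z where z: "\<And>n. z n \<in> M" "\<And>n. (norm (x - z n))\<^sup>2 < d + inverse (real (Suc n))"
    by metis
  \<comment> \<open>Parallelogram law: the midpoint of \<open>z m\<close> and \<open>z n\<close>
    lies in \<open>M\<close>, so its squared distance to \<open>x\<close> is at least
    \<open>d\<close>.\<close>
  have cau: "(norm (z m - z n))\<^sup>2 \<le> 2 * inverse (real (Suc m)) + 2 * inverse (real (Suc n))" for m n
  proof -
    have "(1/2) *\<^sub>R (z m + z n) \<in> M"
      unfolding scaleR_scaleC
      by (intro complex_vector.subspace_scale complex_vector.subspace_add M z)
    from d[OF this] have "d \<le> (norm (x - (1/2) *\<^sub>R (z m + z n)))\<^sup>2" .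
    also have "x - (1/2) *\<^sub>R (z m + z n) = (1/2) *\<^sub>R ((x - z m) + (x - z n))"
      by (simp add: algebra_simps flip: scaleR_add_left)
    finally have 1: "4 * d \<le> (norm ((x - z m) + (x - z n)))\<^sup>2"
      by (simp add: power_divide)
    have "(norm (z m - z n))\<^sup>2 = (norm ((x - z n) - (x - z m)))\<^sup>2"
      by simp
    also have "\<dots> + (norm ((x - z m) + (x - z n)))\<^sup>2
        = 2 * (norm (x - z m))\<^sup>2 + 2 * (norm (x - z n))\<^sup>2"
      unfolding norm_diff_sq[of "x - z n" "x - z m"] norm_add_sq[of "x - z m" "x - z n"]
      using Re_cinner_commute[of "x - z m" "x - z n"] by simp
    finally show ?thesis using 1 z(2)[of m] z(2)[of n] by linarith
  qed
  have "Cauchy z"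
  proof (rule metric_CauchyI)
    fix e :: real assume e: "e > 0"
    then obtain N where N: "inverse (real (Suc N)) < e\<^sup>2 / 4"
      using reals_Archimedean[of "e\<^sup>2 / 4"] by auto
    have "dist (z m) (z n) < e" if "m \<ge> N" "n \<ge> N" for m n
    proof -
      have "inverse (real (Suc m)) \<le> inverse (real (Suc N))"
        "inverse (real (Suc n)) \<le> inverse (real (Suc N))"
        using that by (simp_all add: le_imp_inverse_le)
      then have "(norm (z m - z n))\<^sup>2 < e\<^sup>2" using cau[of m n] N by linarith
      then show ?thesis using e unfolding dist_norm by (simp add: power2_less_imp_less)
    qed
    then show "\<exists>N. \<forall>m\<ge>N. \<forall>n\<ge>N. dist (z m) (z n) < e" by blast
  qed
  then obtain p where p: "z \<longlonglongrightarrow> p"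
    using Cauchy_convergent convergent_def by blast
  have pM: "p \<in> M" using closed_sequentially[OF M(2)] z(1) p by blast
  have "(\<lambda>n. (norm (x - z n))\<^sup>2) \<longlonglongrightarrow> (norm (x - p))\<^sup>2"
    by (intro tendsto_intros p)
  moreover have "(\<lambda>n. d + inverse (real (Suc n))) \<longlonglongrightarrow> d + 0"
    by (intro tendsto_intros LIMSEQ_inverse_real_of_nat)
  ultimately have "(norm (x - p))\<^sup>2 \<le> d + 0"
    by (rule LIMSEQ_le) (use z(2) in \<open>auto intro: less_imp_le\<close>)
  then have pd: "(norm (x - p))\<^sup>2 \<le> d" by simp
  have "cinner (x - p) w = 0" if w: "w \<in> M" for w
  proof (cases "w = 0")
    case False
    \<comment> \<open>The coefficient of the best approximation of \<open>x - p\<close> along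
      \<open>w\<close>; moving \<open>p\<close> by \<open>c *\<^sub>C w\<close> would lower the
      distance unless the inner product vanishes.\<close>
    define c where "c = cinner (x - p) w / of_real ((norm w)\<^sup>2)"
    have "p + c *\<^sub>C w \<in> M"
      by (intro complex_vector.subspace_scale complex_vector.subspace_add M pM w)
    from order_trans[OF pd d[OF this]] have "(norm (x - p))\<^sup>2 \<le> (norm ((x - p) - c *\<^sub>C w))\<^sup>2"
      by (simp only: diff_diff_eq)
    also have "\<dots> = (norm (x - p))\<^sup>2 - (cmod (cinner (x - p) w))\<^sup>2 / (norm w)\<^sup>2"
      unfolding c_def by (rule norm_diff_proj_sq[OF False])
    finally have "(cmod (cinner (x - p) w))\<^sup>2 / (norm w)\<^sup>2 \<le> 0" by simp
    then show ?thesis using False by (simp add: divide_le_0_iff)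
  qed simp
  with pM show ?thesis by blast
qed

text \<open>The kernel has a nonzero orthogonal vector \<open>e\<close>, and every \<open>u\<close>
  differs from a multiple of \<open>e\<close> by a kernel vector.\<close>

lemma Riesz_representation:
  fixes f :: "'a::chilbert_space \<Rightarrow> complex"
  assumes f: "bounded_clinear f"
  shows "\<exists>y. \<forall>x. f x = cinner x y"
proof (cases "\<forall>x. f x = 0")
  case False
  then obtain x where x: "f x \<noteq> 0" by blast
  let ?N = "{x. f x = 0}"
  have "complex_vector.subspace ?N"
    unfolding complex_vector.subspace_def by (simp add: bounded_clinear_simps[OF f])
  moreover have "closed ?N"
    by (rule closed_Collect_eq)
      (auto intro!: continuous_at_imp_continuous_on bounded_clinear_isCont f)
  ultimately obtain p where p: "f p = 0" "\<And>z. f z = 0 \<Longrightarrow> cinner (x - p) z = 0"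
    using orthogonal_projection_exists[of ?N x] by blast
  define e where "e = x - p"
  have fe: "f e \<noteq> 0" using x p by (simp add: e_def bounded_clinear_simps[OF f])
  then have e0: "cinner e e \<noteq> 0" by (auto simp: cinner_eq_zero_iff bounded_clinear_simps[OF f])
  have orth: "cinner e z = 0" if "f z = 0" for z using p(2)[OF that] by (simp add: e_def)
  have "f u = cinner u ((cnj (f e) / cinner e e) *\<^sub>C e)" for u
  proof -
    \<comment> \<open>A combination of \<open>u\<close> and \<open>e\<close> on which
      \<open>f\<close> vanishes; pairing it with \<open>e\<close> solves for
      \<open>f u\<close>.\<close>
    have "f (f e *\<^sub>C u - f u *\<^sub>C e) = 0"
      by (simp add: bounded_clinear_simps[OF f] scaleC_complex_def)
    then have "cinner (f e *\<^sub>C u - f u *\<^sub>C e) e = 0"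
      using orth cinner_commute by (metis complex_cnj_zero)
    then have "f e * cinner u e = f u * cinner e e" by (simp add: cinner_simps)
    moreover have "cnj (cinner e e) = cinner e e" using cinner_commute by metis
    ultimately show ?thesis using e0 by (simp add: cinner_simps field_simps)
  qed
  then show ?thesis by blast
qed (auto intro!: exI[of _ 0])

text \<open>Two candidates differ by a vector of \<open>M\<close>, which can be tested against
  itself. Hence exhibiting one vector of \<open>M\<close> with the right pairings evaluates the
  \<open>THE\<close>; the adjoint of \<open>char_fun\<close> is computed this way, vector by
  vector.\<close>

lemma adj_onI:
  assumes "complex_vector.subspace M" "x \<in> M" "\<And>z. z \<in> M \<Longrightarrow> cinner (A z) y = cinner z x"
  shows "adj_on M A y = x"
  unfolding adj_on_def
proof (rule the_equality)
  fix x' assume x': "x' \<in> M \<and> (\<forall>z\<in>M. cinner (A z) y = cinner z x')"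
  have "x - x' \<in> M" using complex_vector.subspace_diff[OF assms(1)] assms(2) x' by blast
  then have "cinner (x - x') x = cinner (x - x') x'" using assms(3) x' by metis
  then have "cinner (x - x') (x - x') = 0" by (simp add: cinner_diff_right)
  then show "x' = x" by (simp add: cinner_eq_zero_iff)
qed (use assms in auto)

lemmas adjI = adj_onI[OF complex_vector.subspace_UNIV UNIV_I]

lemma cinner_adj:
  fixes A :: "'a::chilbert_space \<Rightarrow> 'b::complex_inner"
  assumes A: "bounded_clinear A"
  shows "cinner (A z) y = cinner z (adj A y)"
proof -
  obtain x where x: "\<And>z. cinner (A z) y = cinner z x"
    using Riesz_representation[OF bounded_clinear_compose[OF bounded_clinear_cinner_left A]] by blast
  then have "adj A y = x" by (intro adjI) simp
  with x show ?thesis by simp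
qed

lemma cinner_adj_left:
  fixes A :: "'a::chilbert_space \<Rightarrow> 'b::complex_inner"
  assumes A: "bounded_clinear A"
  shows "cinner (adj A y) z = cinner y (A z)"
  by (metis A cinner_adj cinner_commute)

text \<open>Put z = B y: the square of the norm of B y is at most K times the norm of B y times that
  of y.\<close>

lemma norm_le_of_adjoint:
  assumes K: "0 \<le> K" "\<And>x. norm (A x) \<le> K * norm x"
    and adj: "\<And>z y. cinner (A z) y = cinner z (B y)"
  shows "norm (B y) \<le> K * norm y"
proof -
  have "(norm (B y))\<^sup>2 = cmod (cinner (A (B y)) y)"
    by (simp add: adj cinner_self norm_power)
  also have "\<dots> \<le> norm (A (B y)) * norm y" by (rule cinner_Cauchy_Schwarz)
  also have "\<dots> \<le> (K * norm (B y)) * norm y"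
    by (intro mult_right_mono K(2)) simp
  finally have "norm (B y) * norm (B y) \<le> norm (B y) * (K * norm y)"
    by (simp add: power2_eq_square mult_ac)
  then show ?thesis
    using K(1) by (cases "norm (B y) = 0") (auto simp: mult_le_cancel_left)
qed

text \<open>The pairings with all \<open>z\<close> determine \<open>B y\<close>, so linearity of
  \<open>B\<close> is inherited from the inner product.\<close>

lemma bounded_clinear_of_adjoint:
  assumes A: "bounded_clinear A" and adj: "\<And>z y. cinner (A z) y = cinner z (B y)"
  shows "bounded_clinear B"
proof -
  obtain K where K: "0 \<le> K" "\<And>x. norm (A x) \<le> K * norm x"
    using bounded_clinear_bound[OF A] by blast
  show ?thesis
  proof (rule bounded_clinearI)
    show "B (x + y) = B x + B y" for x y
      by (rule cinner_eqI_right) (simp add: cinner_add_right flip: adj)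
    show "B (c *\<^sub>C x) = c *\<^sub>C B x" for c x
      by (rule cinner_eqI_right) (simp add: cinner_scaleC_right flip: adj)
    show "norm (B x) \<le> K * norm x" for x
      by (rule norm_le_of_adjoint[OF K adj])
  qed
qed

lemma bounded_clinear_adj:
  fixes A :: "'a::chilbert_space \<Rightarrow> 'b::complex_inner"
  assumes A: "bounded_clinear A"
  shows "bounded_clinear (adj A)"
  by (rule bounded_clinear_of_adjoint[OF A cinner_adj[OF A]])

section \<open>Orthonormal bases and the trace\<close>

definition orthonormal :: "'a::complex_inner set \<Rightarrow> bool" where
  "orthonormal B \<longleftrightarrow> (\<forall>x\<in>B. norm x = 1) \<and> (\<forall>x\<in>B. \<forall>y\<in>B. x \<noteq> y \<longrightarrow> cinner x y = 0)"

lemma orthonormal_cinner: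
  "orthonormal B \<Longrightarrow> x \<in> B \<Longrightarrow> y \<in> B \<Longrightarrow> cinner x y = (if x = y then 1 else 0)"
  by (auto simp: orthonormal_def cinner_self)

lemma orthonormal_subset: "orthonormal B \<Longrightarrow> F \<subseteq> B \<Longrightarrow> orthonormal F"
  unfolding orthonormal_def by (metis subsetD)

lemma is_onb_iff:
  "is_onb M B \<longleftrightarrow> B \<subseteq> M \<and> orthonormal B \<and> closure (complex_vector.span B) = M"
  unfolding is_onb_def orthonormal_def by (simp add: conj_assoc)

text \<open>For finite orthonormal \<open>F\<close> this is the orthogonal projection onto the span
  of \<open>F\<close>.\<close>

definition fproj :: "'a::complex_inner set \<Rightarrow> 'a \<Rightarrow> 'a" where
  "fproj F x = (\<Sum>e\<in>F. cinner x e *\<^sub>C e)"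

lemma bounded_clinear_fproj: "bounded_clinear (fproj F)"
  unfolding fproj_def[abs_def]
proof (rule bounded_clinear_sum_op)
  fix e :: 'a
  show "bounded_clinear (\<lambda>x. cinner x e *\<^sub>C e)"
  proof (rule bounded_clinearI)
    show "norm (cinner x e *\<^sub>C e) \<le> (norm e)\<^sup>2 * norm x" for x
      using mult_right_mono[OF cinner_Cauchy_Schwarz[of x e], of "norm e"]
      by (simp add: norm_scaleC power2_eq_square mult_ac)
  qed (simp_all add: cinner_simps scaleC_add_left scaleC_scaleC)
qed

context
  fixes F :: "'a::complex_inner set"
  assumes F: "finite F" "orthonormal F"
begin

lemma fproj_in_span: "fproj F x \<in> complex_vector.span F"
  unfolding fproj_def
  by (intro complex_vector.span_sum complex_vector.span_scale complex_vector.span_base)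

lemma cinner_fproj: "e \<in> F \<Longrightarrow> cinner (fproj F x) e = cinner x e"
  unfolding fproj_def cinner_sum_left cinner_scaleC_left
  using F by (simp add: orthonormal_cinner[OF F(2)] if_distrib cong: if_cong)

lemma cinner_diff_fproj_span: "s \<in> complex_vector.span F \<Longrightarrow> cinner (x - fproj F x) s = 0"
proof (induction s rule: complex_vector.span_induct_alt)
  case (step c s t)
  then show ?case by (simp add: cinner_simps cinner_fproj)
qed simp

lemma norm_diff_span_sq:
  assumes "s \<in> complex_vector.span F"
  shows "(norm (x - s))\<^sup>2 = (norm (x - fproj F x))\<^sup>2 + (norm (fproj F x - s))\<^sup>2"
proof -
  have "fproj F x - s \<in> complex_vector.span F"
    by (intro complex_vector.span_diff fproj_in_span assms)
  then have "cinner (x - fproj F x) (fproj F x - s) = 0" by (rule cinner_diff_fproj_span)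
  then show ?thesis using norm_add_sq[of "x - fproj F x" "fproj F x - s"] by simp
qed

lemma fproj_span: "s \<in> complex_vector.span F \<Longrightarrow> fproj F s = s"
  using norm_diff_span_sq[of s s] by simp

lemma span_fproj: "complex_vector.span F = {x. fproj F x = x}"
  using fproj_span fproj_in_span by (metis (mono_tags, lifting) Collect_eqI mem_Collect_eq Collect_mem_eq)

text \<open>The span is the fixed point set of the continuous map \<open>fproj F\<close>. This is
  what identifies the defect space with a finite span, without taking closures.\<close>

lemma closed_span_orthonormal: "closed (complex_vector.span F)"
  unfolding span_fproj
  by (rule closed_Collect_eq)
    (auto intro!: continuous_at_imp_continuous_on bounded_clinear_isCont bounded_clinear_fproj)

lemma norm_fproj_sq: "(norm (fproj F x))\<^sup>2 = (\<Sum>e\<in>F. (cmod (cinner x e))\<^sup>2)"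
proof -
  have "complex_of_real ((norm (fproj F x))\<^sup>2) = cinner (fproj F x) (\<Sum>e\<in>F. cinner x e *\<^sub>C e)"
    by (simp only: fproj_def[symmetric] cinner_self)
  also have "\<dots> = (\<Sum>e\<in>F. cnj (cinner x e) * cinner x e)"
    by (simp add: cinner_sum_right cinner_scaleC_right cinner_fproj)
  also have "\<dots> = complex_of_real (\<Sum>e\<in>F. (cmod (cinner x e))\<^sup>2)"
    by (simp add: complex_norm_square mult.commute del: of_real_power)
  finally show ?thesis by (simp only: of_real_eq_iff)
qed

lemma Bessel_eq: "(norm (x - fproj F x))\<^sup>2 = (norm x)\<^sup>2 - (\<Sum>e\<in>F. (cmod (cinner x e))\<^sup>2)"
  using norm_diff_span_sq[OF complex_vector.span_zero, of x] norm_fproj_sq[of x] by simp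

end

text \<open>One Gram-Schmidt step.\<close>

lemma orthonormal_insert:
  assumes "finite F" "orthonormal F" "x \<notin> complex_vector.span F"
  defines "e \<equiv> (1 / norm (x - fproj F x)) *\<^sub>R (x - fproj F x)"
  shows "orthonormal (insert e F)" "x \<in> complex_vector.span (insert e F)"
    "e \<in> complex_vector.span (insert x F)"
proof -
  let ?z = "x - fproj F x"
  have z: "?z \<noteq> 0" using assms(3) fproj_in_span[OF assms(1,2), of x] by auto
  have "cinner e y = 0" if "y \<in> F" for y
    using cinner_diff_fproj_span[OF assms(1,2) complex_vector.span_base[OF that]]
    by (simp add: e_def cinner_scaleR_left)
  moreover have "cinner y e = 0" if "y \<in> F" for y
    using calculation[OF that] cinner_commute[of y e] by simp
  ultimately show "orthonormal (insert e F)"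
    using assms(2) z unfolding orthonormal_def by (auto simp: e_def)
  have pin: "fproj F x \<in> complex_vector.span (insert y F)" for y
    using fproj_in_span[OF assms(1,2), of x] complex_vector.span_mono[of F "insert y F"] by blast
  have "x = norm ?z *\<^sub>R e + fproj F x" using z by (simp add: e_def)
  also have "\<dots> \<in> complex_vector.span (insert e F)"
    unfolding scaleR_scaleC
    by (intro complex_vector.span_add complex_vector.span_scale pin complex_vector.span_base) simp
  finally show "x \<in> complex_vector.span (insert e F)" .
  show "e \<in> complex_vector.span (insert x F)"
    unfolding e_def scaleR_scaleC
    by (intro complex_vector.span_diff complex_vector.span_scale pin complex_vector.span_base) simp
qed

lemma finite_orthonormal_basis:
  fixes S :: "'a::complex_inner set"
  assumes "finite S"
  shows "\<exists>F. finite F \<and> orthonormal F \<and> complex_vector.span F = complex_vector.span S"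
  using assms
proof (induction S)
  case empty
  show ?case by (intro exI[of _ "{}"]) (auto simp: orthonormal_def)
next
  case (insert x S)
  then obtain F where F: "finite F" "orthonormal F" "complex_vector.span F = complex_vector.span S"
    by blast
  have xS: "complex_vector.span (insert x S) = complex_vector.span (insert x F)"
    using F(3) by (simp add: complex_vector.span_insert)
  show ?case
  proof (cases "x \<in> complex_vector.span F")
    case True
    then show ?thesis using F xS complex_vector.span_redundant by metis
  next
    case False
    let ?e = "(1 / norm (x - fproj F x)) *\<^sub>R (x - fproj F x)"
    note e = orthonormal_insert[OF F(1,2) False]
    have "complex_vector.span (insert ?e F) = complex_vector.span (insert x F)"
      unfolding complex_vector.span_eq
      using e(2,3) complex_vector.span_superset[of "insert ?e F"]
        complex_vector.span_superset[of "insert x F"] by auto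
    then show ?thesis using e(1) F xS by (intro exI[of _ "insert ?e F"]) auto
  qed
qed

lemma finite_orthonormal_basis_subspace:
  fixes V :: "'a::complex_inner set"
  assumes "complex_vector.subspace V" "V \<subseteq> complex_vector.span S" "finite S"
  obtains F where "finite F" "orthonormal F" "complex_vector.span F = V"
proof -
  obtain B where B: "B \<subseteq> V" "complex_vector.independent B" "V \<subseteq> complex_vector.span B"
    using complex_vector.basis_exists by metis
  have "finite B" using complex_vector.independent_span_bound[OF assms(3) B(2)] B(1) assms(2) by blast
  moreover have "complex_vector.span B = V"
    using B assms(1) by (metis complex_vector.span_subspace)
  ultimately show ?thesis using finite_orthonormal_basis[of B] that by auto
qed

lemma orthonormal_independent:
  assumes "orthonormal F"
  shows "complex_vector.independent F"
  unfolding complex_vector.dependent_explicit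
proof safe
  fix S u v assume S: "finite S" "S \<subseteq> F" "(\<Sum>v\<in>S. u v *\<^sub>C v) = 0" and v: "v \<in> S" "u v \<noteq> 0"
  have "0 = cinner (\<Sum>v\<in>S. u v *\<^sub>C v) v" using S by simp
  also have "\<dots> = (\<Sum>w\<in>S. u w * (if w = v then 1 else 0))"
    unfolding cinner_sum_left cinner_scaleC_left
    using assms S v by (intro sum.cong refl) (subst orthonormal_cinner[of F]; auto)
  also have "\<dots> = (\<Sum>w\<in>S. if w = v then u w else 0)"
    by (rule sum.cong) auto
  also have "\<dots> = u v" using S(1) v(1) by simp
  finally show False using v by simp
qed

text \<open>A maximal orthonormal subset of \<open>M\<close> by Zorn. If its closed span missed a
  point of \<open>M\<close>, the normalized component orthogonal to that span would enlarge
  it.\<close>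

lemma onb_exists:
  fixes M :: "'a::chilbert_space set"
  assumes M: "complex_vector.subspace M" "closed M"
  shows "\<exists>B. is_onb M B"
proof -
  let ?A = "{B. B \<subseteq> M \<and> orthonormal B}"
  have "\<exists>B\<in>?A. \<forall>X\<in>?A. B \<subseteq> X \<longrightarrow> X = B"
  proof (rule subset_Zorn_nonempty)
    show "?A \<noteq> {}" by (auto intro!: exI[of _ "{}"] simp: orthonormal_def)
    fix C assume C: "C \<noteq> {}" "subset.chain ?A C"
    have "cinner x y = 0" if xy: "x \<in> X" "y \<in> Y" "X \<in> C" "Y \<in> C" "x \<noteq> y" for x y X Y
    proof -
      \<comment> \<open>Two vectors of the union lie in a common member of the chain.\<close>
      have "X \<subseteq> Y \<or> Y \<subseteq> X" using C(2) xy(3,4) unfolding subset_chain_def by metis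
      then obtain Z where Z: "Z \<in> C" "x \<in> Z" "y \<in> Z" using xy(1-4) by blast
      then have "orthonormal Z" using C(2) by (auto simp: subset_chain_def)
      then show ?thesis using xy(5) Z unfolding orthonormal_def by metis
    qed
    moreover have "norm x = 1" if "x \<in> X" "X \<in> C" for x X
    proof -
      have "orthonormal X" using C(2) that(2) by (auto simp: subset_chain_def)
      then show ?thesis using that(1) unfolding orthonormal_def by metis
    qed
    ultimately have "orthonormal (\<Union>C)"
      unfolding orthonormal_def by (metis UnionE)
    moreover have "\<Union>C \<subseteq> M" using C(2) by (auto simp: subset_chain_def)
    ultimately show "\<Union>C \<in> ?A" by simp
  qed
  then obtain B where "B \<in> ?A" and max': "\<forall>X\<in>?A. B \<subseteq> X \<longrightarrow> X = B" by (rule bexE)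
  then have B: "B \<subseteq> M" "orthonormal B" by simp_all
  have max: "X = B" if "X \<subseteq> M" "orthonormal X" "B \<subseteq> X" for X
    using bspec[OF max', of X] that by simp
  let ?N = "closure (complex_vector.span B)"
  have NM: "?N \<subseteq> M"
    using M B by (intro closure_minimal complex_vector.span_minimal)
  have "M \<subseteq> ?N"
  proof
    fix x assume x: "x \<in> M"
    obtain p where p: "p \<in> ?N" "\<And>z. z \<in> ?N \<Longrightarrow> cinner (x - p) z = 0"
      using orthogonal_projection_exists[OF subspace_closure_span closed_closure] by metis
    show "x \<in> ?N"
    proof (cases "x = p")
      case False
      define e where "e = (1 / norm (x - p)) *\<^sub>R (x - p)"
      have BN: "B \<subseteq> ?N" using closure_subset complex_vector.span_superset by blast
      have ey: "cinner e y = 0" if "y \<in> ?N" for y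
        using p(2)[OF that] by (simp add: e_def cinner_scaleR_left)
      moreover have "cinner y e = 0" if "y \<in> ?N" for y
        using ey[OF that] cinner_commute[of y e] by simp
      ultimately have "orthonormal (insert e B)"
        using B(2) BN False unfolding orthonormal_def by (auto simp: e_def)
      moreover have "e \<in> M"
        unfolding e_def scaleR_scaleC
        using M(1) x p(1) NM by (intro complex_vector.subspace_scale complex_vector.subspace_diff) auto
      ultimately have "insert e B = B" using max[of "insert e B"] B(1) by blast
      then have "cinner e e = 0" using ey BN by blast
      then show ?thesis using False by (simp add: e_def cinner_eq_zero_iff)
    qed (use p in simp)
  qed
  with NM have "?N = M" by (rule equalityI)
  then have "is_onb M B" unfolding is_onb_iff using B by simp
  then show ?thesis ..
qed

text \<open>A finite combination of basis vectors close to \<open>x\<close> is beaten by the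
  projection onto any larger finite part of the basis, and \<open>Bessel_eq\<close> turns that
  projection error into the missing part of the sum.\<close>

lemma Parseval_norm:
  assumes B: "is_onb M B" and x: "x \<in> M"
  shows "((\<lambda>e. (cmod (cinner x e))\<^sup>2) has_sum (norm x)\<^sup>2) B"
proof -
  have orth: "orthonormal F" if "F \<subseteq> B" for F
    using B that orthonormal_subset by (auto simp: is_onb_iff)
  have le: "(\<Sum>e\<in>F. (cmod (cinner x e))\<^sup>2) \<le> (norm x)\<^sup>2" if "finite F" "F \<subseteq> B" for F
    using Bessel_eq[OF that(1) orth[OF that(2)], of x] zero_le_power2[of "norm (x - fproj F x)"]
    by linarith
  show ?thesis
    unfolding has_sum_def tendsto_iff eventually_finite_subsets_at_top
  proof (intro allI impI)
    fix \<epsilon> :: real assume \<epsilon>: "\<epsilon> > 0"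
    define d where "d = sqrt \<epsilon>"
    have d: "d > 0" "d\<^sup>2 = \<epsilon>" using \<epsilon> by (auto simp: d_def)
    have "x \<in> closure (complex_vector.span B)" using B x by (simp add: is_onb_iff)
    then obtain s where s: "s \<in> complex_vector.span B" "dist s x < d"
      using d unfolding closure_approachable by blast
    obtain F c where F: "finite F" "F \<subseteq> B" "s = (\<Sum>a\<in>F. c a *\<^sub>C a)"
      using s(1) unfolding complex_vector.span_explicit by auto
    have "dist (\<Sum>e\<in>G. (cmod (cinner x e))\<^sup>2) ((norm x)\<^sup>2) < \<epsilon>"
      if G: "finite G" "F \<subseteq> G" "G \<subseteq> B" for G
    proof -
      have "s \<in> complex_vector.span G"
        unfolding F(3) using G(2)
        by (intro complex_vector.span_sum complex_vector.span_scale complex_vector.span_base) blast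
      then have "(norm (x - fproj G x))\<^sup>2 \<le> (norm (x - s))\<^sup>2"
        unfolding norm_diff_span_sq[OF G(1) orth[OF G(3)] \<open>s \<in> complex_vector.span G\<close>, of x] by simp
      also have "\<dots> < d\<^sup>2"
        using s(2) by (intro power_strict_mono) (auto simp: dist_norm norm_minus_commute)
      finally have "(norm x)\<^sup>2 - (\<Sum>e\<in>G. (cmod (cinner x e))\<^sup>2) < \<epsilon>"
        using Bessel_eq[OF G(1) orth[OF G(3)], of x] d by simp
      then show ?thesis using le[OF G(1,3)] by (simp add: dist_real_def)
    qed
    then show "\<exists>X. finite X \<and> X \<subseteq> B \<and> (\<forall>Y. finite Y \<and> X \<subseteq> Y \<and> Y \<subseteq> B \<longrightarrow>
        dist (\<Sum>e\<in>Y. (cmod (cinner x e))\<^sup>2) ((norm x)\<^sup>2) < \<epsilon>)"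
      using F by blast
  qed
qed

lemma polarization:
  "4 * cinner x y = of_real ((norm (x + y))\<^sup>2) - of_real ((norm (x - y))\<^sup>2)
     + \<i> * of_real ((norm (x + \<i> *\<^sub>C y))\<^sup>2) - \<i> * of_real ((norm (x - \<i> *\<^sub>C y))\<^sup>2)"
  unfolding cinner_self[symmetric] by (simp add: cinner_simps algebra_simps)

lemma has_sum_finite_sum:
  fixes f :: "'j \<Rightarrow> 'e \<Rightarrow> complex"
  assumes "\<And>j. j \<in> J \<Longrightarrow> (f j has_sum s j) B"
  shows "((\<lambda>e. \<Sum>j\<in>J. f j e) has_sum (\<Sum>j\<in>J. s j)) B"
  using assms
  by (induction J rule: infinite_finite_induct) (auto intro!: has_sum_add)

lemma has_sum_minus:
  fixes f g :: "'e \<Rightarrow> complex"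
  assumes "(f has_sum s) B" "(g has_sum t) B"
  shows "((\<lambda>e. f e - g e) has_sum (s - t)) B"
  using has_sum_add[OF assms(1), of "\<lambda>e. - g e" "- t"] assms(2) by (simp add: has_sum_uminus)

lemma Parseval:
  assumes B: "is_onb M B" and M: "complex_vector.subspace M" and x: "x \<in> M" and y: "y \<in> M"
  shows "((\<lambda>e. cinner x e * cinner e y) has_sum cinner x y) B"
proof -
  have N: "((\<lambda>e. complex_of_real ((cmod (cinner z e))\<^sup>2)) has_sum complex_of_real ((norm z)\<^sup>2)) B"
    if "z \<in> M" for z
    using has_sum_of_real[OF Parseval_norm[OF B that]] .
  have iy: "\<i> *\<^sub>C y \<in> M" using complex_vector.subspace_scale[OF M y] .
  note in_M = complex_vector.subspace_add[OF M x y] complex_vector.subspace_diff[OF M x y]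
    complex_vector.subspace_add[OF M x iy] complex_vector.subspace_diff[OF M x iy]
  have "((\<lambda>e. (of_real ((cmod (cinner (x + y) e))\<^sup>2) - of_real ((cmod (cinner (x - y) e))\<^sup>2)
     + \<i> * of_real ((cmod (cinner (x + \<i> *\<^sub>C y) e))\<^sup>2)
     - \<i> * of_real ((cmod (cinner (x - \<i> *\<^sub>C y) e))\<^sup>2)) * (1/4)) has_sum (4 * cinner x y) * (1/4)) B"
    unfolding polarization[of x y]
    by (intro has_sum_cmult_left has_sum_minus has_sum_add has_sum_cmult_right N in_M)
  moreover have "(of_real ((cmod (cinner (x + y) e))\<^sup>2) - of_real ((cmod (cinner (x - y) e))\<^sup>2)
     + \<i> * of_real ((cmod (cinner (x + \<i> *\<^sub>C y) e))\<^sup>2)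
     - \<i> * of_real ((cmod (cinner (x - \<i> *\<^sub>C y) e))\<^sup>2)) * (1/4) = cinner x e * cinner e y" for e
  \<comment> \<open>Polarization a second time, now in the space of complex numbers, applied to the
    two coefficients at \<open>e\<close>.\<close>
  proof -
    have "4 * cinner (cinner x e) (cinner y e)
      = of_real ((cmod (cinner (x + y) e))\<^sup>2) - of_real ((cmod (cinner (x - y) e))\<^sup>2)
     + \<i> * of_real ((cmod (cinner (x + \<i> *\<^sub>C y) e))\<^sup>2)
     - \<i> * of_real ((cmod (cinner (x - \<i> *\<^sub>C y) e))\<^sup>2)"
      unfolding polarization[of "cinner x e" "cinner y e"] by (simp add: cinner_simps scaleC_complex_def)
    from this[symmetric] show ?thesis
      using cinner_commute[of e y] by (simp only:) (simp add: cinner_complex_def)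
  qed
  ultimately have "((\<lambda>e. cinner x e * cinner e y) has_sum (4 * cinner x y) * (1/4)) B"
    by (simp only:)
  moreover have "(4 * cinner x y) * (1/4) = cinner x y" by simp
  ultimately show ?thesis by (simp only:)
qed

text \<open>\<open>trace_on\<close> uses an unspecified orthonormal basis. By
  \<open>Parseval\<close> each rank one term contributes the same number in every basis of
  \<open>M\<close>, provided both of its vectors lie in \<open>M\<close>.\<close>

lemma trace_on_finite_rank:
  fixes M :: "'a::chilbert_space set"
  assumes M: "complex_vector.subspace M" "closed M"
    and ab: "\<And>j. j \<in> J \<Longrightarrow> a j \<in> M" "\<And>j. j \<in> J \<Longrightarrow> b j \<in> M"
    and A: "\<And>x. x \<in> M \<Longrightarrow> A x = (\<Sum>j\<in>J. cinner x (b j) *\<^sub>C a j)"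
  shows "trace_on M A = (\<Sum>j\<in>J. cinner (a j) (b j))"
proof -
  define B where "B = (SOME B. is_onb M B)"
  have B: "is_onb M B" unfolding B_def using onb_exists[OF M] by (rule someI_ex)
  have "((\<lambda>e. \<Sum>j\<in>J. cinner (a j) e * cinner e (b j)) has_sum (\<Sum>j\<in>J. cinner (a j) (b j))) B"
    by (intro has_sum_finite_sum Parseval[OF B M(1)] ab)
  then have "((\<lambda>e. cinner (A e) e) has_sum (\<Sum>j\<in>J. cinner (a j) (b j))) B"
  proof (rule has_sum_cong[THEN iffD1, rotated])
    fix e assume "e \<in> B"
    then have "e \<in> M" using B by (auto simp: is_onb_iff)
    then show "(\<Sum>j\<in>J. cinner (a j) e * cinner e (b j)) = cinner (A e) e"
      by (simp add: A cinner_sum_left cinner_scaleC_left mult.commute)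
  qed
  then show ?thesis unfolding trace_on_def B_def[symmetric] by (rule infsumI)
qed

section \<open>Square roots of positive operators\<close>

text \<open>The Taylor coefficients of \<open>1 - sqrt (1 - z)\<close>, from \<open>2 y = z + y\<^sup>2\<close>.\<close>

fun sqrt_coeff :: "nat \<Rightarrow> real" where
  "sqrt_coeff n = (if n = 0 then 0 else if n = 1 then 1 / 2
     else (\<Sum>i\<in>{1..<n}. sqrt_coeff i * sqrt_coeff (n - i)) / 2)"

declare sqrt_coeff.simps [simp del]

lemma sqrt_coeff_nonneg: "0 \<le> sqrt_coeff n"
proof (induction n rule: less_induct)
  case (less n)
  then show ?case
    by (subst sqrt_coeff.simps) (auto intro!: sum_nonneg mult_nonneg_nonneg)
qed

lemma sqrt_coeff_0: "sqrt_coeff 0 = 0"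
  by (simp add: sqrt_coeff.simps)

text \<open>The identity 2 y = z + y^2 read off at degree n. Since the coefficient at 0 vanishes,
  the convolution may run over all i \<le> n, the form needed for a Cauchy product.\<close>

lemma sqrt_coeff_rec:
  "2 * sqrt_coeff n = (if n = 1 then 1 else 0) + (\<Sum>i\<le>n. sqrt_coeff i * sqrt_coeff (n - i))"
proof -
  have *: "(\<Sum>i\<le>n. sqrt_coeff i * sqrt_coeff (n - i)) = (\<Sum>i\<in>{1..<n}. sqrt_coeff i * sqrt_coeff (n - i))"
  proof (rule sum.mono_neutral_right)
    show "\<forall>i\<in>{..n} - {1..<n}. sqrt_coeff i * sqrt_coeff (n - i) = 0"
    proof
      fix i assume "i \<in> {..n} - {1..<n}"
      then have "i = 0 \<or> i = n" by auto
      then show "sqrt_coeff i * sqrt_coeff (n - i) = 0" by (auto simp: sqrt_coeff_0)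
    qed
  qed auto
  show ?thesis unfolding * by (subst sqrt_coeff.simps) auto
qed

text \<open>The partial sums S_N satisfy 2 S_{N+1} \<le> 1 + S_N^2, which keeps them below
  1.\<close>

lemma sqrt_coeff_sum_le: "(\<Sum>n\<le>N. sqrt_coeff n) \<le> 1"
proof (induction N)
  case 0
  show ?case by (simp add: sqrt_coeff_0)
next
  case (Suc N)
  let ?S = "\<Sum>n\<le>N. sqrt_coeff n"
  have "(\<Sum>n\<le>Suc N. \<Sum>i\<le>n. sqrt_coeff i * sqrt_coeff (n - i))
      = (\<Sum>(i, j)\<in>{(i, j). i + j \<le> Suc N}. sqrt_coeff i * sqrt_coeff j)"
    by (rule sum.triangle_reindex_eq[symmetric])
  \<comment> \<open>An index N+1 forces the other one to be 0, where the coefficient vanishes; thus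
    only S_N enters on the right.\<close>
  also have "\<dots> = (\<Sum>(i, j)\<in>{(i, j). i + j \<le> Suc N} \<inter> {..N} \<times> {..N}. sqrt_coeff i * sqrt_coeff j)"
  proof (rule sum.mono_neutral_right)
    show "finite {(i, j). i + j \<le> Suc N}"
      by (rule finite_subset[of _ "{..Suc N} \<times> {..Suc N}"]) auto
    show "\<forall>p\<in>{(i, j). i + j \<le> Suc N} - {(i, j). i + j \<le> Suc N} \<inter> {..N} \<times> {..N}.
        (case p of (i, j) \<Rightarrow> sqrt_coeff i * sqrt_coeff j) = 0"
    proof clarify
      fix i j assume "i + j \<le> Suc N" "(i, j) \<notin> {(i, j). i + j \<le> Suc N} \<inter> {..N} \<times> {..N}"
      then have "i = 0 \<or> j = 0" by auto
      then show "sqrt_coeff i * sqrt_coeff j = 0" by (auto simp: sqrt_coeff_0)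
    qed
  qed auto
  also have "\<dots> \<le> (\<Sum>(i, j)\<in>{..N} \<times> {..N}. sqrt_coeff i * sqrt_coeff j)"
    by (rule sum_mono2) (auto intro: mult_nonneg_nonneg sqrt_coeff_nonneg)
  also have "\<dots> = ?S * ?S"
    by (simp add: sum_product sum.cartesian_product)
  finally have "(\<Sum>n\<le>Suc N. \<Sum>i\<le>n. sqrt_coeff i * sqrt_coeff (n - i)) \<le> ?S * ?S" .
  moreover have "?S * ?S \<le> 1"
    using Suc by (intro mult_le_one sum_nonneg sqrt_coeff_nonneg)
  moreover have "2 * (\<Sum>n\<le>Suc N. sqrt_coeff n)
     = (\<Sum>n\<le>Suc N. if n = 1 then 1 else 0) + (\<Sum>n\<le>Suc N. \<Sum>i\<le>n. sqrt_coeff i * sqrt_coeff (n - i))"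
    unfolding sum_distrib_left sqrt_coeff_rec sum.distrib ..
  moreover have "(\<Sum>n\<le>Suc N. if n = 1 then 1 else 0) = (1 :: real)"
    by (subst sum.delta) auto
  ultimately show ?case by linarith
qed

lemma sqrt_coeff_summable: "sqrt_coeff summable_on UNIV" (is ?summable)
  and sqrt_coeff_infsum_le: "(\<Sum>\<^sub>\<infinity>n. sqrt_coeff n) \<le> 1" (is ?le)
proof -
  have le: "sum sqrt_coeff F \<le> 1" if F: "finite F" for F
  proof -
    have "F \<subseteq> {..Max (insert 0 F)}" using F by (auto intro: Max_ge)
    then have "sum sqrt_coeff F \<le> (\<Sum>n\<le>Max (insert 0 F). sqrt_coeff n)"
      by (intro sum_mono2 sqrt_coeff_nonneg) auto
    also have "\<dots> \<le> 1" by (rule sqrt_coeff_sum_le)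
    finally show ?thesis .
  qed
  show s: ?summable
    by (rule nonneg_bdd_above_summable_on) (auto intro!: bdd_aboveI[where M = 1] le sqrt_coeff_nonneg)
  show ?le using s le by (intro infsum_le_finite_sums) auto
qed

text \<open>The operator I - (I - C)^(1/2) for a contraction \<open>C\<close>; the root itself is x
  - \<open>sqrt_series C x\<close>.\<close>

definition sqrt_series :: "('a::chilbert_space \<Rightarrow> 'a) \<Rightarrow> 'a \<Rightarrow> 'a" where
  "sqrt_series C x = (\<Sum>\<^sub>\<infinity>n. sqrt_coeff n *\<^sub>R (C ^^ n) x)"

definition contraction :: "('a::complex_inner \<Rightarrow> 'b::complex_inner) \<Rightarrow> bool" where
  "contraction C \<longleftrightarrow> bounded_clinear C \<and> (\<forall>x. norm (C x) \<le> norm x)"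

definition self_adjoint :: "('a::complex_inner \<Rightarrow> 'a) \<Rightarrow> bool" where
  "self_adjoint C \<longleftrightarrow> (\<forall>x y. cinner (C x) y = cinner x (C y))"

lemma self_adjointD: "self_adjoint C \<Longrightarrow> cinner (C x) y = cinner x (C y)"
  by (simp add: self_adjoint_def)

lemma contraction_bounded_clinear: "contraction C \<Longrightarrow> bounded_clinear C"
  and contraction_norm: "contraction C \<Longrightarrow> norm (C x) \<le> norm x"
  by (simp_all add: contraction_def)

context
  fixes C :: "'a::chilbert_space \<Rightarrow> 'a"
  assumes C: "contraction C"
begin

lemma norm_funpow_contraction: "norm ((C ^^ n) x) \<le> norm x"
  by (induction n) (auto intro: order_trans[OF contraction_norm[OF C]])

lemma bounded_clinear_funpow: "bounded_clinear (C ^^ n)"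
proof (induction n)
  case 0
  show ?case using bounded_clinear_id by (simp add: id_def)
next
  case (Suc n)
  show ?case
    using bounded_clinear_compose[OF contraction_bounded_clinear[OF C] Suc] by (simp add: comp_def)
qed

lemma sqrt_series_abs_summable:
  "(\<lambda>n. norm (sqrt_coeff n *\<^sub>R (C ^^ n) x)) summable_on UNIV"
proof (rule Infinite_Sum.abs_summable_on_comparison_test')
  show "(\<lambda>n. sqrt_coeff n * norm x) summable_on UNIV"
    by (rule summable_on_cmult_left[OF sqrt_coeff_summable])
  show "norm (sqrt_coeff n *\<^sub>R (C ^^ n) x) \<le> sqrt_coeff n * norm x" for n
    by (simp add: sqrt_coeff_nonneg mult_left_mono norm_funpow_contraction)
qed

lemma sqrt_series_has_sum:
  "((\<lambda>n. sqrt_coeff n *\<^sub>R (C ^^ n) x) has_sum sqrt_series C x) UNIV"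
  unfolding sqrt_series_def
  by (rule has_sum_infsum[OF abs_summable_summable[OF sqrt_series_abs_summable]])

lemma norm_sqrt_series: "norm (sqrt_series C x) \<le> norm x"
proof -
  have "norm (sqrt_series C x) \<le> (\<Sum>\<^sub>\<infinity>n. norm (sqrt_coeff n *\<^sub>R (C ^^ n) x))"
    unfolding sqrt_series_def by (rule norm_infsum_bound[OF sqrt_series_abs_summable])
  also have "\<dots> \<le> (\<Sum>\<^sub>\<infinity>n. sqrt_coeff n * norm x)"
    by (intro infsum_mono sqrt_series_abs_summable summable_on_cmult_left[OF sqrt_coeff_summable])
      (simp add: sqrt_coeff_nonneg mult_left_mono norm_funpow_contraction)
  also have "\<dots> = (\<Sum>\<^sub>\<infinity>n. sqrt_coeff n) * norm x"
    by (rule infsum_cmult_left[OF sqrt_coeff_summable])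
  also have "\<dots> \<le> norm x"
    using mult_right_mono[OF sqrt_coeff_infsum_le, of "norm x"] by simp
  finally show ?thesis .
qed

text \<open>The relation passes to powers and, by continuity, to the series. It serves for complex
  scalars, for the commutation in the uniqueness of the root, and for moving defect operators across
  the row operator.\<close>

lemma sqrt_series_intertwine:
  assumes D: "contraction D" and S: "bounded_clinear S" "\<And>x. S (C x) = D (S x)"
  shows "S (sqrt_series C x) = sqrt_series D (S x)"
proof -
  have "S ((C ^^ n) x) = (D ^^ n) (S x)" for n
    by (induction n) (simp_all add: S(2))
  then have "((\<lambda>n. sqrt_coeff n *\<^sub>R (D ^^ n) (S x)) has_sum S (sqrt_series C x)) UNIV"
    using has_sum_bounded_linear[OF bounded_clinear_bounded_linear[OF S(1)] sqrt_series_has_sum[of x]]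
    by (simp add: bounded_clinear_scaleR[OF S(1)])
  then show ?thesis unfolding sqrt_series_def[of D] by (rule infsumI[symmetric])
qed

lemma bounded_clinear_sqrt_series: "bounded_clinear (sqrt_series C)"
proof (rule bounded_clinearI)
  show "sqrt_series C (x + y) = sqrt_series C x + sqrt_series C y" for x y
  proof (rule has_sum_unique[OF sqrt_series_has_sum])
    show "((\<lambda>n. sqrt_coeff n *\<^sub>R (C ^^ n) (x + y)) has_sum sqrt_series C x + sqrt_series C y) UNIV"
      using has_sum_add[OF sqrt_series_has_sum sqrt_series_has_sum, of x y]
      by (simp add: bounded_clinear_add[OF bounded_clinear_funpow] scaleR_add_right)
  qed
  \<comment> \<open>Multiplication by \<open>c\<close> intertwines \<open>C\<close> with
    itself.\<close>
  show "sqrt_series C (c *\<^sub>C x) = c *\<^sub>C sqrt_series C x" for c x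
    by (rule sqrt_series_intertwine[OF C bounded_clinear_scaleC_op, symmetric])
      (simp add: bounded_clinear_scaleC[OF contraction_bounded_clinear[OF C]])
  show "norm (sqrt_series C x) \<le> 1 * norm x" for x
    using norm_sqrt_series by simp
qed

text \<open>An absolutely convergent double series summed in two ways: by rows it is
  \<open>sqrt_series C\<close> applied twice, by diagonals it is given by
  \<open>sqrt_coeff_rec\<close>.\<close>

lemma sqrt_series_eq: "2 *\<^sub>R sqrt_series C x = C x + sqrt_series C (sqrt_series C x)"
proof -
  let ?f = "\<lambda>(i, j). (sqrt_coeff i * sqrt_coeff j) *\<^sub>R (C ^^ (i + j)) x"
  have inner: "((\<lambda>j. ?f (i, j)) has_sum (sqrt_coeff i *\<^sub>R (C ^^ i) (sqrt_series C x))) UNIV" for i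
    using has_sum_bounded_linear[OF bounded_linear_scaleR_right,
        OF has_sum_bounded_linear[OF bounded_clinear_bounded_linear[OF bounded_clinear_funpow]
          sqrt_series_has_sum], of "sqrt_coeff i" i x]
    by (simp add: bounded_clinear_scaleR[OF bounded_clinear_funpow] funpow_add)
  have "(\<lambda>p. norm (?f p)) summable_on UNIV \<times> UNIV"
  proof (rule Infinite_Sum.abs_summable_on_comparison_test')
    show "norm (?f p) \<le> (case p of (i, j) \<Rightarrow> (sqrt_coeff i * norm x) * sqrt_coeff j)" for p
      using mult_left_mono[OF norm_funpow_contraction[of "fst p + snd p" x],
          of "sqrt_coeff (fst p) * sqrt_coeff (snd p)"]
      by (cases p) (simp add: sqrt_coeff_nonneg abs_mult mult_ac)
    have "(\<lambda>p. norm (case p of (i, j) \<Rightarrow> (sqrt_coeff i * norm x) * sqrt_coeff j)) summable_on UNIV \<times> UNIV"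
      unfolding Infinite_Sum.abs_summable_on_Sigma_iff
      by (auto simp: sqrt_coeff_nonneg abs_mult infsum_cmult_right' infsum_nonneg
          intro!: summable_on_cmult_right summable_on_cmult_left sqrt_coeff_summable)
    then show "(\<lambda>p. case p of (i, j) \<Rightarrow> (sqrt_coeff i * norm x) * sqrt_coeff j) summable_on UNIV \<times> UNIV"
      by (rule abs_summable_summable)
  qed
  then have summable: "?f summable_on UNIV \<times> UNIV" by (rule abs_summable_summable)
  have 1: "(?f has_sum sqrt_series C (sqrt_series C x)) (UNIV \<times> UNIV)"
    by (rule has_sum_SigmaI[OF inner sqrt_series_has_sum summable])
  have 2: "((\<lambda>(n, i). (sqrt_coeff i * sqrt_coeff (n - i)) *\<^sub>R (C ^^ n) x)
      has_sum sqrt_series C (sqrt_series C x)) (Sigma UNIV (\<lambda>n. {..n}))"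
    by (rule has_sum_reindex_bij_witness[where i = "\<lambda>(n, i). (i, n - i)"
          and j = "\<lambda>(i, j). (i + j, i)", THEN iffD1, OF _ _ _ _ _ _ 1]) auto
  have "((\<lambda>n. \<Sum>i\<le>n. (sqrt_coeff i * sqrt_coeff (n - i)) *\<^sub>R (C ^^ n) x)
      has_sum sqrt_series C (sqrt_series C x)) UNIV"
    by (rule has_sum_SigmaD[OF 2]) simp
  moreover have "((\<lambda>n. if n = 1 then (C ^^ n) x else 0) has_sum C x) UNIV"
    by (rule has_sum_finite_neutralI[where B = "{1}"]) auto
  ultimately have "((\<lambda>n. (if n = 1 then (C ^^ n) x else 0)
      + (\<Sum>i\<le>n. (sqrt_coeff i * sqrt_coeff (n - i)) *\<^sub>R (C ^^ n) x))
      has_sum (C x + sqrt_series C (sqrt_series C x))) UNIV"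
    by (intro has_sum_add)
  moreover have "(if n = 1 then (C ^^ n) x else 0)
      + (\<Sum>i\<le>n. (sqrt_coeff i * sqrt_coeff (n - i)) *\<^sub>R (C ^^ n) x)
      = 2 *\<^sub>R sqrt_coeff n *\<^sub>R (C ^^ n) x" for n
  proof -
    have "2 *\<^sub>R sqrt_coeff n *\<^sub>R (C ^^ n) x = (2 * sqrt_coeff n) *\<^sub>R (C ^^ n) x" by simp
    also have "\<dots> = (if n = 1 then (C ^^ n) x else 0)
      + (\<Sum>i\<le>n. (sqrt_coeff i * sqrt_coeff (n - i)) *\<^sub>R (C ^^ n) x)"
      unfolding sqrt_coeff_rec[of n] scaleR_add_left scaleR_sum_left by simp
    finally show ?thesis ..
  qed
  ultimately have "((\<lambda>n. 2 *\<^sub>R sqrt_coeff n *\<^sub>R (C ^^ n) x)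
      has_sum (C x + sqrt_series C (sqrt_series C x))) UNIV" by (simp only:)
  moreover have "((\<lambda>n. 2 *\<^sub>R sqrt_coeff n *\<^sub>R (C ^^ n) x) has_sum 2 *\<^sub>R sqrt_series C x) UNIV"
    by (rule has_sum_bounded_linear[OF bounded_linear_scaleR_right sqrt_series_has_sum])
  ultimately show ?thesis by (rule has_sum_unique[rotated])
qed

lemma sqrt_series_square:
  "(x - sqrt_series C x) - sqrt_series C (x - sqrt_series C x) = x - C x"
  using sqrt_series_eq[of x]
  by (simp add: bounded_clinear_diff[OF bounded_clinear_sqrt_series] scaleR_2 algebra_simps)

lemma self_adjoint_sqrt_series:
  assumes "self_adjoint C"
  shows "self_adjoint (sqrt_series C)"
  unfolding self_adjoint_def
proof (intro allI)
  fix x y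
  have pow: "cinner ((C ^^ n) x) y = cinner x ((C ^^ n) y)" for n x y
    by (induction n arbitrary: x y) (simp_all add: self_adjointD[OF assms] funpow_swap1)
  have "((\<lambda>n. cinner (sqrt_coeff n *\<^sub>R (C ^^ n) x) y) has_sum cinner (sqrt_series C x) y) UNIV"
    using has_sum_bounded_linear[OF bounded_clinear_bounded_linear[OF bounded_clinear_cinner_left]
        sqrt_series_has_sum] .
  moreover have "((\<lambda>n. cinner x (sqrt_coeff n *\<^sub>R (C ^^ n) y)) has_sum cinner x (sqrt_series C y)) UNIV"
    using has_sum_bounded_linear[OF bounded_linear_cinner_right sqrt_series_has_sum] .
  ultimately show "cinner (sqrt_series C x) y = cinner x (sqrt_series C y)"
    by (auto simp: cinner_simps pow intro: has_sum_unique)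
qed

lemma positive_op_sqrt_series:
  assumes "self_adjoint C"
  shows "positive_op (\<lambda>x. x - sqrt_series C x)"
  unfolding positive_op_def
proof (intro conjI allI)
  show "bounded_clinear (\<lambda>x. x - sqrt_series C x)"
    by (intro bounded_clinear_minus_op bounded_clinear_id bounded_clinear_sqrt_series)
  fix x
  have "Im (cinner (sqrt_series C x) x) = 0"
    using self_adjointD[OF self_adjoint_sqrt_series[OF assms], of x x]
      cinner_commute[of "sqrt_series C x" x]
    by (metis add_cancel_right_right add_self_div_2 cnj.simps(2) neg_equal_0_iff_equal
        equal_neg_zero)
  moreover have "Re (cinner (sqrt_series C x) x) \<le> (norm x)\<^sup>2"
  proof -
    have "Re (cinner (sqrt_series C x) x) \<le> norm (sqrt_series C x) * norm x"
      using complex_Re_le_cmod cinner_Cauchy_Schwarz by (rule order_trans)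
    also have "\<dots> \<le> norm x * norm x" by (intro mult_right_mono norm_sqrt_series) simp
    finally show ?thesis by (simp add: power2_eq_square)
  qed
  ultimately show "cinner (x - sqrt_series C x) x \<in> \<real>\<^sub>\<ge>\<^sub>0"
    unfolding complex_nonneg_Reals_iff cinner_diff_left
    by (simp add: norm_eq_Re_cinner) (simp add: cinner_self)
qed

end

section \<open>Uniqueness of the positive square root\<close>

lemma positive_op_bounded_clinear: "positive_op A \<Longrightarrow> bounded_clinear A"
  by (simp add: positive_op_def)

lemma positive_op_cinner:
  assumes "positive_op A"
  shows "Re (cinner (A x) x) \<ge> 0" "Im (cinner (A x) x) = 0"
  using assms by (simp_all add: positive_op_def complex_nonneg_Reals_iff)

text \<open>The quadratic form is real; its values at x + y and x + iy fix the imaginary and the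
  real part of the sesquilinear form.\<close>

lemma positive_op_self_adjoint:
  assumes A: "positive_op A"
  shows "self_adjoint A"
  unfolding self_adjoint_def
proof (intro allI)
  fix x y
  note simps = bounded_clinear_add[OF positive_op_bounded_clinear[OF A]]
    bounded_clinear_scaleC[OF positive_op_bounded_clinear[OF A]]
  have "Im (cinner (A x) y) = - Im (cinner (A y) x)"
    using positive_op_cinner(2)[OF A, of "x + y"] positive_op_cinner(2)[OF A, of x]
      positive_op_cinner(2)[OF A, of y] by (simp add: simps cinner_simps)
  moreover have "Re (cinner (A x) y) = Re (cinner (A y) x)"
    using positive_op_cinner(2)[OF A, of "x + \<i> *\<^sub>C y"] positive_op_cinner(2)[OF A, of x]
      positive_op_cinner(2)[OF A, of y] by (simp add: simps cinner_simps)
  ultimately have "cinner (A x) y = cnj (cinner (A y) x)" by (simp add: complex_eq_iff)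
  then show "cinner (A x) y = cinner x (A y)" using cinner_commute[of x "A y"] by simp
qed

lemma positive_op_null:
  assumes A: "positive_op A" and y: "cinner (A y) y = 0"
  shows "A y = 0"
proof (rule ccontr)
  assume nz: "A y \<noteq> 0"
  note simps = bounded_clinear_simps[OF positive_op_bounded_clinear[OF A]]
  \<comment> \<open>The form is tested at y - t A y, where it equals t (t b - 2 a). The summand 1
    keeps the denominator positive and gives t b \<le> a, so the value would be negative.\<close>
  define a b t where "a = (norm (A y))\<^sup>2" and "b = Re (cinner (A (A y)) (A y))" and "t = a / (b + 1)"
  have a: "a > 0" using nz by (simp add: a_def)
  have b: "b \<ge> 0" unfolding b_def by (rule positive_op_cinner(1)[OF A])
  have "Re (cinner (A (y - t *\<^sub>R A y)) (y - t *\<^sub>R A y)) = - 2 * t * a + t * t * b"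
    using y self_adjointD[OF positive_op_self_adjoint[OF A], of "A y" y]
    by (simp add: simps cinner_simps a_def b_def norm_eq_Re_cinner algebra_simps)
  then have "0 \<le> - 2 * t * a + t * t * b" using positive_op_cinner(1)[OF A] by metis
  also have "\<dots> = t * (t * b - 2 * a)" by (simp add: algebra_simps)
  finally have "0 \<le> t * (t * b - 2 * a)" .
  moreover have "t > 0" using a b by (simp add: t_def)
  ultimately have "2 * a \<le> t * b" by (simp add: zero_le_mult_iff)
  also have "\<dots> \<le> a" using a b by (simp add: t_def field_simps)
  finally show False using a by simp
qed

text \<open>Any positive root \<open>B'\<close> commutes with \<open>C\<close>, because C = I -
  B'^2, hence with the series. So B^2 - B'^2 factors as (B + B')(B - B').\<close>

lemma sqrt_op_eq:
  fixes C :: "'a::chilbert_space \<Rightarrow> 'a"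
  assumes C: "contraction C" "self_adjoint C"
  shows "sqrt_op (\<lambda>x. x - C x) = (\<lambda>x. x - sqrt_series C x)"
  unfolding sqrt_op_def
proof (rule the_equality)
  let ?B = "\<lambda>x. x - sqrt_series C x"
  have B: "positive_op ?B" by (rule positive_op_sqrt_series[OF C])
  then show "positive_op ?B \<and> (\<forall>x. ?B (?B x) = x - C x)"
    using sqrt_series_square[OF C(1)] by blast
  fix B' assume "positive_op B' \<and> (\<forall>x. B' (B' x) = x - C x)"
  then have B': "positive_op B'" and sq: "\<And>x. B' (B' x) = x - C x" by auto
  note simps = bounded_clinear_simps[OF positive_op_bounded_clinear[OF B']]
    bounded_clinear_simps[OF positive_op_bounded_clinear[OF B]]
  have "C x = x - B' (B' x)" for x by (simp add: sq)
  then have "B' (C x) = C (B' x)" for x by (simp add: simps)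
  then have "B' (sqrt_series C x) = sqrt_series C (B' x)" for x
    by (intro sqrt_series_intertwine C positive_op_bounded_clinear B')
  then have comm: "B' (?B x) = ?B (B' x)" for x by (simp add: simps)
  show "B' = ?B"
  proof
    fix x
    \<comment> \<open>Since (B + B') y = 0, both nonnegative forms vanish at y, so B and B'
      annihilate y; then y is orthogonal to (B - B') x, which is y itself.\<close>
    define y where "y = ?B x - B' x"
    have 1: "?B y + B' y = 0"
    proof -
      have "?B y = ?B (?B x) - ?B (B' x)"
        unfolding y_def using bounded_clinear_diff[OF positive_op_bounded_clinear[OF B]] .
      moreover have "B' y = B' (?B x) - B' (B' x)"
        unfolding y_def using bounded_clinear_diff[OF positive_op_bounded_clinear[OF B']] .
      ultimately show ?thesis using comm[of x] sq[of x] sqrt_series_square[OF C(1), of x] by simp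
    qed
    then have "cinner (?B y) y + cinner (B' y) y = 0"
      by (metis cinner_add_left cinner_zero_left)
    moreover from this have "Re (cinner (?B y) y) + Re (cinner (B' y) y) = 0"
      by (metis plus_complex.simps(1) zero_complex.simps(1))
    ultimately have "cinner (?B y) y = 0" "cinner (B' y) y = 0"
      using positive_op_cinner[OF B, of y] positive_op_cinner[OF B', of y]
      by (simp_all add: complex_eq_iff)
    then have null: "?B y = 0" "B' y = 0"
      using positive_op_null[OF B, of y] positive_op_null[OF B', of y] by blast+
    have "cinner y y = cinner (?B x) y - cinner (B' x) y"
      unfolding y_def by (rule cinner_diff_left)
    also have "\<dots> = cinner x (?B y) - cinner x (B' y)"
      using self_adjointD[OF positive_op_self_adjoint[OF B], of x y]
        self_adjointD[OF positive_op_self_adjoint[OF B'], of x y] by metis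
    also have "\<dots> = 0" unfolding null by simp
    finally have "y = 0" by (simp add: cinner_eq_zero_iff)
    then show "B' x = ?B x" unfolding y_def by simp
  qed
qed

section \<open>Square-summable families and tensor products of operators\<close>

lemma coord_zero [simp]: "coord 0 w = 0"
  and coord_add [simp]: "coord (x + y) w = coord x w + coord y w"
  and coord_diff [simp]: "coord (x - y) w = coord x w - coord y w"
  and coord_minus [simp]: "coord (- x) w = - coord x w"
  and coord_scaleC [simp]: "coord (c *\<^sub>C x) w = c *\<^sub>C coord x w"
  and coord_scaleR [simp]: "coord (r *\<^sub>R x) w = r *\<^sub>R coord x w"
  by (simp_all add: zero_ell2.rep_eq plus_ell2.rep_eq minus_ell2.rep_eq uminus_ell2.rep_eq
      scaleC_ell2.rep_eq scaleR_ell2.rep_eq)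

lemma coord_sum [simp]: "coord (sum f I) w = (\<Sum>i\<in>I. coord (f i) w)"
  by (induction I rule: infinite_finite_induct) simp_all

lemma ell2_eqI: "(\<And>w. coord x w = coord y w) \<Longrightarrow> x = y"
  by (metis coord_inject ext)

lemma sum_norm_coord_le:
  assumes "finite F"
  shows "(\<Sum>w\<in>F. (norm (coord x w))\<^sup>2) \<le> (norm x)\<^sup>2"
  using L2_set_le_ell2[OF assms, of x] unfolding L2_set_def
  by (metis abs_norm_cancel norm_ge_zero power_mono real_sqrt_abs real_sqrt_le_iff)

lemma norm_coord_le: "norm (coord x w) \<le> norm x"
  by (rule power2_le_imp_le) (use sum_norm_coord_le[of "{w}" x] in simp_all)

lemma
  fixes f :: "'i \<Rightarrow> 'a::complex_inner"
  assumes B: "0 \<le> B" and le: "\<And>F. finite F \<Longrightarrow> (\<Sum>w\<in>F. (norm (f w))\<^sup>2) \<le> B\<^sup>2"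
  shows coord_Abs_ell2: "coord (Abs_ell2 f) = f"
    and norm_Abs_ell2_le: "norm (Abs_ell2 f) \<le> B"
proof -
  have *: "(\<lambda>w. (norm (f w))\<^sup>2) summable_on UNIV \<and> sqrt (\<Sum>\<^sub>\<infinity>w. (norm (f w))\<^sup>2) \<le> B"
    by (rule ell2_boundI) (use B le in \<open>simp add: L2_set_def real_le_lsqrt sum_nonneg\<close>)
  then show 1: "coord (Abs_ell2 f) = f" by (simp add: Abs_ell2_inverse)
  show "norm (Abs_ell2 f) \<le> B" using * unfolding norm_ell2.rep_eq 1 by blast
qed

lemma coord_Abs_ell2_finite:
  fixes f :: "'i \<Rightarrow> 'a::complex_inner"
  assumes G: "finite G" and zero: "\<And>w. w \<notin> G \<Longrightarrow> f w = 0"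
  shows "coord (Abs_ell2 f) = f"
proof (rule coord_Abs_ell2)
  fix F :: "'i set" assume F: "finite F"
  have "(\<Sum>w\<in>F. (norm (f w))\<^sup>2) \<le> (\<Sum>w\<in>F \<union> G. (norm (f w))\<^sup>2)"
    using F G by (intro sum_mono2) auto
  also have "\<dots> = (\<Sum>w\<in>G. (norm (f w))\<^sup>2)"
    using F G zero by (intro sum.mono_neutral_right) auto
  also have "\<dots> = (sqrt (\<Sum>w\<in>G. (norm (f w))\<^sup>2))\<^sup>2"
    by (simp add: sum_nonneg)
  finally show "(\<Sum>w\<in>F. (norm (f w))\<^sup>2) \<le> (sqrt (\<Sum>w\<in>G. (norm (f w))\<^sup>2))\<^sup>2" .
qed (simp add: sum_nonneg)

lemma bounded_clinear_coord: "bounded_clinear (\<lambda>x. coord x w)"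
  by (rule bounded_clinearI[where K = 1]) (simp_all add: norm_coord_le)

lemma cinner_ell2_finite:
  assumes "finite F" "\<And>w. w \<notin> F \<Longrightarrow> coord y w = 0"
  shows "cinner x y = (\<Sum>w\<in>F. cinner (coord x w) (coord y w))"
proof -
  have "cinner x y = (\<Sum>\<^sub>\<infinity>w\<in>F. cinner (coord x w) (coord y w))"
    unfolding cinner_ell2.rep_eq
    by (rule infsum_cong_neutral) (use assms in auto)
  then show ?thesis using assms(1) by simp
qed

text \<open>Over words this is the elementary tensor of a basis vector with
  \<open>v\<close>.\<close>

definition single :: "'i \<Rightarrow> 'a::complex_inner \<Rightarrow> ('i, 'a) ell2" where
  "single w v = Abs_ell2 (\<lambda>u. if u = w then v else 0)"

lemma coord_single: "coord (single w v) u = (if u = w then v else 0)"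
proof -
  have "coord (single w v) = (\<lambda>u. if u = w then v else 0)"
    unfolding single_def by (rule coord_Abs_ell2_finite[of "{w}"]) auto
  then show ?thesis by simp
qed

lemma cinner_single: "cinner x (single w v) = cinner (coord x w) v"
  by (subst cinner_ell2_finite[of "{w}"]) (auto simp: coord_single)

lemma norm_diff_finite_sq:
  assumes "finite F"
  shows "(norm (x - (\<Sum>w\<in>F. single w (coord x w))))\<^sup>2 = (norm x)\<^sup>2 - (\<Sum>w\<in>F. (norm (coord x w))\<^sup>2)"
proof -
  let ?s = "\<Sum>w\<in>F. single w (coord x w)"
  have s: "coord ?s w = (if w \<in> F then coord x w else 0)" for w
    using assms by (simp add: coord_single)
  have "cinner x ?s = of_real (\<Sum>w\<in>F. (norm (coord x w))\<^sup>2)"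
    by (simp add: cinner_sum_right cinner_single cinner_self)
  moreover have "cinner ?s ?s = of_real (\<Sum>w\<in>F. (norm (coord x w))\<^sup>2)"
    unfolding cinner_sum_right cinner_single s by (simp add: cinner_self)
  ultimately show ?thesis by (simp only: norm_diff_sq norm_eq_Re_cinner[of ?s]) simp
qed

text \<open>Truncations to finite index sets converge, because the tail of the sum of squares does.
  Continuous identities therefore need checking on \<open>single w v\<close> only.\<close>

lemma ell2_subspace_eq_UNIV:
  fixes S :: "('i, 'a::complex_inner) ell2 set"
  assumes S: "closed S" "0 \<in> S" "\<And>x y. x \<in> S \<Longrightarrow> y \<in> S \<Longrightarrow> x + y \<in> S"
    and single: "\<And>w v. single w v \<in> S"
  shows "x \<in> S"
proof -
  have sumS: "(\<Sum>w\<in>F. single w (coord x w)) \<in> S" for F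
    by (induction F rule: infinite_finite_induct) (auto intro: S single)
  have hs: "((\<lambda>w. (norm (coord x w))\<^sup>2) has_sum (norm x)\<^sup>2) UNIV"
  proof -
    have "(\<lambda>w. (norm (coord x w))\<^sup>2) summable_on UNIV" using coord[of x] by simp
    moreover have "(norm x)\<^sup>2 = (\<Sum>\<^sub>\<infinity>w. (norm (coord x w))\<^sup>2)"
      by (simp add: norm_ell2.rep_eq infsum_nonneg)
    ultimately show ?thesis by simp
  qed
  have "x \<in> closure S"
    unfolding closure_approachable
  proof (intro allI impI)
    fix e :: real assume e: "e > 0"
    obtain F where F: "finite F" "dist (\<Sum>w\<in>F. (norm (coord x w))\<^sup>2) ((norm x)\<^sup>2) \<le> e\<^sup>2 / 2"
      using has_sum_finite_approximation[OF hs, of "e\<^sup>2 / 2"] e by auto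
    have "(norm (x - (\<Sum>w\<in>F. single w (coord x w))))\<^sup>2 \<le> e\<^sup>2 / 2"
      unfolding norm_diff_finite_sq[OF F(1)] using F(2) unfolding dist_real_def by linarith
    also have "\<dots> < e\<^sup>2" using e by simp
    finally have "norm (x - (\<Sum>w\<in>F. single w (coord x w))) < e"
      using e by (simp add: power2_less_imp_less)
    then show "\<exists>y\<in>S. dist y x < e"
      using sumS[of F] by (auto simp: dist_norm norm_minus_commute)
  qed
  then show ?thesis using S(1) by simp
qed

text \<open>The common bound 1 makes the set of convergence closed, by splitting the error in three.
  The bound is required only eventually because the radial operators are controlled just for r in
  [0, 1).\<close>

lemma tendsto_contractions:
  fixes A :: "'r \<Rightarrow> ('i, 'a::complex_inner) ell2 \<Rightarrow> 'b::complex_inner"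
  assumes A: "\<forall>\<^sub>F r in G. contraction (A r)" and B: "contraction B"
    and single: "\<And>w v. ((\<lambda>r. A r (single w v)) \<longlongrightarrow> B (single w v)) G"
  shows "((\<lambda>r. A r x) \<longlongrightarrow> B x) G"
proof -
  let ?S = "{x. ((\<lambda>r. A r x) \<longlongrightarrow> B x) G}"
  have "x \<in> ?S"
  proof (rule ell2_subspace_eq_UNIV)
    have "((\<lambda>r. A r 0) \<longlongrightarrow> 0) G"
      using A by (auto intro!: tendsto_eventually elim!: eventually_mono
          simp: bounded_clinear_zero[OF contraction_bounded_clinear])
    then show "0 \<in> ?S" by (simp add: bounded_clinear_zero[OF contraction_bounded_clinear[OF B]])
  next
    fix x y assume xy: "x \<in> ?S" "y \<in> ?S"
    then have "((\<lambda>r. A r x + A r y) \<longlongrightarrow> B x + B y) G" by (auto intro: tendsto_add)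
    moreover have "\<forall>\<^sub>F r in G. A r x + A r y = A r (x + y)"
      using A by eventually_elim (simp add: bounded_clinear_add[OF contraction_bounded_clinear])
    ultimately show "x + y \<in> ?S"
      by (simp add: bounded_clinear_add[OF contraction_bounded_clinear[OF B]] tendsto_cong)
  next
    show "closed ?S"
    proof (subst closure_subset_eq[symmetric], rule subsetI)
      fix x assume x: "x \<in> closure ?S"
      show "x \<in> ?S"
      proof (clarify, rule tendstoI)
        fix e :: real assume "e > 0"
        then obtain y where y: "((\<lambda>r. A r y) \<longlongrightarrow> B y) G" "dist y x < e / 3"
          using x unfolding closure_approachable by (metis (lifting) divide_pos_pos mem_Collect_eq zero_less_numeral)
        have "\<forall>\<^sub>F r in G. dist (A r y) (B y) < e / 3"
          using y(1) \<open>e > 0\<close> by (intro tendstoD) auto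
        then show "\<forall>\<^sub>F r in G. dist (A r x) (B x) < e"
          using A
        proof eventually_elim
          case (elim r)
          have "dist (A r x) (A r y) \<le> dist y x"
            using contraction_norm[OF elim(2), of "x - y"]
            by (simp add: dist_norm norm_minus_commute bounded_clinear_diff[OF contraction_bounded_clinear[OF elim(2)]])
          moreover have "dist (B y) (B x) \<le> dist y x"
            using contraction_norm[OF B, of "y - x"]
            by (simp add: dist_norm bounded_clinear_diff[OF contraction_bounded_clinear[OF B]])
          moreover have "dist (A r x) (B x) \<le> dist (A r x) (A r y) + dist (A r y) (B y) + dist (B y) (B x)"
            using dist_triangle[of "A r x" "B x" "A r y"] dist_triangle[of "A r y" "B x" "B y"] by linarith
          ultimately show ?case using y(2) elim(1) by linarith
        qed
      qed
    qed
  qed (simp add: single)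
  then show ?thesis by simp
qed

lemma closed_eq_bounded_clinear:
  assumes "bounded_clinear A" "bounded_clinear B"
  shows "closed {x. A x = B x}"
  using assms by (intro closed_Collect_eq) (auto intro!: continuous_at_imp_continuous_on bounded_clinear_isCont)

section \<open>Operators that reindex a family and act on its entries\<close>

definition partial_inj :: "('j \<Rightarrow> 'i option) \<Rightarrow> bool" where
  "partial_inj \<phi> \<longleftrightarrow> (\<forall>w w' v. \<phi> w = Some v \<longrightarrow> \<phi> w' = Some v \<longrightarrow> w = w')"

text \<open>The output at \<open>w\<close> is read from the input at \<open>\<phi> w\<close>, or is
  0. With \<open>\<phi>\<close> partially injective no entry is read twice, so the bound of
  \<open>A\<close> carries over. The identity, the creation operators and the length projections,
  each tensored with an operator, all have this shape.\<close>

definition ell2_op :: "('j \<Rightarrow> 'i option) \<Rightarrow> ('a::complex_inner \<Rightarrow> 'b::complex_inner) \<Rightarrow>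
    ('i, 'a) ell2 \<Rightarrow> ('j, 'b) ell2" where
  "ell2_op \<phi> A x = Abs_ell2 (\<lambda>w. case \<phi> w of None \<Rightarrow> 0 | Some v \<Rightarrow> A (coord x v))"

context
  fixes \<phi> :: "'j \<Rightarrow> 'i option" and A :: "'a::complex_inner \<Rightarrow> 'b::complex_inner"
  assumes A: "bounded_clinear A"
    and inj: "partial_inj \<phi>"
begin

lemma
  assumes K: "0 \<le> K" "\<And>x. norm (A x) \<le> K * norm x"
  shows coord_ell2_op_bounded: "coord (ell2_op \<phi> A x) = (\<lambda>w. case \<phi> w of None \<Rightarrow> 0 | Some v \<Rightarrow> A (coord x v))"
    and norm_ell2_op_le: "norm (ell2_op \<phi> A x) \<le> K * norm x"
proof -
  have "(\<Sum>w\<in>F. (norm (case \<phi> w of None \<Rightarrow> 0 | Some v \<Rightarrow> A (coord x v)))\<^sup>2) \<le> (K * norm x)\<^sup>2"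
    if F: "finite F" for F
  proof -
    let ?F = "{w\<in>F. \<phi> w \<noteq> None}"
    have "(\<Sum>w\<in>F. (norm (case \<phi> w of None \<Rightarrow> 0 | Some v \<Rightarrow> A (coord x v)))\<^sup>2)
        = (\<Sum>w\<in>?F. (norm (A (coord x (the (\<phi> w)))))\<^sup>2)"
      using F by (intro sum.mono_neutral_cong_right) auto
    also have "\<dots> \<le> (\<Sum>w\<in>?F. K\<^sup>2 * (norm (coord x (the (\<phi> w))))\<^sup>2)"
    proof (rule sum_mono)
      fix w
      have "(norm (A (coord x (the (\<phi> w)))))\<^sup>2 \<le> (K * norm (coord x (the (\<phi> w))))\<^sup>2"
        by (intro power_mono K) simp
      then show "(norm (A (coord x (the (\<phi> w)))))\<^sup>2 \<le> K\<^sup>2 * (norm (coord x (the (\<phi> w))))\<^sup>2"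
        by (simp only: power_mult_distrib)
    qed
    also have "\<dots> = K\<^sup>2 * (\<Sum>v\<in>(\<lambda>w. the (\<phi> w)) ` ?F. (norm (coord x v))\<^sup>2)"
    proof (subst sum.reindex)
      show "inj_on (\<lambda>w. the (\<phi> w)) ?F"
        using inj unfolding partial_inj_def inj_on_def by (metis (mono_tags, lifting) mem_Collect_eq option.collapse)
    qed (simp add: sum_distrib_left)
    also have "\<dots> \<le> K\<^sup>2 * (norm x)\<^sup>2"
      using F by (intro mult_left_mono sum_norm_coord_le) auto
    finally show ?thesis by (simp only: power_mult_distrib)
  qed
  moreover have "0 \<le> K * norm x" using K(1) by simp
  ultimately show "coord (ell2_op \<phi> A x) = (\<lambda>w. case \<phi> w of None \<Rightarrow> 0 | Some v \<Rightarrow> A (coord x v))"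
    "norm (ell2_op \<phi> A x) \<le> K * norm x"
    unfolding ell2_op_def by (blast intro: coord_Abs_ell2 norm_Abs_ell2_le)+
qed

lemma coord_ell2_op:
  "coord (ell2_op \<phi> A x) w = (case \<phi> w of None \<Rightarrow> 0 | Some v \<Rightarrow> A (coord x v))"
  using bounded_clinear_bound[OF A] coord_ell2_op_bounded by metis

lemma bounded_clinear_ell2_op: "bounded_clinear (ell2_op \<phi> A)"
proof -
  obtain K where K: "0 \<le> K" "\<And>x. norm (A x) \<le> K * norm x"
    using bounded_clinear_bound[OF A] by blast
  show ?thesis
  proof (rule bounded_clinearI)
    show "norm (ell2_op \<phi> A x) \<le> K * norm x" for x by (rule norm_ell2_op_le[OF K])
  qed (auto intro!: ell2_eqI simp: coord_ell2_op bounded_clinear_simps[OF A] split: option.split)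
qed

end

lemma coord_tensor_vec:
  fixes f :: "('i, complex) ell2"
  shows "coord (tensor_vec f v) w = coord f w *\<^sub>C v"
proof -
  have "coord (tensor_vec f v) = (\<lambda>w. coord f w *\<^sub>C v)"
    unfolding tensor_vec_def
  proof (rule coord_Abs_ell2[where B = "norm f * norm v"])
    fix F :: "'i set" assume F: "finite F"
    have "(\<Sum>w\<in>F. (norm (coord f w *\<^sub>C v))\<^sup>2) = (\<Sum>w\<in>F. (norm (coord f w))\<^sup>2) * (norm v)\<^sup>2"
      by (simp add: norm_scaleC power_mult_distrib sum_distrib_right)
    also have "\<dots> \<le> (norm f)\<^sup>2 * (norm v)\<^sup>2"
      by (intro mult_right_mono sum_norm_coord_le F) simp
    finally show "(\<Sum>w\<in>F. (norm (coord f w *\<^sub>C v))\<^sup>2) \<le> (norm f * norm v)\<^sup>2"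
      by (simp add: power_mult_distrib)
  qed simp
  then show ?thesis by simp
qed

lemma tensor_vec_single: "tensor_vec (single w 1) v = single w v"
  by (rule ell2_eqI) (simp add: coord_tensor_vec coord_single scaleC_one)

text \<open>A bounded operator is determined by its values on elementary tensors, since these
  include all \<open>single w v\<close>. This evaluates the \<open>THE\<close> in
  \<open>tensor_op\<close>.\<close>

lemma tensor_op_eqI:
  assumes Z: "bounded_clinear Z" "\<And>f v. Z (tensor_vec f v) = tensor_vec (X f) (A v)"
  shows "tensor_op X A = Z"
  unfolding tensor_op_def
proof (rule the_equality)
  fix Z' assume "bounded_clinear Z' \<and> (\<forall>f v. Z' (tensor_vec f v) = tensor_vec (X f) (A v))"
  then have Z': "bounded_clinear Z'" "\<And>f v. Z' (tensor_vec f v) = tensor_vec (X f) (A v)" by auto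
  show "Z' = Z"
  proof
    fix x
    have "x \<in> {x. Z' x = Z x}"
    proof (rule ell2_subspace_eq_UNIV)
      show "closed {x. Z' x = Z x}" by (rule closed_eq_bounded_clinear[OF Z'(1) Z(1)])
      show "single w v \<in> {x. Z' x = Z x}" for w v
        using Z(2)[of "single w 1" v] Z'(2)[of "single w 1" v] by (simp add: tensor_vec_single)
    qed (auto simp: bounded_clinear_simps[OF Z(1)] bounded_clinear_simps[OF Z'(1)])
    then show "Z' x = Z x" by simp
  qed
qed (use Z in auto)

text \<open>The scalar \<open>c\<close> absorbs the radius in r R_i: it is moved from the Fock
  factor to the other one.\<close>

lemma tensor_op_eq:
  assumes A: "bounded_clinear A"
    and inj: "partial_inj \<phi>"
    and X: "\<And>f w. coord (X f) w = (case \<phi> w of None \<Rightarrow> 0 | Some v \<Rightarrow> c * coord f v)"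
  shows "tensor_op X A = ell2_op \<phi> (\<lambda>x. c *\<^sub>C A x)"
proof (rule tensor_op_eqI)
  have A': "bounded_clinear (\<lambda>x. c *\<^sub>C A x)"
    by (rule bounded_clinear_compose[OF bounded_clinear_scaleC_op A])
  show "bounded_clinear (ell2_op \<phi> (\<lambda>x. c *\<^sub>C A x))"
    by (rule bounded_clinear_ell2_op[OF A' inj])
  show "ell2_op \<phi> (\<lambda>x. c *\<^sub>C A x) (tensor_vec f v) = tensor_vec (X f) (A v)" for f v
    by (rule ell2_eqI)
      (auto simp: coord_ell2_op[OF A' inj] coord_tensor_vec X bounded_clinear_scaleC[OF A]
        scaleC_scaleC split: option.split)
qed

lemma coord_tensor_op_id:
  assumes "bounded_clinear A"
  shows "coord (tensor_op id A x) w = A (coord x w)"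
proof -
  have "tensor_op id A = ell2_op Some (\<lambda>x. 1 *\<^sub>C A x)"
    by (rule tensor_op_eq) (use assms in \<open>auto simp: partial_inj_def\<close>)
  then have eq: "tensor_op id A = ell2_op Some A" by (simp add: scaleC_one)
  show ?thesis unfolding eq by (subst coord_ell2_op[OF assms]) (auto simp: partial_inj_def)
qed

section \<open>Words\<close>

definition words :: "nat \<Rightarrow> 'n::finite list set" where
  "words m = {w. length w = m}"

definition words_lt :: "nat \<Rightarrow> 'n::finite list set" where
  "words_lt m = {w. length w < m}"

lemma in_words [simp]: "w \<in> words m \<longleftrightarrow> length w = m"
  by (simp add: words_def)

lemma in_words_lt [simp]: "w \<in> words_lt m \<longleftrightarrow> length w < m"
  by (simp add: words_lt_def)

lemma finite_words [simp]: "finite (words m :: 'n::finite list set)"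
  using finite_lists_length_eq[of "UNIV :: 'n set" m] by (simp add: words_def)

lemma card_words: "card (words m :: 'n::finite list set) = CARD('n) ^ m"
  using card_lists_length_eq[of "UNIV :: 'n set" m] by (simp add: words_def)

lemma words_lt_Suc: "words_lt (Suc m) = words_lt m \<union> words m"
  by auto

lemma words_lt_0 [simp]: "words_lt 0 = {}"
  by auto

lemma finite_words_lt [simp]: "finite (words_lt m :: 'n::finite list set)"
  by (induction m) (simp_all add: words_lt_Suc)

lemma sum_words_lt_Suc: "(\<Sum>w\<in>words_lt (Suc m). f w) = (\<Sum>w\<in>words_lt m. f w) + (\<Sum>w\<in>words m. f w)"
  unfolding words_lt_Suc by (rule sum.union_disjoint) auto

lemma sum_words_lt: "(\<Sum>w\<in>words_lt m. f w) = (\<Sum>k<m. \<Sum>w\<in>words k. f w)"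
  by (induction m) (simp_all add: sum_words_lt_Suc)

lemma words_Suc_snoc: "words (Suc m) = (\<lambda>(w, i). w @ [i]) ` (words m \<times> UNIV)"
proof (intro equalityI subsetI)
  fix w :: "'n::finite list" assume "w \<in> words (Suc m)"
  then show "w \<in> (\<lambda>(w, i). w @ [i]) ` (words m \<times> UNIV)"
    by (cases w rule: rev_cases) (auto simp: image_iff)
qed auto

text \<open>Splitting off the last letter follows right creation and the forward system; the
  versions with \<open>Cons\<close> split off the first letter, which follows \<open>foldr T\<close>
  and the iterates of \<open>Phi\<close>.\<close>

lemma sum_words_snoc: "(\<Sum>w\<in>words (Suc m). f w) = (\<Sum>w\<in>words m. \<Sum>i\<in>UNIV. f (w @ [i]))"
  unfolding words_Suc_snoc
  by (subst sum.reindex) (auto simp: inj_on_def sum.cartesian_product intro!: sum.cong)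

lemma words_0 [simp]: "words 0 = {[]}"
  by auto

lemma sum_words_lt_snoc:
  "(\<Sum>w\<in>words_lt (Suc m). f w) = f [] + (\<Sum>w\<in>words_lt m. \<Sum>i\<in>UNIV. f (w @ [i]))"
proof (induction m)
  case 0
  show ?case by (simp add: sum_words_lt_Suc)
next
  case (Suc m)
  then show ?case
    by (subst sum_words_lt_Suc) (simp add: sum_words_snoc sum_words_lt_Suc[of _ m] add.assoc)
qed

lemma words_Suc_Cons: "words (Suc m) = (\<lambda>(i, w). i # w) ` (UNIV \<times> words m)"
  by (auto simp: length_Suc_conv image_iff)

lemma sum_words_Cons: "(\<Sum>w\<in>words (Suc m). f w) = (\<Sum>i\<in>UNIV. \<Sum>w\<in>words m. f (i # w))"
  unfolding words_Suc_Cons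
  by (subst sum.reindex) (auto simp: inj_on_def sum.cartesian_product intro!: sum.cong)

lemma words_lt_Suc_Cons: "words_lt (Suc m) = insert [] ((\<lambda>(i, w). i # w) ` (UNIV \<times> words_lt m))"
proof (intro equalityI subsetI)
  fix w :: "'n::finite list" assume "w \<in> words_lt (Suc m)"
  then show "w \<in> insert [] ((\<lambda>(i, w). i # w) ` (UNIV \<times> words_lt m))"
    by (cases w) auto
qed auto

lemma sum_words_lt_Cons:
  "(\<Sum>w\<in>words_lt (Suc m). f w) = f [] + (\<Sum>i\<in>UNIV. \<Sum>w\<in>words_lt m. f (i # w))"
proof -
  have "(\<Sum>w\<in>(\<lambda>(i, w). i # w) ` (UNIV \<times> words_lt m). f w) = (\<Sum>i\<in>UNIV. \<Sum>w\<in>words_lt m. f (i # w))"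
    by (subst sum.reindex) (auto simp: inj_on_def sum.cartesian_product intro!: sum.cong)
  then show ?thesis unfolding words_lt_Suc_Cons by (subst sum.insert) auto
qed

lemma finite_subset_words_lt:
  assumes "finite (F :: 'n::finite list set)"
  shows "\<exists>m. F \<subseteq> words_lt m"
proof -
  have "w \<in> words_lt (Suc (Max (length ` F)))" if "w \<in> F" for w
    using assms that by (simp add: less_Suc_eq_le)
  then show ?thesis by blast
qed

text \<open>Every finite set of words has bounded length, so it suffices to bound the partial sums
  by length, the quantities that the energy estimate controls.\<close>

lemma
  fixes f :: "'n::finite list \<Rightarrow> 'a::complex_inner"
  assumes B: "0 \<le> B" and le: "\<And>m. (\<Sum>w\<in>words_lt m. (norm (f w))\<^sup>2) \<le> B\<^sup>2"
  shows coord_Abs_ell2_words: "coord (Abs_ell2 f) = f"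
    and norm_Abs_ell2_words_le: "norm (Abs_ell2 f) \<le> B"
proof -
  have le': "(\<Sum>w\<in>F. (norm (f w))\<^sup>2) \<le> B\<^sup>2" if F: "finite F" for F
  proof -
    obtain m where "F \<subseteq> words_lt m" using finite_subset_words_lt[OF F] by blast
    then have "(\<Sum>w\<in>F. (norm (f w))\<^sup>2) \<le> (\<Sum>w\<in>words_lt m. (norm (f w))\<^sup>2)"
      by (intro sum_mono2) auto
    then show ?thesis using le[of m] by linarith
  qed
  show "coord (Abs_ell2 f) = f" by (rule coord_Abs_ell2[OF B]) (rule le')
  show "norm (Abs_ell2 f) \<le> B" by (rule norm_Abs_ell2_le[OF B]) (rule le')
qed

lemma coord_tensor_op_right_creation:
  fixes A :: "'a::complex_inner \<Rightarrow> 'b::complex_inner" and i :: "'n::finite"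
  assumes A: "bounded_clinear A"
  shows "coord (tensor_op (\<lambda>f. r *\<^sub>R right_creation i f) A x) w
      = (if w \<noteq> [] \<and> last w = i then r *\<^sub>R A (coord x (butlast w)) else 0)" (is ?coord)
    and "bounded_clinear (tensor_op (\<lambda>f. r *\<^sub>R right_creation i f) A)" (is ?bounded)
proof -
  let ?\<phi> = "\<lambda>w :: 'n list. if w \<noteq> [] \<and> last w = i then Some (butlast w) else None"
  have inj: "partial_inj ?\<phi>"
    unfolding partial_inj_def using append_butlast_last_id by (metis option.distinct(1) option.inject)
  note coord_op = coord_ell2_op[where \<phi> = ?\<phi>, OF _ inj]
  have rc: "coord (right_creation i f) w = (case ?\<phi> w of None \<Rightarrow> 0 | Some v \<Rightarrow> coord f v)" for f w
  proof -
    have "right_creation i f = ell2_op ?\<phi> (\<lambda>x. x) f"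
      unfolding right_creation_def ell2_op_def by (rule arg_cong[of _ _ Abs_ell2]) auto
    then show ?thesis by (simp only: coord_op[OF bounded_clinear_id])
  qed
  have eq: "tensor_op (\<lambda>f. r *\<^sub>R right_creation i f) A = ell2_op ?\<phi> (\<lambda>x. of_real r *\<^sub>C A x)"
    by (rule tensor_op_eq[where \<phi> = ?\<phi>, OF A inj]) (auto simp: rc scaleR_conv_of_real)
  have A': "bounded_clinear (\<lambda>x. of_real r *\<^sub>C A x)"
    by (rule bounded_clinear_compose[OF bounded_clinear_scaleC_op A])
  show ?coord unfolding eq coord_op[OF A'] by (simp add: scaleR_scaleC)
  show ?bounded unfolding eq by (rule bounded_clinear_ell2_op[where \<phi> = ?\<phi>, OF A' inj])
qed

lemma coord_tensor_op_proj_hom: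
  "coord (tensor_op (proj_hom m) id x) w = (if length w = m then coord x w else 0)"
proof -
  let ?\<phi> = "\<lambda>w :: 'n list. if length w = m then Some w else None"
  have inj: "partial_inj ?\<phi>"
    unfolding partial_inj_def by (metis option.distinct(1) option.inject)
  note coord_op = coord_ell2_op[where \<phi> = ?\<phi>, OF _ inj]
  have rc: "coord (proj_hom m f) w = (case ?\<phi> w of None \<Rightarrow> 0 | Some v \<Rightarrow> 1 * coord f v)" for f w
  proof -
    have "proj_hom m f = ell2_op ?\<phi> (\<lambda>x. x) f"
      unfolding proj_hom_def ell2_op_def by (rule arg_cong[of _ _ Abs_ell2]) auto
    then show ?thesis by (simp only: coord_op[OF bounded_clinear_id] mult_1)
  qed
  have eq: "tensor_op (proj_hom m) id = ell2_op ?\<phi> (\<lambda>x :: 'a. 1 *\<^sub>C id x)"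
    by (rule tensor_op_eq[where \<phi> = ?\<phi>, OF _ inj rc]) (use bounded_clinear_id in \<open>auto simp: id_def\<close>)
  have A': "bounded_clinear (\<lambda>x :: 'a. 1 *\<^sub>C id x)"
    by (simp add: bounded_clinear_id scaleC_one)
  show ?thesis unfolding eq coord_op[OF A'] by (simp add: scaleC_one)
qed

lemma coord_tensor_op_proj_le:
  "coord (tensor_op (proj_le m) id x) w = (if length w \<le> m then coord x w else 0)"
proof -
  let ?\<phi> = "\<lambda>w :: 'n list. if length w \<le> m then Some w else None"
  have inj: "partial_inj ?\<phi>"
    unfolding partial_inj_def by (metis option.distinct(1) option.inject)
  note coord_op = coord_ell2_op[where \<phi> = ?\<phi>, OF _ inj]
  have rc: "coord (proj_le m f) w = (case ?\<phi> w of None \<Rightarrow> 0 | Some v \<Rightarrow> 1 * coord f v)" for f w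
  proof -
    have "proj_le m f = ell2_op ?\<phi> (\<lambda>x. x) f"
      unfolding proj_le_def ell2_op_def by (rule arg_cong[of _ _ Abs_ell2]) auto
    then show ?thesis by (simp only: coord_op[OF bounded_clinear_id] mult_1)
  qed
  have eq: "tensor_op (proj_le m) id = ell2_op ?\<phi> (\<lambda>x :: 'a. 1 *\<^sub>C id x)"
    by (rule tensor_op_eq[where \<phi> = ?\<phi>, OF _ inj rc]) (use bounded_clinear_id in \<open>auto simp: id_def\<close>)
  have A': "bounded_clinear (\<lambda>x :: 'a. 1 *\<^sub>C id x)"
    by (simp add: bounded_clinear_id scaleC_one)
  show ?thesis unfolding eq coord_op[OF A'] by (simp add: scaleC_one)
qed

lemma closed_fock_tensor:
  assumes "closed D"
  shows "closed (fock_tensor D :: ('n list, 'a::complex_inner) ell2 set)"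
proof -
  have "fock_tensor D = (\<Inter>w. (\<lambda>x :: ('n list, 'a) ell2. coord x w) -` D)"
    by (auto simp: fock_tensor_def)
  moreover have "closed ((\<lambda>x :: ('n list, 'a) ell2. coord x w) -` D)" for w
    by (intro closed_vimage assms continuous_at_imp_continuous_on ballI
        bounded_clinear_isCont bounded_clinear_coord)
  ultimately show ?thesis by auto
qed

lemma subspace_fock_tensor:
  assumes "complex_vector.subspace D"
  shows "complex_vector.subspace (fock_tensor D)"
  unfolding complex_vector.subspace_def fock_tensor_def
  by (auto simp: complex_vector.subspace_0[OF assms] complex_vector.subspace_add[OF assms]
      complex_vector.subspace_scale[OF assms])

section \<open>Row contractions and the characteristic function\<close>

lemma norm_vec_sq: "(norm (v :: 'a::complex_inner ^ 'n))\<^sup>2 = (\<Sum>i\<in>UNIV. (norm (v $ i))\<^sup>2)"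
  by (simp add: norm_vec_def L2_set_def sum_nonneg)

lemma scaleC_vec_component [simp]: "(c *\<^sub>C v) $ i = c *\<^sub>C (v $ i)"
  by (simp add: scaleC_vec_def)

lemma bounded_clinear_vec_nth: "bounded_clinear (\<lambda>v :: 'a::complex_inner ^ 'n. v $ i)"
  by (rule bounded_clinearI[where K = 1]) (simp_all add: Finite_Cartesian_Product.norm_nth_le)

locale row_contr =
  fixes T :: "'n::finite \<Rightarrow> 'h::chilbert_space \<Rightarrow> 'h"
  assumes bounded_clinear_T: "\<And>i. bounded_clinear (T i)"
    and row_contraction: "row_contraction T"
begin

abbreviation R :: "'h ^ 'n \<Rightarrow> 'h" where "R \<equiv> row_op T"
abbreviation Rs :: "'h \<Rightarrow> 'h ^ 'n" where "Rs \<equiv> adj (row_op T)"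
abbreviation Ts :: "'n \<Rightarrow> 'h \<Rightarrow> 'h" where "Ts i \<equiv> adj (T i)"
abbreviation D :: "'h \<Rightarrow> 'h" where "D \<equiv> defect T"
abbreviation Ds :: "'h ^ 'n \<Rightarrow> 'h ^ 'n" where "Ds \<equiv> defect_star T"

lemmas cinner_T = cinner_adj[OF bounded_clinear_T]
lemmas bounded_clinear_Ts = bounded_clinear_adj[OF bounded_clinear_T]

lemma bounded_clinear_R: "bounded_clinear R"
  unfolding row_op_def[abs_def]
  by (intro bounded_clinear_sum_op bounded_clinear_compose[OF bounded_clinear_T bounded_clinear_vec_nth])

lemmas cinner_R = cinner_adj[OF bounded_clinear_R]
lemmas cinner_Rs = cinner_adj_left[OF bounded_clinear_R]
lemmas bounded_clinear_Rs = bounded_clinear_adj[OF bounded_clinear_R]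

lemma Rs_component: "Rs x $ i = Ts i x"
proof -
  have "Rs x = (\<chi> i. Ts i x)"
    by (rule adjI) (simp add: row_op_def cinner_vec_def cinner_sum_left cinner_T)
  then show ?thesis by simp
qed

lemma contraction_Rs: "contraction Rs"
  unfolding contraction_def
proof (intro conjI allI bounded_clinear_Rs)
  fix x
  have "positive_op (\<lambda>x. x - R (Rs x))" using row_contraction by (simp add: row_contraction_def)
  from positive_op_cinner(1)[OF this, of x] have "0 \<le> Re (cinner x x) - Re (cinner (R (Rs x)) x)"
    by (simp add: cinner_diff_left)
  then have "(norm (Rs x))\<^sup>2 \<le> (norm x)\<^sup>2"
    by (simp add: norm_eq_Re_cinner[symmetric] cinner_R)
  then show "norm (Rs x) \<le> norm x" by (rule power2_le_imp_le) simp
qed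

lemma contraction_R: "contraction R"
  unfolding contraction_def
proof (intro conjI allI bounded_clinear_R)
  fix v
  show "norm (R v) \<le> norm v"
    using norm_le_of_adjoint[of 1 Rs R v] contraction_norm[OF contraction_Rs] cinner_Rs by simp
qed

text \<open>Each adjoint of \<open>T i\<close> is a component of the contraction
  \<open>Rs\<close>.\<close>

lemma norm_T_le: "norm (T i x) \<le> norm x"
proof -
  have "norm (Ts i x) \<le> norm x" for x
    using Finite_Cartesian_Product.norm_nth_le[of "Rs x" i] contraction_norm[OF contraction_Rs, of x]
    by (simp add: Rs_component)
  then show ?thesis
    using norm_le_of_adjoint[of 1 "Ts i" "T i" x] cinner_adj_left[OF bounded_clinear_T] by simp
qed

lemma contraction_compose: "contraction A \<Longrightarrow> contraction B \<Longrightarrow> contraction (\<lambda>x. A (B x))"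
  unfolding contraction_def by (auto intro: bounded_clinear_compose order_trans)

lemma RRs: "contraction (\<lambda>x. R (Rs x))" "self_adjoint (\<lambda>x. R (Rs x))"
  by (rule contraction_compose[OF contraction_R contraction_Rs])
    (simp add: self_adjoint_def cinner_R cinner_Rs[symmetric])

lemma RsR: "contraction (\<lambda>v. Rs (R v))" "self_adjoint (\<lambda>v. Rs (R v))"
  by (rule contraction_compose[OF contraction_Rs contraction_R])
    (simp add: self_adjoint_def cinner_R[symmetric] cinner_Rs)

lemma D_eq: "D = (\<lambda>x. x - sqrt_series (\<lambda>x. R (Rs x)) x)"
  unfolding defect_def by (rule sqrt_op_eq[OF RRs])

lemma Ds_eq: "Ds = (\<lambda>v. v - sqrt_series (\<lambda>v. Rs (R v)) v)"
  unfolding defect_star_def by (rule sqrt_op_eq[OF RsR])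

lemma positive_op_D: "positive_op D"
  unfolding D_eq by (rule positive_op_sqrt_series[OF RRs])

lemma positive_op_Ds: "positive_op Ds"
  unfolding Ds_eq by (rule positive_op_sqrt_series[OF RsR])

lemmas bounded_clinear_D = positive_op_bounded_clinear[OF positive_op_D]
lemmas bounded_clinear_Ds = positive_op_bounded_clinear[OF positive_op_Ds]
lemmas cinner_D = self_adjointD[OF positive_op_self_adjoint[OF positive_op_D]]
lemmas cinner_Ds = self_adjointD[OF positive_op_self_adjoint[OF positive_op_Ds]]

lemma D_square: "D (D x) = x - R (Rs x)"
  unfolding D_eq by (rule sqrt_series_square[OF RRs(1)])

lemma Ds_square: "Ds (Ds v) = v - Rs (R v)"
  unfolding Ds_eq by (rule sqrt_series_square[OF RsR(1)])

text \<open>\<open>R\<close> intertwines R^* R with R R^*, hence also the series of their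
  roots.\<close>

lemma R_Ds: "R (Ds v) = D (R v)"
  unfolding D_eq Ds_eq
  using sqrt_series_intertwine[OF RsR(1) RRs(1) bounded_clinear_R, of v]
  by (simp add: bounded_clinear_diff[OF bounded_clinear_R])

lemma Rs_D: "Rs (D x) = Ds (Rs x)"
  unfolding D_eq Ds_eq
  using sqrt_series_intertwine[OF RRs(1) RsR(1) bounded_clinear_Rs, of x]
  by (simp add: bounded_clinear_diff[OF bounded_clinear_Rs])

lemmas lin_simps = bounded_clinear_simps[OF bounded_clinear_T] bounded_clinear_simps[OF bounded_clinear_Ts]
  bounded_clinear_simps[OF bounded_clinear_R] bounded_clinear_simps[OF bounded_clinear_Rs]
  bounded_clinear_simps[OF bounded_clinear_D] bounded_clinear_simps[OF bounded_clinear_Ds]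

section \<open>The Julia operator and its linear system\<close>

lemma julia_isometry:
  "(norm (- R v + D y))\<^sup>2 + (norm (Ds v + Rs y))\<^sup>2 = (norm v)\<^sup>2 + (norm y)\<^sup>2"
proof -
  \<comment> \<open>The two cross terms cancel because of \<open>R_Ds\<close>.\<close>
  have "cinner (R v) (D y) = cinner (Ds v) (Rs y)"
    by (simp add: cinner_D[symmetric] R_Ds[symmetric] cinner_R)
  moreover have "(norm (D y))\<^sup>2 = (norm y)\<^sup>2 - (norm (Rs y))\<^sup>2"
    by (simp add: norm_eq_Re_cinner cinner_D D_square cinner_diff_right flip: cinner_Rs)
  moreover have "(norm (Ds v))\<^sup>2 = (norm v)\<^sup>2 - (norm (R v))\<^sup>2"
    by (simp add: norm_eq_Re_cinner cinner_Ds Ds_square cinner_diff_right flip: cinner_R)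
  ultimately show ?thesis
    using norm_diff_sq[of "D y" "R v"] norm_add_sq[of "Ds v" "Rs y"] Re_cinner_commute[of "D y" "R v"]
    by simp
qed

text \<open>A linear system on words with input \<open>f\<close> and initial state \<open>h\<close>, whose transfer function for
  \<open>r = 1\<close> is \<open>\<Theta>\<^sub>T\<close>. Appending the letter \<open>i\<close> at the end of a word is \<open>R\<^sub>i\<close>, hence the recursion over
  reversed words.\<close>

primrec rev_state :: "real \<Rightarrow> ('n list \<Rightarrow> 'h ^ 'n) \<Rightarrow> 'h \<Rightarrow> 'n list \<Rightarrow> 'h" where
  "rev_state r f h [] = h"
| "rev_state r f h (i # v) = r *\<^sub>R (Ds (f (rev v)) $ i + Ts i (rev_state r f h v))"

definition state :: "real \<Rightarrow> ('n list \<Rightarrow> 'h ^ 'n) \<Rightarrow> 'h \<Rightarrow> 'n list \<Rightarrow> 'h" where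
  "state r f h w = rev_state r f h (rev w)"

definition output_map :: "real \<Rightarrow> ('n list \<Rightarrow> 'h ^ 'n) \<Rightarrow> 'h \<Rightarrow> 'n list \<Rightarrow> 'h" where
  "output_map r f h w = - R (f w) + D (state r f h w)"

text \<open>Input and initial state are kept together so that one energy estimate covers both uses:
  zero state gives the characteristic function, zero input gives \<open>poisson\<close>.\<close>

definition transfer :: "real \<Rightarrow> ('n list, 'h ^ 'n) ell2 \<Rightarrow> 'h \<Rightarrow> ('n list, 'h) ell2" where
  "transfer r x h = Abs_ell2 (output_map r (coord x) h)"

lemma state_Nil [simp]: "state r f h [] = h"
  by (simp add: state_def)

lemma state_snoc: "state r f h (w @ [i]) = r *\<^sub>R (Ds (f w) $ i + Ts i (state r f h w))"
  by (simp add: state_def)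

text \<open>The isometry of the Julia operator summed over words: output plus remaining state is at
  most initial state plus input. Energy is lost only through the factor r^2 at each new
  letter.\<close>

lemma output_energy:
  assumes r: "0 \<le> r" "r \<le> 1"
  shows "(\<Sum>w\<in>words_lt m. (norm (output_map r f h w))\<^sup>2) + (\<Sum>w\<in>words m. (norm (state r f h w))\<^sup>2)
    \<le> (norm h)\<^sup>2 + (\<Sum>w\<in>words_lt m. (norm (f w))\<^sup>2)"
proof (induction m)
  case 0
  show ?case by simp
next
  case (Suc m)
  have "(\<Sum>i\<in>UNIV. (norm (state r f h (w @ [i])))\<^sup>2) + (norm (output_map r f h w))\<^sup>2
      \<le> (norm (f w))\<^sup>2 + (norm (state r f h w))\<^sup>2" for w
  proof -
    have "(\<Sum>i\<in>UNIV. (norm (state r f h (w @ [i])))\<^sup>2) = r\<^sup>2 * (norm (Ds (f w) + Rs (state r f h w)))\<^sup>2"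
      by (simp add: state_snoc norm_vec_sq Rs_component power_mult_distrib sum_distrib_left)
    also have "\<dots> \<le> (norm (Ds (f w) + Rs (state r f h w)))\<^sup>2"
      using r by (intro mult_left_le_one_le) (auto simp: power_le_one)
    finally show ?thesis
      using julia_isometry[of "f w" "state r f h w"] by (simp add: output_map_def)
  qed
  then have "(\<Sum>w\<in>words m. (\<Sum>i\<in>UNIV. (norm (state r f h (w @ [i])))\<^sup>2) + (norm (output_map r f h w))\<^sup>2)
      \<le> (\<Sum>w\<in>words m. (norm (f w))\<^sup>2 + (norm (state r f h w))\<^sup>2)"
    by (rule sum_mono)
  then show ?case using Suc
    by (simp add: sum_words_lt_Suc sum_words_snoc sum.distrib)
qed

context
  fixes r :: real
  assumes r: "0 \<le> r" "r \<le> 1"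
begin

lemma transfer_bound:
  "(\<Sum>w\<in>words_lt m. (norm (output_map r (coord x) h w))\<^sup>2) \<le> (sqrt ((norm h)\<^sup>2 + (norm x)\<^sup>2))\<^sup>2"
proof -
  have "(\<Sum>w\<in>words m. (norm (state r (coord x) h w))\<^sup>2) \<ge> 0" by (intro sum_nonneg) simp
  then show ?thesis
    using output_energy[OF r, where m = m and f = "coord x" and h = h]
      sum_norm_coord_le[of "words_lt m" x] by simp
qed

lemma coord_transfer: "coord (transfer r x h) w = output_map r (coord x) h w"
  unfolding transfer_def by (subst coord_Abs_ell2_words[OF _ transfer_bound]) simp_all

lemma norm_transfer_le: "norm (transfer r x h) \<le> sqrt ((norm h)\<^sup>2 + (norm x)\<^sup>2)"
  unfolding transfer_def by (rule norm_Abs_ell2_words_le[OF _ transfer_bound]) simp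

lemma state_add:
  "state r (\<lambda>w. f w + g w) (h + k) w = state r f h w + state r g k w"
  by (induction w rule: rev_induct) (simp_all add: state_snoc lin_simps scaleR_add_right add_ac)

lemma state_scaleC:
  "state r (\<lambda>w. c *\<^sub>C f w) (c *\<^sub>C h) w = c *\<^sub>C state r f h w"
  by (induction w rule: rev_induct)
    (simp_all add: state_snoc lin_simps scaleR_scaleC scaleC_scaleC scaleC_add_right mult.commute)

lemma transfer_add: "transfer r (x + y) (h + k) = transfer r x h + transfer r y k"
  by (rule ell2_eqI) (simp add: coord_transfer output_map_def plus_ell2.rep_eq state_add lin_simps)

lemma transfer_scaleC: "transfer r (c *\<^sub>C x) (c *\<^sub>C h) = c *\<^sub>C transfer r x h"
  by (rule ell2_eqI)
    (simp add: coord_transfer output_map_def scaleC_ell2.rep_eq state_scaleC lin_simps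
      complex_vector.scale_right_diff_distrib)

lemma contraction_transfer: "contraction (\<lambda>x. transfer r x 0)"
  unfolding contraction_def
proof (intro conjI allI)
  show *: "norm (transfer r x 0) \<le> norm x" for x
    using norm_transfer_le[of x 0] by simp
  show "bounded_clinear (\<lambda>x. transfer r x 0)"
  proof (rule bounded_clinearI[where K = 1])
    show "transfer r (x + y) 0 = transfer r x 0 + transfer r y 0" for x y
      using transfer_add[of x y 0 0] by simp
    show "transfer r (c *\<^sub>C x) 0 = c *\<^sub>C transfer r x 0" for c x
      using transfer_scaleC[of c x 0] by simp
  qed (simp add: *)
qed

end

text \<open>The map K of the overview, as the response to an initial state.\<close>

definition poisson :: "'h \<Rightarrow> ('n list, 'h) ell2" where
  "poisson h = transfer 1 0 h"

lemma bounded_clinear_poisson: "bounded_clinear poisson"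
proof (rule bounded_clinearI[where K = 1])
  show "poisson (x + y) = poisson x + poisson y" for x y
    using transfer_add[of 1 0 0 x y] by (simp add: poisson_def)
  show "poisson (c *\<^sub>C x) = c *\<^sub>C poisson x" for c x
    using transfer_scaleC[of 1 c 0 x] by (simp add: poisson_def)
  show "norm (poisson x) \<le> 1 * norm x" for x
    using norm_transfer_le[of 1 0 x] by (simp add: poisson_def)
qed

lemma coord_poisson: "coord (poisson h) w = D (state 1 (\<lambda>_. 0) h w)"
  unfolding poisson_def by (subst coord_transfer) (simp_all add: output_map_def lin_simps zero_ell2.rep_eq)

text \<open>Without input, appending a letter applies the adjoint of its operator to the state;
  along \<open>w\<close> this builds the adjoint of \<open>foldr T w\<close>.\<close>

lemma cinner_foldr: "cinner (foldr T w g) h = cinner g (state 1 (\<lambda>_. 0) h w)"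
  by (induction w arbitrary: g rule: rev_induct) (simp_all add: state_snoc cinner_T lin_simps)

text \<open>In other words, the adjoint of K sends the elementary tensor of w and g to T_w \<Delta>
  g. This links K to the vectors \<open>gen\<close> in the trace, the rank and the injectivity
  argument.\<close>

lemma cinner_poisson: "cinner (coord (poisson h) w) g = cinner h (foldr T w (D g))"
  by (metis cinner_D cinner_commute cinner_foldr coord_poisson)

subsection \<open>The radial limit\<close>

text \<open>The resolvent equation y = z + Y y, read at the word w @ [i], is the recursion of
  \<open>state\<close>.\<close>

lemma char_fun_radial_eq:
  assumes r: "0 \<le> r" "r < 1"
  shows "char_fun_radial T r x = transfer r x 0"
proof -
  let ?R = "\<lambda>i f. r *\<^sub>R right_creation i f :: 'n fock"
  define Y where "Y y = (\<Sum>i\<in>UNIV. tensor_op (?R i) (Ts i) y)" for y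
  define z where "z = (\<Sum>i\<in>UNIV. tensor_op (?R i) id
    (tensor_op id (\<lambda>v. v $ i) (tensor_op id Ds x)))"
  have id: "bounded_clinear (id :: 'h \<Rightarrow> 'h)" using bounded_clinear_id by (simp add: id_def)
  note coord_R = coord_tensor_op_right_creation(1)
  have Y: "coord (Y y) [] = 0" "coord (Y y) (w @ [i]) = r *\<^sub>R Ts i (coord y w)" for y w i
    unfolding Y_def coord_sum coord_R[OF bounded_clinear_Ts] by simp_all
  have z: "coord z [] = 0" "coord z (w @ [i]) = r *\<^sub>R (Ds (coord x w) $ i)" for w i
    unfolding z_def coord_sum coord_R[OF id]
    by (simp_all add: coord_tensor_op_id[OF bounded_clinear_vec_nth]
        coord_tensor_op_id[OF bounded_clinear_Ds])
  have Y_diff: "Y y - Y y' = Y (y - y')" for y y'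
    unfolding Y_def sum_subtractf[symmetric]
    by (intro sum.cong refl bounded_clinear_diff[symmetric]
        coord_tensor_op_right_creation(2) bounded_clinear_Ts)
  have Y_norm: "norm (Y y) \<le> r * norm y" for y
  proof -
    have le: "(\<Sum>w\<in>words_lt m. (norm (coord (Y y) w))\<^sup>2) \<le> (r * norm y)\<^sup>2" for m
    proof (cases m)
      case (Suc m')
      have "(\<Sum>w\<in>words_lt m. (norm (coord (Y y) w))\<^sup>2)
          = (\<Sum>w\<in>words_lt m'. r\<^sup>2 * (norm (Rs (coord y w)))\<^sup>2)"
        using r unfolding Suc sum_words_lt_snoc norm_vec_sq
        by (simp add: Y Rs_component power_mult_distrib sum_distrib_left)
      also have "\<dots> \<le> (\<Sum>w\<in>words_lt m'. r\<^sup>2 * (norm (coord y w))\<^sup>2)"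
        by (intro sum_mono mult_left_mono power_mono contraction_norm[OF contraction_Rs]) auto
      also have "\<dots> \<le> r\<^sup>2 * (norm y)\<^sup>2"
        unfolding sum_distrib_left[symmetric] by (intro mult_left_mono sum_norm_coord_le) auto
      finally show ?thesis by (simp add: power_mult_distrib)
    qed simp
    have "norm (Abs_ell2 (coord (Y y))) \<le> r * norm y"
      by (rule norm_Abs_ell2_words_le[OF _ le]) (use r in simp)
    then show ?thesis by (simp add: coord_inverse)
  qed
  \<comment> \<open>A fixed point puts \<open>z\<close> into the range, so that \<open>inv\<close>
    returns a genuine solution. Here r < 1 is essential.\<close>
  have "\<exists>!y. z + Y y = y"
    by (rule banach_fix_type[of r]) (use r Y_norm in \<open>auto simp: dist_norm Y_diff\<close>)
  then obtain y0 where "z + Y y0 = y0" by blast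
  then have "z = (\<lambda>y. y - Y y) y0" by (simp add: algebra_simps)
  then have "z \<in> range (\<lambda>y. y - Y y)" by blast
  then have inv: "inv (\<lambda>y. y - Y y) z - Y (inv (\<lambda>y. y - Y y) z) = z"
    by (rule f_inv_into_f)
  define y where "y = inv (\<lambda>y. y - Y y) z"
  have y: "coord y w = coord z w + coord (Y y) w" for w
    using inv by (metis (no_types, lifting) coord_diff diff_add_cancel y_def)
  \<comment> \<open>The equation fixes all coordinates by induction on the word, whichever preimage
    \<open>inv\<close> chose.\<close>
  have "coord y w = state r (coord x) 0 w" for w
  proof (induction w rule: rev_induct)
    case Nil
    then show ?case using y[of "[]"] by (simp add: Y z)
  next
    case (snoc i w)
    then show ?case using y[of "w @ [i]"] by (simp add: Y z state_snoc scaleR_add_right)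
  qed
  moreover have "char_fun_radial T r x = - tensor_op id R x + tensor_op id D y"
    unfolding char_fun_radial_def y_def Y_def z_def ..
  ultimately show ?thesis
    using r by (intro ell2_eqI) (simp add: coord_transfer output_map_def
        coord_tensor_op_id[OF bounded_clinear_R] coord_tensor_op_id[OF bounded_clinear_D])
qed

text \<open>An input of length k reaches the state first at length k + 1, with one factor r, and
  every further letter adds one. The truncated exponent is harmless because the state vanishes up to
  length k.\<close>

lemma state_homogeneous:
  assumes f: "\<And>w. length w \<noteq> k \<Longrightarrow> f w = 0"
  shows "(length w \<le> k \<longrightarrow> state r f 0 w = 0)
    \<and> state r f 0 w = r ^ (length w - k) *\<^sub>R state 1 f 0 w"
proof -
  have le: "state s f 0 w = 0" if "length w \<le> k" for s w
    using that by (induction w rule: rev_induct) (simp_all add: state_snoc f lin_simps)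
  have "state r f 0 w = r ^ (length w - k) *\<^sub>R state 1 f 0 w"
  proof (induction w rule: rev_induct)
    case (snoc i w)
    consider "length w < k" | "length w = k" | "length w > k" by linarith
    then show ?case
    proof cases
      case 1
      then show ?thesis using le[of "w @ [i]"] by simp
    next
      case 2
      then show ?thesis using le[of w] by (simp add: state_snoc lin_simps)
    next
      case 3
      then have "length (w @ [i]) - k = Suc (length w - k)" by simp
      with 3 snoc show ?thesis by (simp add: state_snoc f lin_simps)
    qed
  qed simp
  with le show ?thesis by blast
qed

text \<open>Multiplication by a power of r that depends on the word length: contractions that tend
  strongly to the identity. Words of length at most k are left unchanged.\<close>

lemma tendsto_length_scaling:
  fixes y :: "('n list, 'a::complex_inner) ell2"
  shows "((\<lambda>r. Abs_ell2 (\<lambda>w. r ^ (length w - k) *\<^sub>R coord y w)) \<longlongrightarrow> y) (at_left (1 :: real))"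
proof -
  define S where "S r y = Abs_ell2 (\<lambda>w. r ^ (length w - k) *\<^sub>R coord y w)"
    for r :: real and y :: "('n list, 'a) ell2"
  have coord_S: "coord (S r y) w = r ^ (length w - k) *\<^sub>R coord y w"
    and norm_S: "norm (S r y) \<le> norm y" if r: "0 \<le> r" "r \<le> 1" for r y w
  proof -
    have "(\<Sum>w\<in>F. (norm (r ^ (length w - k) *\<^sub>R coord y w))\<^sup>2) \<le> (norm y)\<^sup>2" if "finite F" for F
    proof -
      have "(\<Sum>w\<in>F. (norm (r ^ (length w - k) *\<^sub>R coord y w))\<^sup>2) \<le> (\<Sum>w\<in>F. (norm (coord y w))\<^sup>2)"
        using r by (intro sum_mono power_mono) (auto intro!: mult_left_le_one_le simp: power_le_one)
      also have "\<dots> \<le> (norm y)\<^sup>2" by (rule sum_norm_coord_le[OF that])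
      finally show ?thesis .
    qed
    note * = coord_Abs_ell2[OF norm_ge_zero this] norm_Abs_ell2_le[OF norm_ge_zero this]
    show "coord (S r y) w = r ^ (length w - k) *\<^sub>R coord y w" unfolding S_def by (subst *(1)) auto
    show "norm (S r y) \<le> norm y" unfolding S_def by (rule *(2))
  qed
  have ev: "\<forall>\<^sub>F r in at_left (1 :: real). 0 \<le> r \<and> r \<le> 1"
    by (rule eventually_mono[OF eventually_at_left_real[of 0 1]]) auto
  have "((\<lambda>r. S r y) \<longlongrightarrow> (\<lambda>y. y) y) (at_left 1)"
  proof (rule tendsto_contractions)
    show "\<forall>\<^sub>F r in at_left 1. contraction (S r)"
      using ev
    proof eventually_elim
      case (elim r)
      show ?case
        unfolding contraction_def
        using elim norm_S
        by (auto intro!: bounded_clinearI[where K = 1] ell2_eqI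
            simp: coord_S scaleC_add_right scaleR_scaleC scaleC_scaleC mult.commute)
    qed
    show "contraction (\<lambda>y :: ('n list, 'a) ell2. y)"
      by (simp add: contraction_def bounded_clinear_id)
    fix w :: "'n list" and v :: 'a
    have "((\<lambda>r :: real. r ^ (length w - k) *\<^sub>R single w v) \<longlongrightarrow> 1 ^ (length w - k) *\<^sub>R single w v) (at_left 1)"
      by (intro tendsto_intros)
    moreover have "\<forall>\<^sub>F r in at_left 1. r ^ (length w - k) *\<^sub>R single w v = S r (single w v)"
      using ev by eventually_elim (auto intro!: ell2_eqI simp: coord_S coord_single)
    ultimately show "((\<lambda>r. S r (single w v)) \<longlongrightarrow> single w v) (at_left 1)"
      by (simp add: tendsto_cong)
  qed
  then show ?thesis by (simp add: S_def)
qed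

lemma char_fun_eq: "char_fun T x = transfer 1 x 0"
proof -
  have ev: "\<forall>\<^sub>F r in at_left (1 :: real). 0 \<le> r \<and> r < 1"
    by (rule eventually_mono[OF eventually_at_left_real[of 0 1]]) auto
  have "((\<lambda>r. char_fun_radial T r x) \<longlongrightarrow> transfer 1 x 0) (at_left 1)"
  proof (rule tendsto_contractions[where B = "\<lambda>x. transfer 1 x 0"])
    show "\<forall>\<^sub>F r in at_left 1. contraction (char_fun_radial T r)"
      using ev
    proof eventually_elim
      case (elim r)
      have "char_fun_radial T r = (\<lambda>x. transfer r x 0)"
        using elim by (intro ext char_fun_radial_eq) auto
      then show ?case using contraction_transfer[of r] elim by simp
    qed
    show "contraction (\<lambda>x. transfer 1 x 0)" by (rule contraction_transfer) auto
    fix w :: "'n list" and v :: "'h ^ 'n"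
    let ?x = "single w v" and ?k = "length w"
    have x: "coord ?x u = 0" if "length u \<noteq> ?k" for u
      using that by (auto simp: coord_single)
    have "char_fun_radial T r ?x = Abs_ell2 (\<lambda>u. r ^ (length u - ?k) *\<^sub>R coord (transfer 1 ?x 0) u)"
      if r: "0 \<le> r \<and> r < 1" for r
    proof -
      \<comment> \<open>The feedthrough term -R lives at length k, where the exponent is 0; on
        longer words only the state contributes.\<close>
      have "output_map r (coord ?x) 0 u = r ^ (length u - ?k) *\<^sub>R output_map 1 (coord ?x) 0 u" for u
        using state_homogeneous[of ?k "coord ?x" u r, OF x] x[of u]
          state_homogeneous[of ?k "coord ?x" u 1, OF x]
        by (cases "length u \<le> ?k") (auto simp: output_map_def lin_simps)
      then have "output_map r (coord ?x) 0 = (\<lambda>u. r ^ (length u - ?k) *\<^sub>R output_map 1 (coord ?x) 0 u)"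
        by blast
      then show ?thesis
        using r by (simp add: char_fun_radial_eq coord_transfer) (simp add: transfer_def)
    qed
    then have "\<forall>\<^sub>F r in at_left 1. Abs_ell2 (\<lambda>u. r ^ (length u - ?k) *\<^sub>R coord (transfer 1 ?x 0) u)
        = char_fun_radial T r ?x"
      using ev by (auto elim!: eventually_mono)
    then show "((\<lambda>r. char_fun_radial T r ?x) \<longlongrightarrow> transfer 1 ?x 0) (at_left 1)"
      using tendsto_length_scaling[of ?k "transfer 1 ?x 0"] by (simp add: tendsto_cong)
  qed
  then show ?thesis unfolding char_fun_def by (intro tendsto_Lim) simp_all
qed

subsection \<open>The adjoint of the characteristic function\<close>

lemma foldr_T_zero [simp]: "foldr T v 0 = 0"
  by (induction v) (simp_all add: lin_simps)

lemma subspace_defect_star_space: "complex_vector.subspace (defect_star_space T)"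
  unfolding defect_star_space_def
  by (intro subspace_closure complex_pair.linear_subspace_image
      bounded_clinear_clinear bounded_clinear_Ds complex_vector.subspace_UNIV)

context
  fixes u :: "('n list, 'h) ell2" and m :: nat
  assumes u_supp: "\<And>w. m \<le> length w \<Longrightarrow> coord u w = 0"
begin

text \<open>\<open>costate\<close> runs the adjoint system backwards from the zero state on long words; the inputs it
  produces are the coordinates of \<open>\<Theta>\<^sub>T\<^sup>* u\<close>.\<close>

definition costate :: "'n list \<Rightarrow> 'h" where
  "costate w = (\<Sum>v\<in>words_lt m. foldr T v (D (coord u (w @ v))))"

definition coinput :: "'n list \<Rightarrow> 'h ^ 'n" where
  "coinput w = - Rs (coord u w) + Ds (\<chi> i. costate (w @ [i]))"

lemma costate_eq_0: "m \<le> length w \<Longrightarrow> costate w = 0"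
  unfolding costate_def by (intro sum.neutral) (simp add: u_supp lin_simps)

lemma costate_rec: "costate w = D (coord u w) + R (\<chi> i. costate (w @ [i]))"
proof (cases m)
  case 0
  have "costate v = 0" "coord u w = 0" for v
    by (rule costate_eq_0 u_supp, unfold 0, simp)+
  then show ?thesis by (simp only: lin_simps row_op_def) (simp add: lin_simps)
next
  case (Suc m')
  have "costate (w @ [i]) = (\<Sum>v\<in>words_lt m'. foldr T v (D (coord u (w @ i # v))))" for i
  proof -
    \<comment> \<open>The first letter has been used up, so words of length m' already reach length
      m, where \<open>u\<close> vanishes.\<close>
    have "(\<Sum>v\<in>words m'. foldr T v (D (coord u (w @ i # v)))) = 0"
      by (intro sum.neutral) (simp add: u_supp Suc lin_simps)
    moreover have "costate (w @ [i]) = (\<Sum>v\<in>words_lt m. foldr T v (D (coord u (w @ i # v))))"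
      unfolding costate_def by simp
    ultimately show ?thesis unfolding Suc sum_words_lt_Suc by simp
  qed
  then have "R (\<chi> i. costate (w @ [i])) = (\<Sum>i\<in>UNIV. \<Sum>v\<in>words_lt m'. T i (foldr T v (D (coord u (w @ i # v)))))"
    by (simp add: row_op_def lin_simps)
  moreover have "costate w = D (coord u w) + (\<Sum>i\<in>UNIV. \<Sum>v\<in>words_lt m'. T i (foldr T v (D (coord u (w @ i # v)))))"
    using sum_words_lt_Cons[of "\<lambda>v. foldr T v (D (coord u (w @ v)))" m', folded Suc]
    unfolding costate_def by simp
  ultimately show ?thesis by (simp only:)
qed

lemma coinput_eq_0: "m \<le> length w \<Longrightarrow> coinput w = 0"
  by (simp add: coinput_def u_supp costate_eq_0 lin_simps vec_eq_iff[symmetric] zero_vec_def[symmetric])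

lemma coord_coinput: "coord (Abs_ell2 coinput) = coinput"
  by (rule coord_Abs_ell2_finite[of "words_lt m"]) (auto simp: coinput_eq_0)

text \<open>Summation by parts: at each word the adjoint of the Julia operator balances output
  against input and next state against present state. The state terms telescope.\<close>

lemma cinner_transfer_coinput: "cinner (transfer 1 z 0) u = cinner z (Abs_ell2 coinput)"
proof -
  let ?s = "state 1 (coord z) 0"
  have "cinner (coord (transfer 1 z 0) w) (coord u w) + (\<Sum>i\<in>UNIV. cinner (?s (w @ [i])) (costate (w @ [i])))
      = cinner (coord z w) (coinput w) + cinner (?s w) (costate w)" for w
  proof -
    let ?b = "\<chi> i. costate (w @ [i])"
    have "(\<Sum>i\<in>UNIV. cinner (?s (w @ [i])) (costate (w @ [i]))) = cinner (Ds (coord z w) + Rs (?s w)) ?b"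
      by (simp add: cinner_vec_def state_snoc Rs_component)
    also have "\<dots> = cinner (coord z w) (Ds ?b) + cinner (?s w) (R ?b)"
      by (simp add: cinner_add_left cinner_Ds cinner_Rs)
    finally show ?thesis
      by (subst coord_transfer)
        (simp_all add: output_map_def coinput_def costate_rec[of w] cinner_simps cinner_R cinner_D)
  qed
  then have "(\<Sum>w\<in>words_lt m. cinner (coord (transfer 1 z 0) w) (coord u w)
        + (\<Sum>i\<in>UNIV. cinner (?s (w @ [i])) (costate (w @ [i]))))
      = (\<Sum>w\<in>words_lt m. cinner (coord z w) (coinput w) + cinner (?s w) (costate w))"
    by simp
  moreover have "(\<Sum>w\<in>words_lt m. \<Sum>i\<in>UNIV. cinner (?s (w @ [i])) (costate (w @ [i])))
      = (\<Sum>w\<in>words_lt m. cinner (?s w) (costate w))"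
  proof -
    \<comment> \<open>Both boundary terms vanish: at length m through the costate, at the empty word
      through the zero initial state.\<close>
    have "(\<Sum>w\<in>words m. cinner (?s w) (costate w)) = 0"
      by (intro sum.neutral) (simp add: costate_eq_0)
    then show ?thesis
      using sum_words_lt_snoc[of "\<lambda>w. cinner (?s w) (costate w)" m]
        sum_words_lt_Suc[of "\<lambda>w. cinner (?s w) (costate w)" m] by simp
  qed
  ultimately have "(\<Sum>w\<in>words_lt m. cinner (coord (transfer 1 z 0) w) (coord u w))
      = (\<Sum>w\<in>words_lt m. cinner (coord z w) (coinput w))"
    by (simp add: sum.distrib)
  moreover have "cinner (transfer 1 z 0) u
      = (\<Sum>w\<in>words_lt m. cinner (coord (transfer 1 z 0) w) (coord u w))"
    by (rule cinner_ell2_finite) (auto simp: u_supp)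
  moreover have "cinner z (Abs_ell2 coinput) = (\<Sum>w\<in>words_lt m. cinner (coord z w) (coinput w))"
    by (subst cinner_ell2_finite[of "words_lt m"]) (auto simp: coord_coinput coinput_eq_0)
  ultimately show ?thesis by simp
qed

text \<open>The Julia operator is also coisometric, so running the system on the input \<open>\<Theta>\<^sub>T\<^sup>* u\<close> inverts the
  backward recursion up to the zero-input response to the initial state \<open>costate []\<close>.\<close>

lemma transfer_coinput: "transfer 1 (Abs_ell2 coinput) 0 = u - poisson (costate [])"
proof -
  have st: "state 1 coinput 0 w = costate w - state 1 (\<lambda>_. 0) (costate []) w" for w
  proof (induction w rule: rev_induct)
    case (snoc i w)
    let ?b = "\<chi> i. costate (w @ [i])"
    have "Ds (coinput w) + Rs (costate w) = ?b"
      unfolding coinput_def costate_rec[of w] by (simp add: lin_simps Rs_D Ds_square)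
    then have "Ds (coinput w) $ i + Ts i (costate w) = costate (w @ [i])"
      by (metis (no_types, lifting) Rs_component vec_lambda_beta vector_add_component)
    then show ?case by (simp add: state_snoc snoc lin_simps algebra_simps)
  qed simp
  show ?thesis
  proof (rule ell2_eqI)
    fix w
    have "- R (coinput w) + D (costate w) = coord u w"
      unfolding coinput_def costate_rec[of w] by (simp add: lin_simps R_Ds D_square)
    then show "coord (transfer 1 (Abs_ell2 coinput) 0) w = coord (u - poisson (costate [])) w"
      by (subst coord_transfer)
        (simp_all add: output_map_def coord_coinput st coord_poisson lin_simps algebra_simps)
  qed
qed

text \<open>The adjoint of \<open>char_fun\<close> is taken inside the smaller space, so its
  candidate value must lie there; \<open>Rs_D\<close> moves the defect space across.\<close>

lemma coinput_in_defect_star_space: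
  assumes "u \<in> fock_tensor (defect_space T)"
  shows "coinput w \<in> defect_star_space T"
proof -
  have "Rs ` closure (range D) \<subseteq> closure (Rs ` range D)"
    by (rule closure_bounded_linear_image_subset[OF bounded_clinear_bounded_linear[OF bounded_clinear_Rs]])
  also have "\<dots> \<subseteq> closure (range Ds)"
    by (rule closure_mono) (auto simp: Rs_D)
  finally have "Rs (coord u w) \<in> defect_star_space T"
    using assms unfolding fock_tensor_def defect_space_def defect_star_space_def by blast
  moreover have "Ds (\<chi> i. costate (w @ [i])) \<in> defect_star_space T"
    unfolding defect_star_space_def by (rule subsetD[OF closure_subset]) (rule rangeI)
  ultimately show ?thesis
    unfolding coinput_def
    by (intro complex_vector.subspace_add complex_vector.subspace_neg subspace_defect_star_space)
qed

text \<open>The argument of \<open>poisson\<close> is the adjoint of K applied to \<open>u\<close>,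
  so this is the identity I - \<Theta>\<Theta>^* = K K^* on finitely supported vectors.\<close>

lemma char_fun_char_fun_adj:
  assumes "u \<in> fock_tensor (defect_space T)"
  shows "char_fun T (char_fun_adj T u) = u - poisson (\<Sum>v\<in>words_lt m. foldr T v (D (coord u v)))"
proof -
  have "char_fun_adj T u = Abs_ell2 coinput"
    unfolding char_fun_adj_def
  proof (rule adj_onI)
    show "complex_vector.subspace (fock_tensor (defect_star_space T) :: ('n list, 'h ^ 'n) ell2 set)"
      by (rule subspace_fock_tensor[OF subspace_defect_star_space])
    show "Abs_ell2 coinput \<in> fock_tensor (defect_star_space T)"
      using coinput_in_defect_star_space[OF assms] by (simp add: fock_tensor_def coord_coinput)
  qed (simp add: char_fun_eq cinner_transfer_coinput)
  then show ?thesis by (simp add: char_fun_eq transfer_coinput costate_def)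
qed

end

end

section \<open>Dimension and growth\<close>

lemma dim_image_inj_on:
  fixes V :: "'a::complex_inner set" and A :: "'a \<Rightarrow> 'b::complex_inner"
  assumes A: "Vector_Spaces.linear scaleC scaleC A" and inj: "inj_on A (complex_vector.span V)"
  shows "complex_vector.dim (A ` V) = complex_vector.dim V"
proof -
  obtain B where B: "B \<subseteq> V" "complex_vector.independent B" "V \<subseteq> complex_vector.span B"
    "card B = complex_vector.dim V"
    using complex_vector.basis_exists .
  have span_B: "complex_vector.span B \<subseteq> complex_vector.span V"
    by (rule complex_vector.span_mono[OF B(1)])
  have "complex_vector.independent (A ` B)"
    by (rule complex_pair.linear_independent_injective_image[OF A B(2) inj_on_subset[OF inj span_B]])
  moreover have "A ` V \<subseteq> complex_vector.span (A ` B)"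
    unfolding complex_pair.linear_span_image[OF A] using B(3) by blast
  ultimately have "card (A ` B) = complex_vector.dim (A ` V)"
    using B(1) by (intro complex_vector.basis_card_eq_dim image_mono)
  moreover have "inj_on A B"
    using inj by (rule inj_on_subset) (use span_B complex_vector.span_superset in blast)
  ultimately show ?thesis using B(4) by (simp add: card_image)
qed

text \<open>A vector z orthogonal to the range of S has <z, S z> = 0, a sum of squares, so z is
  orthogonal to every \<open>g j\<close>. This is applied to the component of \<open>g j\<close>
  orthogonal to the range.\<close>

lemma range_gram_operator:
  fixes g :: "'j \<Rightarrow> 'a::complex_inner"
  assumes J: "finite J"
  shows "range (\<lambda>x. \<Sum>j\<in>J. cinner x (g j) *\<^sub>C g j) = complex_vector.span (g ` J)"
proof
  define S where "S x = (\<Sum>j\<in>J. cinner x (g j) *\<^sub>C g j)" for x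
  have S_span: "S x \<in> complex_vector.span (g ` J)" for x
    unfolding S_def
    by (intro complex_vector.span_sum complex_vector.span_scale complex_vector.span_base) blast
  then show "range (\<lambda>x. \<Sum>j\<in>J. cinner x (g j) *\<^sub>C g j) \<subseteq> complex_vector.span (g ` J)"
    unfolding S_def by blast
  have "Vector_Spaces.linear scaleC scaleC S"
    unfolding Vector_Spaces.linear_iff S_def
    by (simp add: complex_vector.vector_space_axioms cinner_simps scaleC_add_left sum.distrib
        complex_vector.scale_sum_right scaleC_scaleC)
  then have sub: "complex_vector.subspace (range S)"
    by (intro complex_pair.linear_subspace_image complex_vector.subspace_UNIV)
  obtain E where E: "finite E" "orthonormal E" "complex_vector.span E = range S"
    using finite_orthonormal_basis_subspace[OF sub _ finite_imageI[OF J]] S_span by blast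
  have "g j \<in> range S" if j: "j \<in> J" for j
  proof -
    define z where "z = g j - fproj E (g j)"
    have z: "cinner z s = 0" if "s \<in> range S" for s
      using cinner_diff_fproj_span[OF E(1,2)] that E(3) unfolding z_def by blast
    have "0 = cinner z (S z)" using z by simp
    also have "\<dots> = (\<Sum>j\<in>J. cnj (cinner z (g j)) * cinner z (g j))"
      by (simp add: S_def cinner_sum_right cinner_scaleC_right)
    also have "\<dots> = complex_of_real (\<Sum>j\<in>J. (cmod (cinner z (g j)))\<^sup>2)"
      by (simp add: complex_norm_square mult.commute del: of_real_power)
    finally have "(\<Sum>j\<in>J. (cmod (cinner z (g j)))\<^sup>2) = 0"
      by (metis of_real_eq_0_iff)
    then have "cinner z (g j) = 0" using J j by (simp add: sum_nonneg_eq_0_iff)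
    moreover have "fproj E (g j) \<in> range S"
      using fproj_in_span[OF E(1,2)] E(3) by blast
    ultimately have "cinner z z = 0"
      using z[of "fproj E (g j)"] by (subst (2) z_def) (simp add: cinner_diff_right)
    then have "g j = fproj E (g j)" by (simp add: cinner_eq_zero_iff z_def)
    then show ?thesis using \<open>fproj E (g j) \<in> range S\<close> by simp
  qed
  then show "complex_vector.span (g ` J) \<subseteq> range (\<lambda>x. \<Sum>j\<in>J. cinner x (g j) *\<^sub>C g j)"
    unfolding S_def[symmetric] using sub by (intro complex_vector.span_minimal) auto
qed

text \<open>A basis B of level m is extended to a basis B' of level m + 1. Since T_i maps B into
  level m + 1, only the images of the new vectors B' - B can add dimensions at level m + 2.\<close>

lemma dim_growth:
  fixes T :: "'n::finite \<Rightarrow> 'a::complex_inner \<Rightarrow> 'a" and G :: "nat \<Rightarrow> 'a set"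
  assumes T: "\<And>i. Vector_Spaces.linear scaleC scaleC (T i)"
    and G: "\<And>m. finite (G m)" "G 0 = {}" "\<And>m. G (Suc m) = G 1 \<union> (\<Union>i. T i ` G m)"
  defines "r \<equiv> \<lambda>m. real (complex_vector.dim (G m))"
  shows "r m \<le> r (Suc m)"
    and "r (Suc (Suc m)) - r (Suc m) \<le> real CARD('n) * (r (Suc m) - r m)"
proof -
  have mono: "G m \<subseteq> G (Suc m)" for m
  proof (induction m)
    case (Suc m)
    then have "(\<Union>i. T i ` G m) \<subseteq> (\<Union>i. T i ` G (Suc m))" by blast
    then show ?case unfolding G(3)[of m] G(3)[of "Suc m"] by (rule Un_mono[OF order_refl])
  qed (simp add: G(2))
  obtain B where B: "B \<subseteq> G m" "complex_vector.independent B" "G m \<subseteq> complex_vector.span B"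
    "card B = complex_vector.dim (G m)"
    using complex_vector.basis_exists .
  obtain B' where B': "B \<subseteq> B'" "B' \<subseteq> G (Suc m)" "complex_vector.independent B'"
    "G (Suc m) \<subseteq> complex_vector.span B'"
    using complex_vector.maximal_independent_subset_extend[OF order_trans[OF B(1) mono] B(2)] .
  have card_B': "card B' = complex_vector.dim (G (Suc m))"
    by (rule complex_vector.basis_card_eq_dim[OF B'(2,4,3)])
  have fin: "finite B'" using finite_subset[OF B'(2) G(1)] .
  show "r m \<le> r (Suc m)"
    unfolding r_def B(4)[symmetric] card_B'[symmetric] using card_mono[OF fin B'(1)] by simp
  define W where "W = B' \<union> (\<Union>i. T i ` (B' - B))"
  have B'W: "complex_vector.span B' \<subseteq> complex_vector.span W"
    by (intro complex_vector.span_mono) (simp add: W_def)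
  have "T i x \<in> complex_vector.span W" if x: "x \<in> G (Suc m)" for i x
  proof -
    have "T i b \<in> complex_vector.span W" if b: "b \<in> B'" for b
    proof (cases "b \<in> B")
      case True
      then have "T i b \<in> G (Suc m)" using B(1) unfolding G(3)[of m] by blast
      then show ?thesis using B'(4) B'W by blast
    next
      case False
      then show ?thesis using b by (intro complex_vector.span_base) (auto simp: W_def)
    qed
    then have "complex_vector.span (T i ` B') \<subseteq> complex_vector.span W"
      by (intro complex_vector.span_minimal complex_vector.subspace_span) blast
    moreover have "T i x \<in> complex_vector.span (T i ` B')"
      unfolding complex_pair.linear_span_image[OF T] using x B'(4) by blast
    ultimately show ?thesis by blast
  qed
  moreover have "G 1 \<subseteq> complex_vector.span W"
    using B'(4) B'W unfolding G(3)[of m] by blast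
  ultimately have "G (Suc (Suc m)) \<subseteq> complex_vector.span W"
    unfolding G(3)[of "Suc m"] by blast
  then have "complex_vector.dim (G (Suc (Suc m))) \<le> card W"
    by (rule complex_vector.dim_le_card) (simp add: W_def fin)
  also have "card W \<le> card B' + card (\<Union>i. T i ` (B' - B))"
    unfolding W_def by (rule card_Un_le)
  also have "card (\<Union>i. T i ` (B' - B)) \<le> (\<Sum>i\<in>UNIV. card (T i ` (B' - B)))"
    by (rule card_UN_le) simp
  also have "\<dots> \<le> (\<Sum>i\<in>(UNIV :: 'n set). card (B' - B))"
    using fin by (intro sum_mono card_image_le) simp
  also have "\<dots> = CARD('n) * (card B' - card B)"
    using card_Diff_subset[OF finite_subset[OF B'(1) fin] B'(1)] by simp
  finally have "complex_vector.dim (G (Suc (Suc m))) \<le> card B' + CARD('n) * (card B' - card B)"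
    by simp
  then have "r (Suc (Suc m)) \<le> real (card B' + CARD('n) * (card B' - card B))"
    unfolding r_def by (rule of_nat_mono)
  then show "r (Suc (Suc m)) - r (Suc m) \<le> real CARD('n) * (r (Suc m) - r m)"
    unfolding r_def B(4)[symmetric] card_B'[symmetric]
    using card_mono[OF fin B'(1)] by (simp add: of_nat_diff)
qed

section \<open>Limits of quotients and of weighted means\<close>

lemma weighted_mean_tendsto_0:
  fixes b q :: "nat \<Rightarrow> real"
  assumes b: "b \<longlonglongrightarrow> 0" and q: "\<And>k. 1 \<le> q k"
  shows "(\<lambda>m. (\<Sum>k<m. q k * b k) / (\<Sum>k<m. q k)) \<longlonglongrightarrow> 0"
proof (rule LIMSEQ_I)
  fix e :: real assume e: "e > 0"
  obtain N where N: "\<And>k. k \<ge> N \<Longrightarrow> \<bar>b k\<bar> < e / 2"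
    using LIMSEQ_D[OF b, of "e / 2"] e by auto
  define C where "C = (\<Sum>k<N. q k * \<bar>b k\<bar>)"
  \<comment> \<open>Weights at least 1 make the denominator at least m, so from M on it outweighs
    the head C; the tail is below e/2 by the choice of N.\<close>
  obtain M where M: "C < real M * (e / 2)" "M > 0"
  proof -
    obtain M where "C < real M * (e / 2)" using ex_less_of_nat_mult[of "e / 2" C] e by auto
    moreover have "C \<ge> 0"
      unfolding C_def using q by (intro sum_nonneg mult_nonneg_nonneg) (auto intro: order_trans[OF zero_le_one])
    ultimately show thesis using that[of M] e by (cases "M = 0") auto
  qed
  have "norm ((\<Sum>k<m. q k * b k) / (\<Sum>k<m. q k) - 0) < e" if m: "m \<ge> max M N" for m
  proof -
    have q0: "q k > 0" for k using q[of k] by linarith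
    have s: "real m \<le> (\<Sum>k<m. q k)"
      using sum_mono[of "{..<m}" "\<lambda>_. 1" q] q by simp
    then have s0: "0 < (\<Sum>k<m. q k)" using m M(2) by linarith
    have "\<bar>\<Sum>k<m. q k * b k\<bar> \<le> (\<Sum>k<m. q k * \<bar>b k\<bar>)"
      using sum_abs[of "\<lambda>k. q k * b k" "{..<m}"] q0 by (simp add: abs_mult less_imp_le)
    also have "\<dots> = C + (\<Sum>k\<in>{N..<m}. q k * \<bar>b k\<bar>)"
    proof -
      have "{..<m} = {..<N} \<union> {N..<m}" using m by auto
      then show ?thesis unfolding C_def by (metis finite_atLeastLessThan finite_lessThan
            ivl_disj_int_one(2) sum.union_disjoint)
    qed
    also have "(\<Sum>k\<in>{N..<m}. q k * \<bar>b k\<bar>) \<le> (\<Sum>k\<in>{N..<m}. q k * (e / 2))"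
      using N q0 by (intro sum_mono mult_left_mono) (auto intro: less_imp_le)
    also have "\<dots> \<le> (\<Sum>k<m. q k) * (e / 2)"
      unfolding sum_distrib_right[symmetric] using e q0
      by (intro mult_right_mono sum_mono2) (auto intro: less_imp_le)
    also have "C < (\<Sum>k<m. q k) * (e / 2)"
    proof -
      have "real M * (e / 2) \<le> (\<Sum>k<m. q k) * (e / 2)"
        using e s m by (intro mult_right_mono) auto
      then show ?thesis using M(1) by linarith
    qed
    finally have "\<bar>\<Sum>k<m. q k * b k\<bar> < e * (\<Sum>k<m. q k)" by simp
    then show ?thesis using s0 by (simp add: abs_divide pos_divide_less_eq)
  qed
  then show "\<exists>no. \<forall>m\<ge>no. norm ((\<Sum>k<m. q k * b k) / (\<Sum>k<m. q k) - 0) < e" by blast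
qed

text \<open>With d_k = n^k (d_k / n^k), the second quotient is the mean of the first with weights
  n^k, hence the common limit. This is why a mean over lengths < m can be replaced by the single
  length m in the curvature formula.\<close>

lemma growth_limits:
  fixes d :: "nat \<Rightarrow> real" and n :: real
  assumes n: "1 \<le> n" and d: "\<And>k. 0 \<le> d k" "\<And>k. d (Suc k) \<le> n * d k"
  obtains L where "(\<lambda>k. d k / n ^ k) \<longlonglongrightarrow> L" "(\<lambda>m. (\<Sum>k<m. d k) / (\<Sum>k<m. n ^ k)) \<longlonglongrightarrow> L"
proof -
  have "decseq (\<lambda>k. d k / n ^ k)"
  proof (rule decseq_SucI)
    fix k
    have "d (Suc k) / n ^ Suc k \<le> (n * d k) / n ^ Suc k"
      using n d(2) by (intro divide_right_mono) auto
    then show "d (Suc k) / n ^ Suc k \<le> d k / n ^ k" using n by simp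
  qed
  moreover have "\<forall>k. 0 \<le> d k / n ^ k" using n d(1) by simp
  ultimately obtain L where L: "(\<lambda>k. d k / n ^ k) \<longlonglongrightarrow> L"
    using decseq_convergent by blast
  have "(\<lambda>k. d k / n ^ k - L) \<longlonglongrightarrow> L - L" by (intro tendsto_intros L)
  then have "(\<lambda>m. (\<Sum>k<m. n ^ k * (d k / n ^ k - L)) / (\<Sum>k<m. n ^ k)) \<longlonglongrightarrow> 0"
    using n by (intro weighted_mean_tendsto_0) (simp_all add: one_le_power)
  then have "(\<lambda>m. (\<Sum>k<m. n ^ k * (d k / n ^ k - L)) / (\<Sum>k<m. n ^ k) + L) \<longlonglongrightarrow> 0 + L"
    by (intro tendsto_intros)
  moreover have "\<forall>\<^sub>F m in sequentially. (\<Sum>k<m. n ^ k * (d k / n ^ k - L)) / (\<Sum>k<m. n ^ k) + L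
      = (\<Sum>k<m. d k) / (\<Sum>k<m. n ^ k)"
    using eventually_gt_at_top[of 0]
  proof eventually_elim
    case (elim m)
    have "0 < (\<Sum>k<m. n ^ k)" using n elim by (intro sum_pos) auto
    moreover have "n ^ k * (d k / n ^ k - L) = d k - n ^ k * L" for k
      using n by (simp add: field_simps)
    ultimately show ?case
      by (simp add: sum_subtractf diff_divide_distrib flip: sum_distrib_right)
  qed
  ultimately have "(\<lambda>m. (\<Sum>k<m. d k) / (\<Sum>k<m. n ^ k)) \<longlonglongrightarrow> L"
    by (simp add: tendsto_cong)
  with L show thesis by (rule that)
qed

section \<open>Curvature and Euler characteristic\<close>

locale finite_defect = row_contr T for T :: "'n::finite \<Rightarrow> 'h::chilbert_space \<Rightarrow> 'h" +
  fixes F :: "'h set"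
  assumes F: "finite F" "orthonormal F" "complex_vector.span F = range (defect T)"
begin

lemma defect_space_eq: "defect_space T = complex_vector.span F"
  unfolding defect_space_def F(3)[symmetric] using closed_span_orthonormal[OF F(1,2)] by simp

lemma rank_defect: "rank_on UNIV D = card F"
  unfolding rank_on_def F(3)[symmetric]
  by (rule complex_vector.dim_span_eq_card_independent[OF orthonormal_independent[OF F(2)]])

abbreviation M :: "('n list, 'h) ell2 set" where
  "M \<equiv> fock_tensor (defect_space T)"

lemma subspace_M: "complex_vector.subspace M" and closed_M: "closed M"
  unfolding defect_space_eq
  by (intro subspace_fock_tensor closed_fock_tensor complex_vector.subspace_span
      closed_span_orthonormal F)+

lemma in_M_iff: "x \<in> M \<longleftrightarrow> (\<forall>w. coord x w \<in> complex_vector.span F)"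
  by (simp add: fock_tensor_def defect_space_eq)

definition vecs :: "nat \<Rightarrow> ('n list \<times> 'h) set" where
  "vecs m = words_lt m \<times> F"

definition gen :: "'n list \<times> 'h \<Rightarrow> 'h" where
  "gen = (\<lambda>(w, f). foldr T w (D f))"

lemma expand_F: "y \<in> complex_vector.span F \<Longrightarrow> y = (\<Sum>f\<in>F. cinner y f *\<^sub>C f)"
  using fproj_span[OF F(1,2)] by (simp add: fproj_def)

lemma D_expand: "D x = (\<Sum>f\<in>F. cinner x (D f) *\<^sub>C f)"
  using expand_F[of "D x"] F(3) by (simp add: cinner_D)

lemma bounded_clinear_foldr: "bounded_clinear (foldr T w)"
proof (induction w)
  case Nil
  then show ?case using bounded_clinear_id by (simp add: id_def)
next
  case (Cons i w)
  then show ?case using bounded_clinear_compose[OF bounded_clinear_T Cons] by (simp add: comp_def)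
qed

text \<open>I - \<Phi>^(m+1)(I) = \<Delta>^2 + \<Sum> T_i (I - \<Phi>^m(I)) T_i^*. The first term
  supplies the empty word, and T_i puts the letter i in front of the others.\<close>

lemma Phi_expand:
  "x - (Phi T ^^ m) id x = (\<Sum>w\<in>words_lt m. \<Sum>f\<in>F. cinner x (gen (w, f)) *\<^sub>C gen (w, f))"
proof (induction m arbitrary: x)
  case (Suc m)
  let ?S = "\<lambda>x. \<Sum>w\<in>words_lt m. \<Sum>f\<in>F. cinner x (gen (w, f)) *\<^sub>C gen (w, f)"
  have IH: "(Phi T ^^ m) id y = y - ?S y" for y
    unfolding Suc[of y, symmetric] by simp
  have "(Phi T ^^ Suc m) id x = (\<Sum>i\<in>UNIV. T i (Ts i x - ?S (Ts i x)))"
    by (simp add: Phi_def IH)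
  also have "\<dots> = R (Rs x) - (\<Sum>i\<in>UNIV. T i (?S (Ts i x)))"
    by (simp add: row_op_def Rs_component lin_simps sum_subtractf)
  finally have "x - (Phi T ^^ Suc m) id x = D (D x) + (\<Sum>i\<in>UNIV. T i (?S (Ts i x)))"
    by (simp add: D_square)
  also have "D (D x) = (\<Sum>f\<in>F. cinner x (gen ([], f)) *\<^sub>C gen ([], f))"
    by (subst D_expand) (simp add: lin_simps gen_def)
  also have "(\<Sum>i\<in>UNIV. T i (?S (Ts i x)))
      = (\<Sum>i\<in>UNIV. \<Sum>w\<in>words_lt m. \<Sum>f\<in>F. cinner x (gen (i # w, f)) *\<^sub>C gen (i # w, f))"
    by (simp add: lin_simps gen_def cinner_adj_left[OF bounded_clinear_T])
  finally show ?case by (simp add: sum_words_lt_Cons)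
qed simp

text \<open>The increment of the trace of I - \<Phi>^m(I) from m to m + 1.\<close>

definition c :: "nat \<Rightarrow> real" where
  "c m = (\<Sum>w\<in>words m. \<Sum>f\<in>F. (norm (gen (w, f)))\<^sup>2)"

lemma c_nonneg: "0 \<le> c m"
  unfolding c_def by (intro sum_nonneg) simp

lemma c_Suc_le: "c (Suc m) \<le> real CARD('n) * c m"
proof -
  have "c (Suc m) = (\<Sum>i\<in>UNIV. \<Sum>w\<in>words m. \<Sum>f\<in>F. (norm (T i (gen (w, f))))\<^sup>2)"
    unfolding c_def sum_words_Cons by (simp add: gen_def)
  also have "\<dots> \<le> (\<Sum>i\<in>(UNIV :: 'n set). \<Sum>w\<in>words m. \<Sum>f\<in>F. (norm (gen (w, f)))\<^sup>2)"
    by (intro sum_mono power_mono norm_T_le) simp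
  finally show ?thesis by (simp add: c_def)
qed

lemma trace_Phi: "trace_on UNIV (\<lambda>x. x - (Phi T ^^ m) id x) = of_real (\<Sum>k<m. c k)"
proof -
  have "trace_on UNIV (\<lambda>x. x - (Phi T ^^ m) id x) = (\<Sum>j\<in>vecs m. cinner (gen j) (gen j))"
    by (rule trace_on_finite_rank)
      (simp_all add: Phi_expand vecs_def sum.cartesian_product split_def)
  also have "\<dots> = of_real (\<Sum>w\<in>words_lt m. \<Sum>f\<in>F. (norm (gen (w, f)))\<^sup>2)"
    by (simp add: cinner_self vecs_def sum.cartesian_product split_def)
  finally show ?thesis by (simp add: sum_words_lt c_def)
qed

lemma poisson_in_M: "poisson h \<in> M"
  by (simp add: in_M_iff coord_poisson F(3))

lemma single_in_M: "f \<in> complex_vector.span F \<Longrightarrow> single w f \<in> M"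
  by (simp add: in_M_iff coord_single complex_vector.span_zero)

lemma foldr_D_expand:
  assumes "y \<in> complex_vector.span F"
  shows "foldr T w (D y) = (\<Sum>f\<in>F. cinner y f *\<^sub>C gen (w, f))"
  by (subst expand_F[OF assms])
    (simp add: lin_simps bounded_clinear_simps[OF bounded_clinear_foldr] gen_def)

text \<open>Expanding P_m \<otimes> I in the orthonormal vectors b_j = \<open>single w f\<close>
  gives rank one terms with a_j = b_j - K g_j, and <K g_j, b_j> is the squared norm of g_j by
  \<open>cinner_poisson\<close>.\<close>

lemma trace_char_fun:
  "trace_on M (\<lambda>x. char_fun T (char_fun_adj T (tensor_op (proj_hom m) id x)))
    = of_real (real (card F) * real CARD('n) ^ m - c m)"
proof -
  define J where "J = (words m :: 'n list set) \<times> F"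
  define b :: "'n list \<times> 'h \<Rightarrow> ('n list, 'h) ell2" where "b = (\<lambda>(w, f). single w f)"
  define a where "a j = b j - poisson (gen j)" for j
  have FM: "f \<in> complex_vector.span F" if "f \<in> F" for f
    using that by (rule complex_vector.span_base)
  have "trace_on M (\<lambda>x. char_fun T (char_fun_adj T (tensor_op (proj_hom m) id x)))
      = (\<Sum>j\<in>J. cinner (a j) (b j))"
  proof (rule trace_on_finite_rank[OF subspace_M closed_M])
    show bM: "b j \<in> M" if "j \<in> J" for j
      using that single_in_M FM by (auto simp: b_def J_def)
    show "a j \<in> M" if "j \<in> J" for j
      unfolding a_def by (intro complex_vector.subspace_diff subspace_M bM that poisson_in_M)
    fix x assume x: "x \<in> M"
    define u where "u = tensor_op (proj_hom m) id x"
    have u: "coord u w = (if length w = m then coord x w else 0)" for w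
      unfolding u_def by (rule coord_tensor_op_proj_hom)
    have uM: "u \<in> M" using x by (simp add: in_M_iff u complex_vector.span_zero)
    \<comment> \<open>\<open>Suc m\<close> is the cutoff because \<open>u\<close> lives on length
      exactly m, and the sum runs over strictly shorter words than the cutoff.\<close>
    have "(\<Sum>v\<in>words_lt (Suc m). foldr T v (D (coord u v)))
        = (\<Sum>v\<in>words m. foldr T v (D (coord x v)))"
    proof -
      have "(\<Sum>v\<in>words_lt m. foldr T v (D (coord u v))) = 0"
        by (intro sum.neutral)
          (simp add: u lin_simps bounded_clinear_zero[OF bounded_clinear_foldr])
      then show ?thesis by (simp add: sum_words_lt_Suc u)
    qed
    also have "\<dots> = (\<Sum>j\<in>J. cinner x (b j) *\<^sub>C gen j)"
      using x unfolding in_M_iff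
      by (simp add: foldr_D_expand J_def b_def cinner_single sum.cartesian_product split_def)
    finally have 1: "(\<Sum>v\<in>words_lt (Suc m). foldr T v (D (coord u v)))
        = (\<Sum>j\<in>J. cinner x (b j) *\<^sub>C gen j)" .
    have 2: "u = (\<Sum>j\<in>J. cinner x (b j) *\<^sub>C b j)"
    proof (rule ell2_eqI)
      fix v
      have "coord (\<Sum>j\<in>J. cinner x (b j) *\<^sub>C b j) v
          = (\<Sum>w\<in>words m. \<Sum>f\<in>F. cinner (coord x w) f *\<^sub>C (if v = w then f else 0))"
        by (simp add: J_def b_def cinner_single coord_single sum.cartesian_product split_def)
      also have "\<dots> = (\<Sum>w\<in>words m. if v = w then \<Sum>f\<in>F. cinner (coord x w) f *\<^sub>C f else 0)"
        by (intro sum.cong) auto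
      also have "\<dots> = coord u v"
        using expand_F[of "coord x v"] x by (simp add: u in_M_iff)
      finally show "coord u v = coord (\<Sum>j\<in>J. cinner x (b j) *\<^sub>C b j) v" ..
    qed
    have "char_fun T (char_fun_adj T u)
        = u - poisson (\<Sum>v\<in>words_lt (Suc m). foldr T v (D (coord u v)))"
      by (rule char_fun_char_fun_adj[OF _ uM]) (simp add: u)
    also have "\<dots> = (\<Sum>j\<in>J. cinner x (b j) *\<^sub>C b j) - (\<Sum>j\<in>J. cinner x (b j) *\<^sub>C poisson (gen j))"
      unfolding 1 using 2 by (simp add: bounded_clinear_simps[OF bounded_clinear_poisson])
    also have "\<dots> = (\<Sum>j\<in>J. cinner x (b j) *\<^sub>C a j)"
      by (simp add: a_def complex_vector.scale_right_diff_distrib sum_subtractf)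
    finally show "char_fun T (char_fun_adj T (tensor_op (proj_hom m) id x)) = (\<Sum>j\<in>J. cinner x (b j) *\<^sub>C a j)"
      by (simp only: u_def)
  qed
  also have "\<dots> = (\<Sum>j\<in>J. of_real (1 - (norm (gen j))\<^sup>2))"
  proof (rule sum.cong)
    fix j assume "j \<in> J"
    then obtain w f where j: "j = (w, f)" "f \<in> F" by (auto simp: J_def)
    have "cinner f f = 1" using orthonormal_cinner[OF F(2) j(2) j(2)] by simp
    then show "cinner (a j) (b j) = of_real (1 - (norm (gen j))\<^sup>2)"
      by (simp add: j a_def b_def cinner_single coord_single cinner_diff_left cinner_poisson)
        (simp add: gen_def cinner_self)
  qed simp
  also have "\<dots> = of_real (\<Sum>j\<in>J. 1 - (norm (gen j))\<^sup>2)" by simp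
  also have "(\<Sum>j\<in>J. 1 - (norm (gen j))\<^sup>2) = real (card J) - (\<Sum>j\<in>J. (norm (gen j))\<^sup>2)"
    by (simp add: sum_subtractf)
  also have "\<dots> = real (card F) * real CARD('n) ^ m - c m"
    by (simp add: J_def card_cartesian_product card_words c_def sum.cartesian_product split_def)
  finally show ?thesis .
qed

definition G :: "nat \<Rightarrow> 'h set" where
  "G m = gen ` vecs m"

lemma finite_G: "finite (G m)"
  by (simp add: G_def vecs_def F)

lemma G_Suc: "G (Suc m) = G 1 \<union> (\<Union>i. T i ` G m)"
proof -
  \<comment> \<open>Case split on the word: the empty word yields \<Delta> f, any other word has a
    first letter. As \<open>G 0\<close> is empty, the \<Delta> f alone make up
    \<open>G 1\<close>.\<close>
  have *: "G (Suc m) = (\<lambda>f. D f) ` F \<union> (\<Union>i. T i ` G m)" for m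
    unfolding G_def vecs_def words_lt_Suc_Cons by (auto simp: gen_def image_iff split: prod.splits) force+
  have "G 0 = {}" by (simp add: G_def vecs_def)
  then show ?thesis using *[of m] *[of 0] by simp
qed

lemma rank_Phi: "rank_on UNIV (\<lambda>x. x - (Phi T ^^ m) id x) = complex_vector.dim (G m)"
proof -
  have "(\<lambda>x. x - (Phi T ^^ m) id x) = (\<lambda>x. \<Sum>j\<in>vecs m. cinner x (gen j) *\<^sub>C gen j)"
    by (simp add: Phi_expand vecs_def sum.cartesian_product split_def)
  then have "range (\<lambda>x. x - (Phi T ^^ m) id x) = complex_vector.span (G m)"
    unfolding G_def by (simp only:) (rule range_gram_operator, simp add: vecs_def F)
  then show ?thesis by (simp add: rank_on_def)
qed

text \<open>By \<open>cinner_poisson\<close> a vector killed by K is orthogonal to all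
  \<open>gen (w, f)\<close>; if it also lies in their span, it is orthogonal to itself.\<close>

lemma inj_on_poisson: "inj_on poisson (complex_vector.span (G m))"
proof -
  have "y = 0" if y: "y \<in> complex_vector.span (G m)" "poisson y = 0" for y
  proof -
    have gen: "cinner y (gen (w, f)) = 0" for w f
      using cinner_poisson[of y w f] y(2) by (simp add: gen_def)
    have "cinner y s = 0" if "s \<in> complex_vector.span (G m)" for s
      using that
    proof (induction s rule: complex_vector.span_induct_alt)
      case (step c x y)
      then show ?case using gen by (auto simp: cinner_simps G_def)
    qed simp
    then show ?thesis using y(1) cinner_eq_zero_iff by blast
  qed
  then show ?thesis
    using complex_pair.linear_inj_on_iff_eq_0[OF bounded_clinear_clinear[OF bounded_clinear_poisson]
        complex_vector.subspace_span] by blast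
qed

text \<open>On \<open>M\<close> the operator is K after S, where S is the adjoint of K cut off at
  length m. S maps \<open>M\<close> onto the span of \<open>G (Suc m)\<close>, and K is injective
  there.\<close>

lemma rank_char_fun:
  "rank_on M (\<lambda>x. tensor_op (proj_le m) id x - char_fun T (char_fun_adj T (tensor_op (proj_le m) id x)))
    = complex_vector.dim (G (Suc m))"
proof -
  define S where "S x = (\<Sum>v\<in>words_lt (Suc m). foldr T v (D (coord x v)))" for x
  have eq: "tensor_op (proj_le m) id x - char_fun T (char_fun_adj T (tensor_op (proj_le m) id x))
      = poisson (S x)" if x: "x \<in> M" for x
  proof -
    define u where "u = tensor_op (proj_le m) id x"
    have u: "coord u w = (if length w \<le> m then coord x w else 0)" for w
      unfolding u_def by (rule coord_tensor_op_proj_le)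
    have uM: "u \<in> M" using x by (simp add: in_M_iff u complex_vector.span_zero)
    have "char_fun T (char_fun_adj T u)
        = u - poisson (\<Sum>v\<in>words_lt (Suc m). foldr T v (D (coord u v)))"
      by (rule char_fun_char_fun_adj[OF _ uM]) (simp add: u)
    also have "(\<Sum>v\<in>words_lt (Suc m). foldr T v (D (coord u v))) = S x"
      unfolding S_def by (intro sum.cong) (auto simp: u)
    finally show ?thesis by (simp add: u_def)
  qed
  have S_linear: "Vector_Spaces.linear scaleC scaleC S"
    unfolding S_def
    by (intro bounded_clinear_clinear bounded_clinear_sum_op bounded_clinear_compose[OF bounded_clinear_foldr]
        bounded_clinear_compose[OF bounded_clinear_D] bounded_clinear_coord)
  have "S ` M = complex_vector.span (G (Suc m))"
  proof (intro equalityI)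
    show "S ` M \<subseteq> complex_vector.span (G (Suc m))"
    proof clarify
      fix x assume x: "x \<in> M"
      show "S x \<in> complex_vector.span (G (Suc m))"
        unfolding S_def
      proof (rule complex_vector.span_sum)
        fix v :: "'n list" assume v: "v \<in> words_lt (Suc m)"
        have "foldr T v (D (coord x v)) = (\<Sum>f\<in>F. cinner (coord x v) f *\<^sub>C gen (v, f))"
          using x unfolding in_M_iff by (intro foldr_D_expand) blast
        also have "\<dots> \<in> complex_vector.span (G (Suc m))"
          using v by (intro complex_vector.span_sum complex_vector.span_scale complex_vector.span_base)
            (auto simp: G_def vecs_def)
        finally show "foldr T v (D (coord x v)) \<in> complex_vector.span (G (Suc m))" .
      qed
    qed
    show "complex_vector.span (G (Suc m)) \<subseteq> S ` M"
    proof (rule complex_vector.span_minimal)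
      show "complex_vector.subspace (S ` M)"
        by (rule complex_pair.linear_subspace_image[OF S_linear subspace_M])
      have "gen (w, f) \<in> S ` M" if wf: "w \<in> words_lt (Suc m)" "f \<in> F" for w f
      proof (rule image_eqI)
        show "single w f \<in> M" using wf by (intro single_in_M complex_vector.span_base)
        have "S (single w f) = (\<Sum>v\<in>words_lt (Suc m). if v = w then foldr T w (D f) else 0)"
          unfolding S_def
          by (intro sum.cong) (auto simp: coord_single lin_simps bounded_clinear_zero[OF bounded_clinear_foldr])
        then show "gen (w, f) = S (single w f)" using wf by (simp add: gen_def)
      qed
      then show "G (Suc m) \<subseteq> S ` M" by (auto simp: G_def vecs_def)
    qed
  qed
  then have "(\<lambda>x. poisson (S x)) ` M = poisson ` complex_vector.span (G (Suc m))"
    by (metis image_image)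
  moreover have "complex_vector.dim (poisson ` complex_vector.span (G (Suc m)))
      = complex_vector.dim (complex_vector.span (G (Suc m)))"
    by (rule dim_image_inj_on[OF bounded_clinear_clinear[OF bounded_clinear_poisson]])
      (simp add: complex_vector.span_span inj_on_poisson)
  ultimately show ?thesis
    unfolding rank_on_def by (simp add: eq cong: image_cong)
qed

lemma curvature_formula:
  defines "A \<equiv> \<lambda>m. trace_on M (\<lambda>x. char_fun T (char_fun_adj T (tensor_op (proj_hom m) id x)))
      / of_nat CARD('n) ^ m"
  shows "convergent A \<and> complex_of_real (curv T) = of_nat (rank_on UNIV D) - lim A"
proof -
  have n: "1 \<le> real CARD('n)" by (simp add: Suc_le_eq)
  obtain L where L: "(\<lambda>k. c k / real CARD('n) ^ k) \<longlonglongrightarrow> L"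
    "(\<lambda>m. (\<Sum>k<m. c k) / (\<Sum>k<m. real CARD('n) ^ k)) \<longlonglongrightarrow> L"
    using growth_limits[where d = c, OF n c_nonneg c_Suc_le] .
  have curv: "curv T = L"
    unfolding curv_def trace_Phi by (rule limI) (use L(2) in simp)
  have "A = (\<lambda>m. of_real (real (card F) - c m / real CARD('n) ^ m))"
    unfolding A_def trace_char_fun by (auto simp: diff_divide_distrib)
  moreover have "(\<lambda>m. complex_of_real (real (card F) - c m / real CARD('n) ^ m))
      \<longlonglongrightarrow> of_real (real (card F) - L)"
    by (intro tendsto_intros L(1))
  ultimately have "A \<longlonglongrightarrow> of_real (real (card F) - L)" by simp
  then show ?thesis
    using curv by (auto simp: convergent_def limI rank_defect)
qed

lemma euler_char_formula:
  defines "E \<equiv> \<lambda>m. real (rank_on M (\<lambda>x. tensor_op (proj_le m) id x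
        - char_fun T (char_fun_adj T (tensor_op (proj_le m) id x)))) / (\<Sum>k\<le>m. real CARD('n) ^ k)"
  shows "convergent E \<and> euler_char T = lim E"
proof -
  define r where "r m = real (complex_vector.dim (G m))" for m
  have G0: "G 0 = {}" by (simp add: G_def vecs_def)
  \<comment> \<open>With r 0 = 0 the increments telescope to the rank itself.\<close>
  have r0: "r 0 = 0" using complex_vector.dim_le_card[of "{}" "{}"] by (simp add: r_def G0)
  note growth = dim_growth[OF bounded_clinear_clinear[OF bounded_clinear_T] finite_G G0 G_Suc,
      folded r_def]
  have n: "1 \<le> real CARD('n)" by (simp add: Suc_le_eq)
  have "0 \<le> r (Suc k) - r k" for k using growth(1)[of k] by simp
  then obtain L where "(\<lambda>m. (\<Sum>k<m. r (Suc k) - r k) / (\<Sum>k<m. real CARD('n) ^ k)) \<longlonglongrightarrow> L"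
    using growth_limits[where d = "\<lambda>k. r (Suc k) - r k", OF n _ growth(2)] by metis
  then have L: "(\<lambda>m. r m / (\<Sum>k<m. real CARD('n) ^ k)) \<longlonglongrightarrow> L"
    by (simp add: sum_lessThan_telescope r0)
  have "euler_char T = L"
    unfolding euler_char_def rank_Phi by (rule limI) (use L in \<open>simp add: r_def\<close>)
  \<comment> \<open>Length at most m means length below m + 1, so \<open>E\<close> is the Euler
    quotient shifted by one, numerator and denominator alike.\<close>
  moreover have "E \<longlonglongrightarrow> L"
    using LIMSEQ_Suc[OF L] unfolding E_def rank_char_fun r_def by (simp only: lessThan_Suc_atMost)
  ultimately show ?thesis by (auto simp: convergent_def limI)
qed

end

theorem theorem3p4:
  fixes T :: "'n::finite \<Rightarrow> 'h::chilbert_space \<Rightarrow> 'h"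
  assumes "\<And>i. bounded_clinear (T i)"
    and "row_contraction T"
    and "finite_rank_on UNIV (defect T)"
  defines "A \<equiv> \<lambda>m. trace_on (fock_tensor (defect_space T))
                 (\<lambda>x. char_fun T (char_fun_adj T (tensor_op (proj_hom m) id x)))
               / of_nat CARD('n) ^ m"
    and "E \<equiv> \<lambda>m. real (rank_on (fock_tensor (defect_space T))
                 (\<lambda>x. tensor_op (proj_le m) id x
                    - char_fun T (char_fun_adj T (tensor_op (proj_le m) id x))))
               / (\<Sum>k\<le>m. real CARD('n) ^ k)"
  shows "(convergent A \<and> complex_of_real (curv T) = of_nat (rank_on UNIV (defect T)) - lim A)
       \<and> (convergent E \<and> euler_char T = lim E)"
proof -
  interpret row_contr T
    by unfold_locales (fact assms)+
  obtain S where S: "finite S" "range (defect T) \<subseteq> complex_vector.span S"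
    using assms(3) unfolding finite_rank_on_def by blast
  have "complex_vector.subspace (range (defect T))"
    by (intro complex_pair.linear_subspace_image bounded_clinear_clinear bounded_clinear_D
        complex_vector.subspace_UNIV)
  then obtain F where "finite F" "orthonormal F" "complex_vector.span F = range (defect T)"
    using finite_orthonormal_basis_subspace S by metis
  then interpret finite_defect T F
    by unfold_locales
  show ?thesis
    unfolding A_def E_def using curvature_formula euler_char_formula by blast
qed

end
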